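(* Let $$F^{\widehat V}_{g,n}(\mathbf t)=\int_{\mathbb R_+^n}\widehat V_{g,n}(\mathbf b)e^{-\mathbf b\cdot\mathbf t}\,d\mathbf b$$ be the Laplace transform of the super volume $\widehat V_{g,n}$. Let $g\ge0$, $n\ge1$ with $2g-2+n\ge2$, and $\mathbf t=(t_1,\dots,t_{n-1})$. (1) The recursion (SW) for the super volumes (see context) implies the recursion $$\text{(A)}\quad -\frac{\partial}{\partial t}F^{\widehat V}_{g,n}(t,\mathbf t)=\mathsf P_t\!\left(\frac12\sec(2\pi t)\left.\frac{\partial^2}{\partial t\,\partial t'}F^{\widehat V}_{g-1,n+1}(t,t',\mathbf t)\right|_{t'=t}\right)+\sum_{\substack{g_1+g_2=g\\ \mathbf t_1\sqcup\mathbf t_2=\mathbf t}}\mathsf P_t\!\left(\frac12\sec(2\pi t)\frac{\partial F^{\widehat V}_{g_1,n_1}}{\partial t}(t,\mathbf t_1)\,\frac{\partial F^{\widehat V}_{g_2,n_2}}{\partial t}(t,\mathbf t_2)\right)+\sum_{j=1}^{n-1}\mathsf P_t\!\left(\frac{t_j\sec(2\pi t)}{t^2-t_j^2}\frac{\partial}{\partial t}F^{\widehat V}_{g,n-1}(t,\mathbf t\setminus t_j)\right).$$ (2) The recursion (N) for the super volumes (see context) implies the recursion $$\text{(B)}\quad -\mathsf P_t\!\left(\cos(2\pi t)\frac{\partial}{\partial t}F^{\widehat V}_{g,n}(t,\mathbf t)\right)=\frac12\left.\frac{\partial^2}{\partial t\,\partial t'}F^{\widehat V}_{g-1,n+1}(t,t',\mathbf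 t)\right|_{t'=t}+\frac12\sum_{\substack{g_1+g_2=g\\ \mathbf t_1\sqcup\mathbf t_2=\mathbf t}}\frac{\partial F^{\widehat V}_{g_1,n_1}}{\partial t}(t,\mathbf t_1)\,\frac{\partial F^{\widehat V}_{g_2,n_2}}{\partial t}(t,\mathbf t_2)+\sum_{j=1}^{n-1}\frac{t_j}{t^2-t_j^2}\left(\frac{\partial}{\partial t}F^{\widehat V}_{g,n-1}(t,\mathbf t\setminus t_j)-\frac{\partial}{\partial t_j}F^{\widehat V}_{g,n-1}(\mathbf t)\right).$$ Moreover, (A) and (B) are equivalent (as relations among symmetric functions $F_{g,n}$ that are polynomials in $t_1^{-1},\dots,t_n^{-1}$, odd in each $t_i^{-1}$).
   Context: For $g\ge0$, $n\ge1$, $2g-2+n\ge1$, $\widehat V_{g,n}(b_1,\dots,b_n)$ is the super volume of the moduli space of super hyperbolic surfaces of genus $g$ with $n$ Neveu–Schwarz geodesic boundary components of lengths $b_1,\dots,b_n$, in Norbury's normalization $\widehat V_{g,n}=(-1)^n2^{g-1+n}V^{SW}_{g,n}$ ($V^{SW}$ the Stanford–Witten super volume). It is a symmetric polynomial, even in each variable; $\widehat V_{0,n}=0$ for $n\ge3$, $\widehat V_{1,1}=\frac18$. The recursions referred to, for $2g-2+n\ge2$, are the Stanford–Witten recursion (SW): $$2\pi b\,\widehat V_{g,n}(b,\mathbf b)=\frac12\int_0^\infty\!\!\int_0^\infty b'b''\widehat V_{g-1,n+1}(b',b'',\mathbf b)\widehat H(b'+b'',b)\,db'db''+\frac12\sum_{\substack{g_1+g_2=g\\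 \mathbf b_1\sqcup\mathbf b_2=\mathbf b}}\int_0^\infty\!\!\int_0^\infty b'b''\widehat V_{g_1,n_1}(b',\mathbf b_1)\widehat V_{g_2,n_2}(b'',\mathbf b_2)\widehat H(b'+b'',b)\,db'db''+\frac12\sum_{j=1}^{n-1}\int_0^\infty b'\widehat V_{g,n-1}(b',\mathbf b\setminus b_j)\big(\widehat H(b',b+b_j)+\widehat H(b',b-b_j)\big)db',$$ $\widehat H(x,y)=\frac12\left(\frac1{\cosh\frac{x-y}4}-\frac1{\cosh\frac{x+y}4}\right)$; and the recursion (N): $$-\frac12\Big((b+2\pi i)\widehat V_{g,n}(b+2\pi i,\mathbf b)+(b-2\pi i)\widehat V_{g,n}(b-2\pi i,\mathbf b)\Big)=\frac12\int_0^b b'(b-b')\widehat V_{g-1,n+1}(b',b-b',\mathbf b)\,db'+\frac12\sum_{\substack{g_1+g_2=g\\ \mathbf b_1\sqcup\mathbf b_2=\mathbf b}}\int_0^b b'(b-b')\widehat V_{g_1,n_1}(b',\mathbf b_1)\widehat V_{g_2,n_2}(b-b',\mathbf b_2)\,db'+\frac12\sum_{j=1}^{n-1}\Big((b+b_j)\widehat V_{g,n-1}(b+b_j,\mathbf b\setminus b_j)+(b-b_j)\widehat V_{g,n-1}(b-b_j,\mathbf b\setminus b_j)\Big).$$ Conventions: $\mathbf b=(b_1,\dots,b_{n-1})$; $\mathbf b\setminus b_j$ (resp. $\mathbf t\setminus t_j$) means the entry is removed; sums over $g_1+g_2=g$ and $\mathbf b_1\sqcup\mathbf b_2=\mathbf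 b$ (resp. $\mathbf t_1\sqcup\mathbf t_2=\mathbf t$) run over ordered pairs of nonnegative integers and ordered set partitions, $n_i=|\mathbf b_i|+1$ (resp. $|\mathbf t_i|+1$); terms involving $(g',n')$ with $g'<0$ or $2g'-2+n'\le0$ are zero. The Laplace integrals converge for $\mathrm{Re}\,t_i>0$ and are identified with the resulting polynomials in $t_i^{-1}$. $\mathsf P_t$ denotes the principal part (the negative powers of $t$) of the Laurent expansion at $t=0$, with the $t_j\neq0$ fixed.
   Formalization: The left side of (N) is taken with +1/2 instead of the printed −1/2: with the printed sign and V_{1,1}=1/8, (N) at (g,n)=(1,2) gives V_{1,2}=−1/8, whereas (SW) and (B) both give V_{1,2}=1/8, so (N) would not imply (B). *)

theory Defs
  imports "HOL-Analysis.Analysis" "HOL-Complex_Analysis.Complex_Analysis"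
begin

text \<open>
  A family of functions (of a genus and finitely many complex variables) is a map
  \<open>nat \<Rightarrow> complex list \<Rightarrow> complex\<close>; the member with indices \<open>(g, n)\<close> is its restriction to genus
  \<open>g\<close> and lists of length \<open>n\<close>. Only stable indices, \<open>2g - 2 + n \<ge> 1\<close>, are meaningful; in the
  recursions every other member is replaced by zero.
\<close>

definition stable :: "nat \<Rightarrow> nat \<Rightarrow> bool" where
  "stable g n \<longleftrightarrow> n \<ge> 1 \<and> 2 * g + n \<ge> 3"

definition stable_part :: "(nat \<Rightarrow> complex list \<Rightarrow> complex) \<Rightarrow> nat \<Rightarrow> complex list \<Rightarrow> complex" where
  "stable_part V g xs = (if stable g (length xs) then V g xs else 0)"

text \<open>
  In the sums over ordered partitions of a list \<open>xs\<close> into two sublists, the first part is given by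
  its set of positions \<open>I\<close>, so that the parts are \<open>nths xs I\<close> and \<open>nths xs (- I)\<close>. Similarly
  \<open>nths xs (- {j})\<close> is \<open>xs\<close> with its entry at position \<open>j\<close> removed.
\<close>


subsection \<open>Polynomials in several variables\<close>

definition polynomial_in :: "nat \<Rightarrow> (complex list \<Rightarrow> complex) \<Rightarrow> bool" where
  "polynomial_in n f \<longleftrightarrow>
     (\<exists>(A :: (nat \<Rightarrow> nat) set) c. finite A \<and>
        (\<forall>xs. length xs = n \<longrightarrow> f xs = (\<Sum>\<alpha>\<in>A. c \<alpha> * (\<Prod>i<n. xs ! i ^ \<alpha> i))))"

definition polynomial_in_inverses :: "nat \<Rightarrow> (complex list \<Rightarrow> complex) \<Rightarrow> bool" where
  "polynomial_in_inverses n F \<longleftrightarrow>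
     (\<exists>p. polynomial_in n p \<and>
        (\<forall>ts. length ts = n \<and> 0 \<notin> set ts \<longrightarrow> F ts = p (map inverse ts)))"


subsection \<open>Super volumes and their Laplace transforms\<close>

text \<open>
  The properties of the super volumes that are independent of any recursion. Lengths are complex
  variables here because one of the recursions shifts them by \<open>\<plusminus> 2 \<pi> \<i>\<close>.
\<close>

definition super_volume_family :: "(nat \<Rightarrow> complex list \<Rightarrow> complex) \<Rightarrow> bool" where
  "super_volume_family V \<longleftrightarrow>
     (\<forall>g n. stable g n \<longrightarrow>
        polynomial_in n (V g) \<and>
        (\<forall>bs cs. length bs = n \<and> mset cs = mset bs \<longrightarrow> V g cs = V g bs) \<and>
        (\<forall>bs i. length bs = n \<and> i < n \<longrightarrow> V g (bs[i := - (bs ! i)]) = V g bs)) \<and>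
     (\<forall>bs. length bs \<ge> 3 \<longrightarrow> V 0 bs = 0) \<and>
     (\<forall>b. V 1 [b] = 1 / 8)"

text \<open>
  \<open>F\<close> is the Laplace transform of \<open>f\<close> in \<open>n\<close> variables: the polynomial in the \<open>1 / t\<^sub>i\<close> that the
  Laplace integral equals where \<open>Re t\<^sub>i > 0\<close>. This determines \<open>F\<close> at all lists of length \<open>n\<close> with
  nonzero entries.
\<close>

definition is_laplace_transform ::
    "nat \<Rightarrow> (complex list \<Rightarrow> complex) \<Rightarrow> (complex list \<Rightarrow> complex) \<Rightarrow> bool" where
  "is_laplace_transform n f F \<longleftrightarrow>
     polynomial_in_inverses n F \<and>
     (\<forall>ts. length ts = n \<and> (\<forall>t\<in>set ts. Re t > 0) \<longrightarrow>
        F ts = (LINT b:(\<Pi>\<^sub>E i\<in>{..<n}. {0<..})|(\<Pi>\<^sub>M i\<in>{..<n}. lborel).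
                  f (map (\<lambda>i. complex_of_real (b i)) [0..<n]) *
                  exp (- (\<Sum>i<n. complex_of_real (b i) * ts ! i))))"

definition laplace_transform_family ::
    "(nat \<Rightarrow> complex list \<Rightarrow> complex) \<Rightarrow> (nat \<Rightarrow> complex list \<Rightarrow> complex) \<Rightarrow> bool" where
  "laplace_transform_family V F \<longleftrightarrow>
     (\<forall>g n. stable g n \<longrightarrow> is_laplace_transform n (V g) (F g))"

definition symmetric_odd_inverse_family :: "(nat \<Rightarrow> complex list \<Rightarrow> complex) \<Rightarrow> bool" where
  "symmetric_odd_inverse_family F \<longleftrightarrow>
     (\<forall>g n. stable g n \<longrightarrow>
        polynomial_in_inverses n (F g) \<and>
        (\<forall>ts us. length ts = n \<and> 0 \<notin> set ts \<and> mset us = mset ts \<longrightarrow> F g us = F g ts) \<and>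
        (\<forall>ts i. length ts = n \<and> 0 \<notin> set ts \<and> i < n \<longrightarrow>
           F g (ts[i := - (ts ! i)]) = - F g ts))"


subsection \<open>The recursions for the volumes\<close>

definition kernel_H :: "real \<Rightarrow> real \<Rightarrow> real" where
  "kernel_H x y = 1/2 * (1 / cosh ((x - y) / 4) - 1 / cosh ((x + y) / 4))"

definition recursion_SW :: "(nat \<Rightarrow> complex list \<Rightarrow> complex) \<Rightarrow> nat \<Rightarrow> nat \<Rightarrow> bool" where
  "recursion_SW V g n \<longleftrightarrow>
     (\<forall>(b :: real) (bs :: real list). b > 0 \<and> length bs = n - 1 \<and> (\<forall>x\<in>set bs. x > 0) \<longrightarrow>
        (let W = (\<lambda>h xs. stable_part V h (map complex_of_real xs)) in
         2 * of_real pi * of_real b * W g (b # bs) =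
           (if g = 0 then 0 else
              1/2 * (LINT x:{0<..}|lborel. LINT y:{0<..}|lborel.
                 of_real (x * y) * W (g - 1) (x # y # bs) * of_real (kernel_H (x + y) b)))
         + 1/2 * (\<Sum>g1\<le>g. \<Sum>I\<in>Pow {..<length bs}.
              LINT x:{0<..}|lborel. LINT y:{0<..}|lborel.
                 of_real (x * y) * W g1 (x # nths bs I) * W (g - g1) (y # nths bs (- I)) *
                 of_real (kernel_H (x + y) b))
         + 1/2 * (\<Sum>j<length bs.
              LINT x:{0<..}|lborel.
                 of_real x * W g (x # nths bs (- {j})) *
                 of_real (kernel_H x (b + bs ! j) + kernel_H x (b - bs ! j)))))"

text \<open>
  Pitfall: this recursion is sometimes displayed with an extra factor \<open>-1\<close> on its left-hand side.
  That sign belongs to the family \<open>(-1)\<^sup>n V\<close>; the family \<open>V\<close> normalised by \<open>V\<^sub>1\<^sub>,\<^sub>1 = 1/8\<close>, which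
  satisfies the recursion above, satisfies the one below. For instance \<open>V\<^sub>1\<^sub>,\<^sub>2 = 1/8\<close>, and at
  \<open>(g, n) = (1, 2)\<close> both sides below equal \<open>b / 8\<close>.
\<close>

definition recursion_N :: "(nat \<Rightarrow> complex list \<Rightarrow> complex) \<Rightarrow> nat \<Rightarrow> nat \<Rightarrow> bool" where
  "recursion_N V g n \<longleftrightarrow>
     (\<forall>(b :: real) (bs :: real list). b > 0 \<and> length bs = n - 1 \<and> (\<forall>x\<in>set bs. x > 0) \<longrightarrow>
        (let W = (\<lambda>h xs. stable_part V h (map complex_of_real xs));
             bp = complex_of_real b + 2 * of_real pi * \<i>;
             bm = complex_of_real b - 2 * of_real pi * \<i> in
         1/2 * (bp * stable_part V g (bp # map of_real bs)
              + bm * stable_part V g (bm # map of_real bs)) =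
           (if g = 0 then 0 else
              1/2 * (LINT x:{0..b}|lborel.
                 of_real (x * (b - x)) * W (g - 1) (x # (b - x) # bs)))
         + 1/2 * (\<Sum>g1\<le>g. \<Sum>I\<in>Pow {..<length bs}.
              LINT x:{0..b}|lborel.
                 of_real (x * (b - x)) * W g1 (x # nths bs I) *
                 W (g - g1) ((b - x) # nths bs (- I)))
         + 1/2 * (\<Sum>j<length bs.
              of_real (b + bs ! j) * W g ((b + bs ! j) # nths bs (- {j}))
            + of_real (b - bs ! j) * W g ((b - bs ! j) # nths bs (- {j})))))"


subsection \<open>The recursions for the Laplace transforms\<close>

text \<open>The principal part at \<open>0\<close> of \<open>f\<close>, evaluated at \<open>t\<close>.\<close>

definition principal_part :: "(complex \<Rightarrow> complex) \<Rightarrow> complex \<Rightarrow> complex" where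
  "principal_part f t = poly (fls_prpart (laurent_expansion f 0)) (inverse t)"

definition csec :: "complex \<Rightarrow> complex" where
  "csec z = 1 / cos z"

text \<open>The derivative of \<open>F\<^sub>g(t, ts)\<close> in its first variable.\<close>

definition d1 :: "(nat \<Rightarrow> complex list \<Rightarrow> complex) \<Rightarrow> nat \<Rightarrow> complex \<Rightarrow> complex list \<Rightarrow> complex" where
  "d1 F g t ts = deriv (\<lambda>u. stable_part F g (u # ts)) t"

text \<open>
  The mixed derivative of \<open>F\<^sub>g(t, t', ts)\<close> in its first two variables, restricted to the diagonal
  \<open>t' = t\<close>; note that \<open>t\<close> is a constant inside the outer derivative.
\<close>

definition d12_diag :: "(nat \<Rightarrow> complex list \<Rightarrow> complex) \<Rightarrow> nat \<Rightarrow> complex \<Rightarrow> complex list \<Rightarrow> complex" where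
  "d12_diag F g t ts = deriv (\<lambda>u. deriv (\<lambda>v. stable_part F g (u # v # ts)) t) t"

definition recursion_A :: "(nat \<Rightarrow> complex list \<Rightarrow> complex) \<Rightarrow> nat \<Rightarrow> nat \<Rightarrow> bool" where
  "recursion_A F g n \<longleftrightarrow>
     (\<forall>t ts. t \<noteq> 0 \<and> length ts = n - 1 \<and> 0 \<notin> set ts \<longrightarrow>
        - d1 F g t ts =
           (if g = 0 then 0 else
              principal_part (\<lambda>u. 1/2 * csec (2 * of_real pi * u) * d12_diag F (g - 1) u ts) t)
         + (\<Sum>g1\<le>g. \<Sum>I\<in>Pow {..<length ts}.
              principal_part (\<lambda>u. 1/2 * csec (2 * of_real pi * u) *
                 d1 F g1 u (nths ts I) * d1 F (g - g1) u (nths ts (- I))) t)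
         + (\<Sum>j<length ts.
              principal_part (\<lambda>u. ts ! j * csec (2 * of_real pi * u) / (u\<^sup>2 - (ts ! j)\<^sup>2) *
                 d1 F g u (nths ts (- {j}))) t))"

text \<open>
  An identity of rational functions: the points where a denominator vanishes are excluded.
\<close>

definition recursion_B :: "(nat \<Rightarrow> complex list \<Rightarrow> complex) \<Rightarrow> nat \<Rightarrow> nat \<Rightarrow> bool" where
  "recursion_B F g n \<longleftrightarrow>
     (\<forall>t ts. t \<noteq> 0 \<and> length ts = n - 1 \<and> 0 \<notin> set ts \<and> (\<forall>s\<in>set ts. t\<^sup>2 \<noteq> s\<^sup>2) \<longrightarrow>
        - principal_part (\<lambda>u. cos (2 * of_real pi * u) * d1 F g u ts) t =
           (if g = 0 then 0 else 1/2 * d12_diag F (g - 1) t ts)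
         + 1/2 * (\<Sum>g1\<le>g. \<Sum>I\<in>Pow {..<length ts}.
              d1 F g1 t (nths ts I) * d1 F (g - g1) t (nths ts (- I)))
         + (\<Sum>j<length ts. ts ! j / (t\<^sup>2 - (ts ! j)\<^sup>2) *
              (d1 F g t (nths ts (- {j})) -
               deriv (\<lambda>u. stable_part F g (ts[j := u])) (ts ! j))))"

end

theory Submission
  imports Defs "HOL-Combinatorics.Permutations" "HOL-Real_Asymp.Real_Asymp"
begin

text \<open>
  On polynomials in the lengths, translation by \<open>\<plusminus> 2 \<pi> \<i>\<close> followed by averaging, the operator
  \<open>cos (2 \<pi> d/db)\<close>, inverts (up to the factor \<open>2 \<pi>\<close>) integration of odd polynomials against the
  kernel \<open>H\<close>, because the moment generating function of \<open>1 / cosh (u / 4)\<close> is \<open>4 \<pi> sec (2 \<pi> s)\<close>.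
  Applied to the Stanford--Witten recursion it therefore gives the recursion with shifts. Under the
  Laplace transform it becomes multiplication by \<open>cos (2 \<pi> t)\<close> followed by taking the principal
  part, convolutions become products, and the average of \<open>r (b + b\<^sub>j)\<close> and \<open>r (b - b\<^sub>j)\<close> for odd \<open>r\<close>
  becomes a divided difference; so the recursion with shifts turns into (B). Finally
  multiplication by \<open>cos (2 \<pi> t)\<close> and by \<open>sec (2 \<pi> t)\<close> are inverse to each other modulo functions
  regular at \<open>t = 0\<close>, which makes (A) and (B) equivalent for each fixed \<open>t\<^sub>1, \<dots>, t\<^sub>n\<^sub>-\<^sub>1\<close>.
\<close>

section \<open>Sums of products of polynomials\<close>

text \<open>Shifts, principal parts and kernel integrals act on one variable, while the recursions
  relate functions of all lengths. The obstacle is to carry such a relation over to the transforms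
  without recomputing every transform. A volume is therefore written once as a list of coefficients
  and one-variable factors: read with \<open>poly\<close> it is the volume, read with
  \<open>lap\<close> its transform, and by \<open>tensor_eq_zero\<close> an identity valid for the
  first reading is valid for every linear reading. Each term then needs only a formula in one or two
  variables. Evenness has to hold factor by factor, since the term in b + b_j and b - b_j becomes a
  divided difference only when b V is odd in b; \<open>tensor_even_part\<close> arranges this. The
  secant enters through polynomials only: by \<open>integral_shifted_sech4\<close> the integral of
  p(u + 2 pi i) + p(u - 2 pi i) against \<open>sech4\<close> is 8 pi p(0). The factor 2 pi of (SW)
  is half the total mass 4 pi of \<open>sech4\<close>, because a half line is half of the real line.
  Kernel integrals of odd polynomials are polynomials in b, so (SW), given for b > 0 only, may be
  evaluated at complex b.\<close>

definition linear_in_poly :: "(complex poly \<Rightarrow> complex \<Rightarrow> complex) \<Rightarrow> bool" where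
  "linear_in_poly u \<longleftrightarrow>
     (\<forall>p q x. u (p + q) x = u p x + u q x) \<and> (\<forall>c p x. u (smult c p) x = c * u p x)"

lemma linear_in_polyD:
  assumes "linear_in_poly u"
  shows "u (p + q) x = u p x + u q x" "u (smult c p) x = c * u p x" "u 0 x = 0"
    "u (\<Sum>y\<leftarrow>ys. f y) x = (\<Sum>y\<leftarrow>ys. u (f y) x)"
proof -
  show "u (p + q) x = u p x + u q x" "u (smult c p) x = c * u p x"
    using assms by (auto simp: linear_in_poly_def)
  show 0: "u 0 x = 0"
    using assms smult_0_left[of 0] unfolding linear_in_poly_def by (metis mult_zero_left)
  show "u (\<Sum>y\<leftarrow>ys. f y) x = (\<Sum>y\<leftarrow>ys. u (f y) x)"
    by (induction ys) (use assms 0 in \<open>auto simp: linear_in_poly_def\<close>)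
qed

lemma linear_in_poly_poly: "linear_in_poly poly"
  by (simp add: linear_in_poly_def)

text \<open>The list \<open>D\<close> encodes a sum of products of polynomials in one variable. With \<open>u = poly\<close> it is a
  polynomial in several variables, and with \<open>u\<close> the Laplace transform of one-variable polynomials
  (\<open>lap\<close> below) it is the Laplace transform of that polynomial.\<close>

definition tensor ::
    "('p \<Rightarrow> 'x \<Rightarrow> complex) \<Rightarrow> (complex \<times> 'p list) list \<Rightarrow> 'x list \<Rightarrow> complex" where
  "tensor u D xs = (\<Sum>(c, ps)\<leftarrow>D. c * prod_list (map2 u ps xs))"

text \<open>All variables but the first are evaluated by \<open>u\<close>; the first stays a
  polynomial variable. The coefficients are tensors in the remaining variables whose lists,
  \<open>slice_coeff\<close>, do not involve \<open>u\<close>. The inductions on the number of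
  variables rest on this.\<close>

definition slice ::
    "(complex poly \<Rightarrow> 'x \<Rightarrow> complex) \<Rightarrow> (complex \<times> complex poly list) list \<Rightarrow> 'x list \<Rightarrow> complex poly" where
  "slice u D xs = (\<Sum>(c, ps)\<leftarrow>D. smult (c * prod_list (map2 u (tl ps) xs)) (hd ps))"

definition slice_coeff ::
    "nat \<Rightarrow> (complex \<times> complex poly list) list \<Rightarrow> (complex \<times> complex poly list) list" where
  "slice_coeff i D = map (\<lambda>(c, ps). (c * coeff (hd ps) i, tl ps)) D"

definition arity :: "(complex \<times> complex poly list) list \<Rightarrow> nat \<Rightarrow> bool" where
  "arity D n \<longleftrightarrow> (\<forall>(c, ps)\<in>set D. length ps = n)"

lemma tensor_Nil [simp]: "tensor u [] xs = 0"
  by (simp add: tensor_def)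

lemma tensor_Cons [simp]: "tensor u ((c, ps) # D) xs = c * prod_list (map2 u ps xs) + tensor u D xs"
  by (simp add: tensor_def)

lemma tensor_append [simp]: "tensor u (D @ E) xs = tensor u D xs + tensor u E xs"
  by (simp add: tensor_def)

lemma arity_simps [simp]:
  "arity [] n" "arity ((c, ps) # D) n \<longleftrightarrow> length ps = n \<and> arity D n"
  "arity (D @ E) n \<longleftrightarrow> arity D n \<and> arity E n"
  by (auto simp: arity_def)

lemma tensor_map_scale: "tensor u (map (\<lambda>(c, ps). (a * c, ps)) D) xs = a * tensor u D xs"
  by (induction D) (auto simp: algebra_simps)

lemma arity_map_scale: "arity D n \<Longrightarrow> arity (map (\<lambda>(c, ps). (a * c, ps)) D) n"
  by (auto simp: arity_def)

lemma arity_slice_coeff: "arity D (Suc n) \<Longrightarrow> arity (slice_coeff i D) n"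
  by (auto simp: arity_def slice_coeff_def)

lemma coeff_slice: "coeff (slice u D xs) i = tensor u (slice_coeff i D) xs"
  by (induction D) (auto simp: slice_def slice_coeff_def)

lemma tensor_eq_slice:
  assumes "linear_in_poly u" "arity D (Suc n)"
  shows "tensor u D (x # xs) = u (slice u D xs) x"
  using assms(2)
proof (induction D)
  case (Cons cp D)
  obtain c p ps where cp: "cp = (c, p # ps)"
    using Cons.prems by (cases cp) (auto simp: length_Suc_conv)
  show ?case
    using Cons by (simp add: cp slice_def linear_in_polyD[OF assms(1)])
qed (simp add: slice_def linear_in_polyD[OF assms(1)])

lemma poly_zero_if_infinite:
  fixes p :: "complex poly"
  assumes "infinite S" "\<And>x. x \<in> S \<Longrightarrow> poly p x = 0"
  shows "p = 0"
  using assms poly_roots_finite[of p] by (metis (mono_tags, lifting) finite_subset mem_Collect_eq subsetI)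

text \<open>Induction on the number of variables. With the other variables in \<open>S\<close>, the
  slice under \<open>poly\<close> has infinitely many roots, so its coefficients vanish. They are
  tensors in one variable less, so they vanish under \<open>u\<close> as well, and a linear
  \<open>u\<close> sends the zero slice to 0. \<open>S\<close> is later the positive reals for
  lengths and the right half plane for transforms.\<close>

theorem tensor_eq_zero:
  assumes "linear_in_poly u" "infinite S" "arity D n"
    and "\<And>xs. length xs = n \<Longrightarrow> set xs \<subseteq> S \<Longrightarrow> tensor poly D xs = 0"
    and "length ys = n"
  shows "tensor u D ys = 0"
  using assms(3-)
proof (induction n arbitrary: D ys)
  case 0
  have "tensor u D [] = tensor poly D []"
    by (simp add: tensor_def)
  then show ?case using 0 by simp
next
  case (Suc n)
  obtain y ys' where ys: "ys = y # ys'" "length ys' = n"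
    using Suc.prems(3) by (auto simp: length_Suc_conv)
  have "coeff (slice u D ys') i = 0" for i
  proof -
    have "tensor poly (slice_coeff i D) xs = 0" if xs: "length xs = n" "set xs \<subseteq> S" for xs
    proof -
      have "slice poly D xs = 0"
      proof (rule poly_zero_if_infinite[OF assms(2)])
        fix x assume "x \<in> S"
        then show "poly (slice poly D xs) x = 0"
          using Suc.prems(2)[of "x # xs"] xs tensor_eq_slice[OF linear_in_poly_poly Suc.prems(1)]
          by simp
      qed
      then show ?thesis using coeff_slice[of poly D xs i] by simp
    qed
    then have "tensor u (slice_coeff i D) ys' = 0"
      using Suc.IH[OF arity_slice_coeff[OF Suc.prems(1)]] ys by blast
    then show ?thesis by (simp add: coeff_slice)
  qed
  then have "slice u D ys' = 0" by (intro poly_eqI) simp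
  then show ?case
    unfolding ys tensor_eq_slice[OF assms(1) Suc.prems(1)] by (simp add: linear_in_polyD[OF assms(1)])
qed

corollary tensor_unique:
  assumes "linear_in_poly u" "infinite S" "arity D n" "arity E n"
    and "\<And>xs. length xs = n \<Longrightarrow> set xs \<subseteq> S \<Longrightarrow> tensor poly D xs = tensor poly E xs"
    and "length ys = n"
  shows "tensor u D ys = tensor u E ys"
proof -
  \<comment> \<open>Subtraction of tensors is appending the list with negated coefficients; the form
    \<open>-1 * c\<close> fits \<open>tensor_map_scale\<close>.\<close>
  let ?E = "map (\<lambda>(c, ps). (-1 * c, ps)) E"
  have scale: "tensor v ?E xs = - tensor v E xs" for v :: "complex poly \<Rightarrow> complex \<Rightarrow> complex" and xs
    by (subst tensor_map_scale) simp
  have "arity ?E n" by (rule arity_map_scale[OF assms(4)])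
  then have "tensor u (D @ ?E) ys = 0"
    by (intro tensor_eq_zero[OF assms(1,2) _ _ assms(6)])
      (use assms(3,5) in \<open>simp_all only: tensor_append scale arity_simps right_minus\<close>)
  then show ?thesis by (simp only: tensor_append scale) simp
qed

lemma polynomial_in_imp_tensor:
  assumes "polynomial_in n f"
  obtains D where "arity D n" "\<And>xs. length xs = n \<Longrightarrow> f xs = tensor poly D xs"
proof -
  obtain A c where A: "finite A"
    and f: "\<And>xs. length xs = n \<Longrightarrow> f xs = (\<Sum>\<alpha>\<in>A. c \<alpha> * (\<Prod>i<n. xs ! i ^ \<alpha> i))"
    using assms unfolding polynomial_in_def by blast
  obtain as where as: "set as = A" "distinct as"
    using A finite_distinct_list by blast
  let ?D = "map (\<lambda>\<alpha>. (c \<alpha>, map (\<lambda>i. monom 1 (\<alpha> i)) [0..<n])) as"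
  have "f xs = tensor poly ?D xs" if xs: "length xs = n" for xs
  proof -
    have "prod_list (map2 poly (map (\<lambda>i. monom 1 (\<alpha> i)) [0..<n]) xs) = (\<Prod>i<n. xs ! i ^ \<alpha> i)" for \<alpha>
      using xs by (simp add: prod.list_conv_set_nth poly_monom lessThan_atLeast0)
    then show ?thesis
      unfolding f[OF xs] using as by (simp add: tensor_def o_def sum_list_distinct_conv_sum_set)
  qed
  then show thesis
    by (intro that[of ?D]) (auto simp: arity_def)
qed

section \<open>Even functions as sums of products of even polynomials\<close>

definition even_part :: "complex poly \<Rightarrow> complex poly" where
  "even_part p = smult (1/2) (p + pcompose p [:0, -1:])"

lemma poly_even_part: "poly (even_part p) x = (poly p x + poly p (- x)) / 2"
  by (simp add: even_part_def poly_pcompose)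

lemma linear_in_poly_even_part: "linear_in_poly (\<lambda>p. poly (even_part p))"
  by (simp add: linear_in_poly_def poly_even_part field_simps)

text \<open>The factors of \<open>D\<close> need not be even one by one even if the function is.
  Taking the even part of every factor averages the function over all sign changes of its variables,
  which does nothing to a function invariant under each of them.\<close>

lemma tensor_even_part:
  assumes "arity D n"
    and "\<And>xs i. length xs = n \<Longrightarrow> i < n \<Longrightarrow> tensor poly D (xs[i := - (xs ! i)]) = tensor poly D xs"
    and "length xs = n"
  shows "tensor (\<lambda>p. poly (even_part p)) D xs = tensor poly D xs"
  using assms
proof (induction n arbitrary: D xs)
  case 0
  then show ?case by (simp add: tensor_def)
next
  case (Suc n)
  let ?u = "\<lambda>p. poly (even_part p)"
  obtain y ys where xs: "xs = y # ys" "length ys = n"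
    using Suc.prems(3) by (auto simp: length_Suc_conv)
  note t = tensor_eq_slice[OF linear_in_poly_poly Suc.prems(1)]
  have "coeff (slice ?u D ys) i = coeff (slice poly D ys) i" for i
  proof -
    have "tensor poly (slice_coeff i D) (zs[k := - (zs ! k)]) = tensor poly (slice_coeff i D) zs"
      if zs: "length zs = n" "k < n" for zs k
    proof -
      have "slice poly D (zs[k := - (zs ! k)]) = slice poly D zs"
        using Suc.prems(2)[of "_ # zs" "Suc k"] zs
        by (simp add: t fun_eq_iff flip: poly_eq_poly_eq_iff)
      then show ?thesis using coeff_slice by metis
    qed
    then show ?thesis
      unfolding coeff_slice using Suc.IH[OF arity_slice_coeff[OF Suc.prems(1)]] xs by blast
  qed
  \<comment> \<open>The induction has settled the other variables, coefficient by coefficient; only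
    the average over the sign of \<open>y\<close> remains.\<close>
  then have s: "slice ?u D ys = slice poly D ys" by (intro poly_eqI) simp
  have "poly (slice poly D ys) (- y) = poly (slice poly D ys) y"
    using Suc.prems(2)[of "y # ys" 0] xs by (simp add: t)
  then show ?case
    unfolding xs tensor_eq_slice[OF linear_in_poly_even_part Suc.prems(1)] s t
    by (simp add: poly_even_part)
qed

definition is_even :: "complex poly \<Rightarrow> bool" where
  "is_even p \<longleftrightarrow> (\<forall>x. poly p (- x) = poly p x)"

lemma polynomial_in_imp_even_tensor:
  assumes "polynomial_in n f"
    and "\<And>xs i. length xs = n \<Longrightarrow> i < n \<Longrightarrow> f (xs[i := - (xs ! i)]) = f xs"
  obtains D where "arity D n" "\<And>xs. length xs = n \<Longrightarrow> f xs = tensor poly D xs"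
    "\<And>c ps p. (c, ps) \<in> set D \<Longrightarrow> p \<in> set ps \<Longrightarrow> is_even p"
proof -
  obtain D where D: "arity D n" "\<And>xs. length xs = n \<Longrightarrow> f xs = tensor poly D xs"
    using polynomial_in_imp_tensor[OF assms(1)] by blast
  let ?E = "map (\<lambda>(c, ps). (c, map even_part ps)) D"
  show thesis
  proof (rule that[of ?E])
    show "arity ?E n" using D(1) by (auto simp: arity_def)
    show "f xs = tensor poly ?E xs" if xs: "length xs = n" for xs
    proof -
      have "tensor (\<lambda>p. poly (even_part p)) D xs = tensor poly D xs"
        by (rule tensor_even_part[OF D(1) _ xs]) (use assms(2) D(2) in auto)
      moreover have "tensor poly ?E xs = tensor (\<lambda>p. poly (even_part p)) D xs"
        by (simp add: tensor_def o_def case_prod_unfold zip_map1)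
      ultimately show ?thesis using D(2)[OF xs] by simp
    qed
    show "is_even p" if "(c, ps) \<in> set ?E" "p \<in> set ps" for c ps p
      using that by (auto simp: is_even_def poly_even_part)
  qed
qed

text \<open>The merged list \<open>rs\<close> does not depend on the evaluation \<open>u\<close>.\<close>

lemma merge_nths:
  assumes "length ps = length (nths [0..<n] I)" "length qs = length (nths [0..<n] (- I))"
  shows "\<exists>rs. length rs = n \<and> (\<forall>(u :: complex poly \<Rightarrow> complex \<Rightarrow> complex) xs. length xs = n \<longrightarrow>
           prod_list (map2 u ps (nths xs I)) * prod_list (map2 u qs (nths xs (- I))) =
           prod_list (map2 u rs xs))"
  using assms
proof (induction n arbitrary: I ps qs)
  case (Suc n)
  let ?I = "{j. Suc j \<in> I}"
  have c: "{j. Suc j \<in> - I} = - ?I" "{j. Suc j \<notin> I} = - ?I" by auto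
  have l: "length (nths [0..<Suc n] J) = (if 0 \<in> J then 1 else 0) + length (nths [0..<n] {j. Suc j \<in> J})"
    for J by (simp add: upt_conv_Cons nths_Cons length_nths del: upt_Suc)
  show ?case
  proof (cases "0 \<in> I")
    case True
    then obtain p ps' where p: "ps = p # ps'" "length ps' = length (nths [0..<n] ?I)"
      using Suc.prems(1) unfolding l by (auto simp: length_Suc_conv)
    have "length qs = length (nths [0..<n] (- ?I))"
      using Suc.prems(2) True unfolding l c by simp
    then obtain rs where rs: "length rs = n" "\<And>(u :: complex poly \<Rightarrow> complex \<Rightarrow> complex) xs. length xs = n \<Longrightarrow>
           prod_list (map2 u ps' (nths xs ?I)) * prod_list (map2 u qs (nths xs (- ?I))) =
           prod_list (map2 u rs xs)"
      using Suc.IH[OF p(2)] by blast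
    show ?thesis
    proof (rule exI[of _ "p # rs"], intro conjI allI impI)
      fix u :: "complex poly \<Rightarrow> complex \<Rightarrow> complex" and xs :: "complex list" assume "length xs = Suc n"
      then show "prod_list (map2 u ps (nths xs I)) * prod_list (map2 u qs (nths xs (- I))) =
           prod_list (map2 u (p # rs) xs)"
        using True rs(2)[of "tl xs" u] by (cases xs) (auto simp: p nths_Cons c mult.assoc)
    qed (simp add: rs)
  next
    case False
    then obtain p qs' where p: "qs = p # qs'" "length qs' = length (nths [0..<n] (- ?I))"
      using Suc.prems(2) unfolding l c by (auto simp: length_Suc_conv)
    have "length ps = length (nths [0..<n] ?I)"
      using Suc.prems(1) False unfolding l c by simp
    then obtain rs where rs: "length rs = n" "\<And>(u :: complex poly \<Rightarrow> complex \<Rightarrow> complex) xs. length xs = n \<Longrightarrow>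
           prod_list (map2 u ps (nths xs ?I)) * prod_list (map2 u qs' (nths xs (- ?I))) =
           prod_list (map2 u rs xs)"
      using Suc.IH[OF _ p(2)] by blast
    show ?thesis
    proof (rule exI[of _ "p # rs"], intro conjI allI impI)
      fix u :: "complex poly \<Rightarrow> complex \<Rightarrow> complex" and xs :: "complex list" assume "length xs = Suc n"
      then show "prod_list (map2 u ps (nths xs I)) * prod_list (map2 u qs (nths xs (- I))) =
           prod_list (map2 u (p # rs) xs)"
        using False rs(2)[of "tl xs" u] by (cases xs) (auto simp: p nths_Cons c mult_ac)
    qed (simp add: rs)
  qed
qed simp

lemma nths_singleton_eq: "j < length xs \<Longrightarrow> nths xs {j} = [xs ! j]"
proof (induction xs arbitrary: j)
  case (Cons x xs)
  then show ?case
    by (cases j) (auto simp: nths_Cons)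
qed simp

lemma mset_nths_compl: "mset (nths xs I) + mset (nths xs (- I)) = mset xs"
proof (induction xs arbitrary: I)
  case (Cons x xs)
  have c: "{j. Suc j \<notin> I} = - {j. Suc j \<in> I}" by auto
  show ?case using Cons[of "{j. Suc j \<in> I}"] by (auto simp: nths_Cons c)
qed simp

lemma length_nths_cong: "length xs = length ys \<Longrightarrow> length (nths xs I) = length (nths ys I)"
  by (simp add: length_nths)

section \<open>Principal parts\<close>

definition has_laurent :: "(complex \<Rightarrow> complex) \<Rightarrow> bool" where
  "has_laurent f \<longleftrightarrow> (\<exists>L. f has_laurent_expansion L)"

lemma principal_part_eq:
  "f has_laurent_expansion L \<Longrightarrow> principal_part f t = poly (fls_prpart L) (inverse t)"
  unfolding principal_part_def by (simp add: laurent_expansion_0_eqI)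

lemma has_laurent_expansion_transfer:
  "eventually (\<lambda>u. f u = g u) (at 0) \<Longrightarrow> g has_laurent_expansion L \<Longrightarrow> f has_laurent_expansion L"
  using has_laurent_expansion_cong[of f g L L] by simp

lemma has_laurent_analytic: "f analytic_on {0} \<Longrightarrow> has_laurent f"
  unfolding has_laurent_def
  using analytic_at_imp_has_fps_expansion_0 has_laurent_expansion_fps by blast

lemma has_laurent_add: "has_laurent f \<Longrightarrow> has_laurent g \<Longrightarrow> has_laurent (\<lambda>u. f u + g u)"
  unfolding has_laurent_def by (blast intro: has_laurent_expansion_add)

lemma has_laurent_mult: "has_laurent f \<Longrightarrow> has_laurent g \<Longrightarrow> has_laurent (\<lambda>u. f u * g u)"
  unfolding has_laurent_def by (blast intro: has_laurent_expansion_mult)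

lemma has_laurent_sum:
  "(\<And>i. i \<in> I \<Longrightarrow> has_laurent (f i)) \<Longrightarrow> has_laurent (\<lambda>u. \<Sum>i\<in>I. f i u)"
  by (induction I rule: infinite_finite_induct)
    (auto intro: has_laurent_add has_laurent_analytic)

lemma principal_part_add:
  assumes "has_laurent f" "has_laurent g"
  shows "principal_part (\<lambda>u. f u + g u) t = principal_part f t + principal_part g t"
proof -
  obtain L M where L: "f has_laurent_expansion L" "g has_laurent_expansion M"
    using assms unfolding has_laurent_def by blast
  show ?thesis
    using principal_part_eq[OF has_laurent_expansion_add[OF L]] principal_part_eq[OF L(1)]
      principal_part_eq[OF L(2)] by simp
qed

lemma principal_part_uminus:
  assumes "has_laurent f"
  shows "principal_part (\<lambda>u. - f u) t = - principal_part f t"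
proof -
  obtain L where L: "f has_laurent_expansion L"
    using assms unfolding has_laurent_def by blast
  show ?thesis
    using principal_part_eq[OF has_laurent_expansion_minus[OF L]] principal_part_eq[OF L] by simp
qed

lemma principal_part_zero [simp]: "principal_part (\<lambda>u. 0) t = 0"
  by (subst principal_part_eq[OF has_laurent_expansion_0]) simp

lemma principal_part_sum:
  assumes "\<And>i. i \<in> I \<Longrightarrow> has_laurent (f i)"
  shows "principal_part (\<lambda>u. \<Sum>i\<in>I. f i u) t = (\<Sum>i\<in>I. principal_part (f i) t)"
  using assms
  by (induction I rule: infinite_finite_induct)
    (auto simp: principal_part_add has_laurent_sum)

lemma principal_part_cong:
  assumes "eventually (\<lambda>u. f u = g u) (at 0)" "has_laurent g"
  shows "principal_part f t = principal_part g t"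
proof -
  obtain L where L: "g has_laurent_expansion L"
    using assms unfolding has_laurent_def by blast
  then have "f has_laurent_expansion L"
    by (rule has_laurent_expansion_transfer[OF assms(1)])
  then show ?thesis using L by (simp add: principal_part_eq)
qed

lemma principal_part_analytic: "f analytic_on {0} \<Longrightarrow> principal_part f t = 0"
  using principal_part_eq[OF has_laurent_expansion_fps[OF analytic_at_imp_has_fps_expansion_0]]
  by (metis fls_prpart_eq0_iff fls_subdegree_fls_to_fps_gt0 poly_0)

lemma laurent_expansion_poly_inverse:
  fixes q :: "complex poly"
  shows "\<exists>L. (\<lambda>u. poly q (inverse u)) has_laurent_expansion L \<and>
           (\<forall>k. fls_nth L k = (if k \<le> 0 then coeff q (nat (- k)) else 0))"
proof (induction q)
  case 0
  then show ?case by (intro exI[of _ 0]) auto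
next
  case (pCons a q)
  then obtain L where L: "(\<lambda>u. poly q (inverse u)) has_laurent_expansion L"
     "\<And>k. fls_nth L k = (if k \<le> 0 then coeff q (nat (- k)) else 0)" by blast
  have "(\<lambda>u. a + inverse u * poly q (inverse u)) has_laurent_expansion fls_const a + inverse fls_X * L"
    by (intro laurent_expansion_intros L)
  moreover have "fls_nth (fls_const a + inverse fls_X * L) k =
      (if k \<le> 0 then coeff (pCons a q) (nat (- k)) else 0)" for k
  proof -
    have "fls_nth (fls_const a + inverse fls_X * L) k = (if k = 0 then a else 0) + fls_nth L (k + 1)"
      by (simp add: fls_inverse_X fls_X_inv_times_conv_shift)
    moreover have "nat (- k) = Suc (nat (- (k + 1)))" if "k < 0" using that by simp
    ultimately show ?thesis by (auto simp: L(2))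
  qed
  ultimately show ?case
    by (intro exI[of _ "fls_const a + inverse fls_X * L"]) (simp only: poly_pCons, simp)
qed

text \<open>A constant term of \<open>q\<close> is a coefficient of u^0 and would be lost in the
  principal part. Without it the function is its own principal part, which is how terms outside the
  principal part sign in (B) are treated.\<close>

lemma
  assumes "\<And>u. u \<noteq> 0 \<Longrightarrow> f u = poly q (inverse u)"
  shows has_laurent_poly_inverse: "has_laurent f"
    and principal_part_poly_inverse: "coeff q 0 = 0 \<Longrightarrow> principal_part f t = poly q (inverse t)"
proof -
  obtain L where L: "(\<lambda>u. poly q (inverse u)) has_laurent_expansion L"
     "\<And>k. fls_nth L k = (if k \<le> 0 then coeff q (nat (- k)) else 0)"
    using laurent_expansion_poly_inverse by blast
  have "eventually (\<lambda>u. f u = poly q (inverse u)) (at 0)"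
    using assms by (simp add: eventually_at_filter)
  then have f: "f has_laurent_expansion L"
    by (rule has_laurent_expansion_transfer[OF _ L(1)])
  then show "has_laurent f" unfolding has_laurent_def by blast
  show "principal_part f t = poly q (inverse t)" if "coeff q 0 = 0"
  proof -
    have "fls_prpart L = q" using that by (intro poly_eqI) (auto simp: L(2))
    then show ?thesis using principal_part_eq[OF f] by simp
  qed
qed

text \<open>Series with equal principal parts differ by a power series, and a power series times
  \<open>c\<close> is again one.\<close>

lemma fls_prpart_fps_mult_cong:
  fixes L M :: "complex fls"
  assumes "fls_prpart L = fls_prpart M"
  shows "fls_prpart (fps_to_fls c * L) = fls_prpart (fps_to_fls c * M)"
proof -
  have "fls_prpart (L - M) = 0" using assms by simp
  then have "L - M = fps_to_fls (fls_regpart (L - M))"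
    by (metis fls_prpart_eq0_iff fls_regpart_to_fls_trivial)
  then have "fps_to_fls c * (L - M) = fps_to_fls (c * fls_regpart (L - M))"
    by (simp add: fls_times_fps_to_fls)
  then have "fls_prpart (fps_to_fls c * (L - M)) = 0"
    by (metis fls_prpart_eq0_iff fls_subdegree_fls_to_fps_gt0)
  then show ?thesis by (simp add: algebra_simps)
qed

text \<open>Principal parts are polynomials in 1/t, so agreement off a finite set suffices.
  \<open>X\<close> takes care of the points t^2 = s^2 that (B) excludes.\<close>

lemma fls_prpart_eqI:
  fixes L M :: "complex fls"
  assumes "finite X" "\<And>t. t \<noteq> 0 \<Longrightarrow> t \<notin> X \<Longrightarrow> poly (fls_prpart L) (inverse t) = poly (fls_prpart M) (inverse t)"
  shows "fls_prpart L = fls_prpart M"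
proof (rule ccontr)
  assume "fls_prpart L \<noteq> fls_prpart M"
  then have "finite {x. poly (fls_prpart L - fls_prpart M) x = 0}"
    by (intro poly_roots_finite) simp
  moreover have "- (inverse ` insert 0 X) \<subseteq> {x. poly (fls_prpart L - fls_prpart M) x = 0}"
  proof
    fix x assume x: "x \<in> - (inverse ` insert 0 X)"
    then have "inverse x \<noteq> 0" "inverse x \<notin> X"
      by (auto simp: image_iff dest: bspec[of X _ "inverse x"])
    then show "x \<in> {x. poly (fls_prpart L - fls_prpart M) x = 0}"
      using assms(2)[of "inverse x"] by simp
  qed
  moreover have "infinite (- (inverse ` insert (0 :: complex) X))"
    using assms(1) infinite_UNIV_char_0 by (metis finite.insertI finite_compl finite_imageI)
  ultimately show False using finite_subset by blast
qed

lemma csec_analytic: "(\<lambda>u. csec (2 * of_real pi * u)) analytic_on {0}"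
  unfolding csec_def by (auto intro!: analytic_intros)

lemma cos_analytic: "(\<lambda>u. cos (2 * of_real pi * u) :: complex) analytic_on {0}"
  by (auto intro!: analytic_intros)

text \<open>Multiplication by a function analytic at \<open>0\<close> acts on Laurent series modulo regular ones,
  and there the cosine and the secant are inverse to each other.\<close>

lemma principal_part_sec_iff_cos:
  assumes f: "\<And>u. u \<noteq> 0 \<Longrightarrow> f u = poly q (inverse u)" "coeff q 0 = 0"
    and Y: "has_laurent Y" and X: "finite X"
  shows "(\<forall>t. t \<noteq> 0 \<longrightarrow> - f t = principal_part (\<lambda>u. csec (2 * of_real pi * u) * Y u) t) \<longleftrightarrow>
         (\<forall>t. t \<noteq> 0 \<and> t \<notin> X \<longrightarrow>
            - principal_part (\<lambda>u. cos (2 * of_real pi * u) * f u) t = principal_part Y t)"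
proof -
  define c where "c = fps_expansion (\<lambda>u. cos (2 * of_real pi * u) :: complex) 0"
  define s where "s = fps_expansion (\<lambda>u. csec (2 * of_real pi * u) :: complex) 0"
  have c: "(\<lambda>u. cos (2 * of_real pi * u)) has_laurent_expansion fps_to_fls c"
    unfolding c_def
    by (rule has_laurent_expansion_fps[OF analytic_at_imp_has_fps_expansion_0[OF cos_analytic]])
  have s: "(\<lambda>u. csec (2 * of_real pi * u)) has_laurent_expansion fps_to_fls s"
    unfolding s_def
    by (rule has_laurent_expansion_fps[OF analytic_at_imp_has_fps_expansion_0[OF csec_analytic]])
  \<comment> \<open>The cosine is 1 at 0, hence nonzero nearby, where cosine times secant is then 1.
    Uniqueness of Laurent expansions turns this into c s = 1 for the formal series.\<close>
  have "isCont (\<lambda>u. cos (2 * of_real pi * u) :: complex) 0" by (intro continuous_intros)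
  then have "eventually (\<lambda>u. cos (2 * of_real pi * u) \<noteq> (0 :: complex)) (at 0)"
    by (intro tendsto_imp_eventually_ne[where c = 1]) (auto simp: isCont_def)
  then have "eventually (\<lambda>u. cos (2 * of_real pi * u) * csec (2 * of_real pi * u) = 1) (at (0 :: complex))"
    by eventually_elim (simp add: csec_def)
  then have "(\<lambda>u. 1) has_laurent_expansion fps_to_fls c * fps_to_fls s"
    by (intro has_laurent_expansion_transfer[OF _ has_laurent_expansion_mult[OF c s]])
      (auto elim: eventually_mono)
  then have cs: "fps_to_fls c * fps_to_fls s = 1"
    using has_laurent_expansion_1 has_laurent_expansion_unique by blast
  obtain D where D: "f has_laurent_expansion D"
    using has_laurent_poly_inverse[of f q] f unfolding has_laurent_def by blast
  obtain L where L: "Y has_laurent_expansion L"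
    using Y unfolding has_laurent_def by blast
  have "(\<forall>t. t \<noteq> 0 \<longrightarrow> - f t = principal_part (\<lambda>u. csec (2 * of_real pi * u) * Y u) t) \<longleftrightarrow>
        fls_prpart (- D) = fls_prpart (fps_to_fls s * L)"
  proof -
    \<comment> \<open>As \<open>q\<close> has no constant term, \<open>f\<close> coincides with its
      principal part.\<close>
    have "- f t = poly (fls_prpart (- D)) (inverse t)" if "t \<noteq> 0" for t
      using that f principal_part_poly_inverse[of f q t] principal_part_eq[OF D, of t] by simp
    then show ?thesis
      using principal_part_eq[OF has_laurent_expansion_mult[OF s L]]
        fls_prpart_eqI[of "{}" "- D" "fps_to_fls s * L"]
      by (metis empty_iff finite.emptyI)
  qed
  also have "\<dots> \<longleftrightarrow> fls_prpart (fps_to_fls c * (- D)) = fls_prpart L"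
  proof
    assume "fls_prpart (- D) = fls_prpart (fps_to_fls s * L)"
    from fls_prpart_fps_mult_cong[OF this, of c]
    show "fls_prpart (fps_to_fls c * (- D)) = fls_prpart L"
      by (simp only: mult.assoc[symmetric] cs mult_1)
  next
    assume "fls_prpart (fps_to_fls c * (- D)) = fls_prpart L"
    from fls_prpart_fps_mult_cong[OF this, of s]
    show "fls_prpart (- D) = fls_prpart (fps_to_fls s * L)"
      by (simp only: mult.assoc[symmetric] mult.commute[of "fps_to_fls s"] cs mult_1)
  qed
  also have "\<dots> \<longleftrightarrow> (\<forall>t. t \<noteq> 0 \<and> t \<notin> X \<longrightarrow>
            - principal_part (\<lambda>u. cos (2 * of_real pi * u) * f u) t = principal_part Y t)"
  proof -
    have "- principal_part (\<lambda>u. cos (2 * of_real pi * u) * f u) t =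
        poly (fls_prpart (fps_to_fls c * (- D))) (inverse t)" for t
      using principal_part_eq[OF has_laurent_expansion_mult[OF c D]] by simp
    then show ?thesis
      using principal_part_eq[OF L] fls_prpart_eqI[OF X, of "fps_to_fls c * (- D)" L] by metis
  qed
  finally show ?thesis .
qed

text \<open>This turns the kernel term of (A) into the divided difference of (B). By evenness q(x) -
  q(1/s) vanishes at both 1/s and -1/s, so subtracting \<open>f s\<close> cancels both poles and
  leaves a polynomial in 1/u. The subtracted part s / (u^2 - s^2) * f(s) is regular at 0 because s
  is nonzero.\<close>

lemma principal_part_kernel:
  fixes q :: "complex poly"
  assumes f: "\<And>u. u \<noteq> 0 \<Longrightarrow> f u = poly q (inverse u)" "coeff q 0 = 0"
    and even: "\<And>x. poly q (- x) = poly q x" and s: "s \<noteq> 0" and t: "t \<noteq> 0" "t\<^sup>2 \<noteq> s\<^sup>2"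
  shows "principal_part (\<lambda>u. s / (u\<^sup>2 - s\<^sup>2) * f u) t = s / (t\<^sup>2 - s\<^sup>2) * (f t - f s)"
proof -
  let ?y = "inverse s"
  have "poly (q - [:poly q ?y:]) ?y = 0" by simp
  then obtain r where r: "q - [:poly q ?y:] = [:- ?y, 1:] * r"
    unfolding poly_eq_0_iff_dvd by (auto elim!: dvdE)
  have "poly (q - [:poly q ?y:]) (- ?y) = 0" by (simp add: even)
  then have "poly r (- ?y) = 0" unfolding r using s by simp
  then obtain r' where r': "r = [:?y, 1:] * r'"
    unfolding poly_eq_0_iff_dvd by (auto elim!: dvdE)
  have qx: "poly q x - poly q ?y = (x\<^sup>2 - ?y\<^sup>2) * poly r' x" for x
    using arg_cong[OF r, of "\<lambda>p. poly p x"] unfolding r'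
    by (simp add: algebra_simps power2_eq_square)
  \<comment> \<open>With x = 1/u, the product of s / (u^2 - s^2) and x^2 - 1/s^2 is -x^2 / s. The
    factor x^2 also shows that \<open>q'\<close> has no constant term.\<close>
  define q' where "q' = - smult ?y (pCons 0 (pCons 0 r'))"
  have eq: "s / (u\<^sup>2 - s\<^sup>2) * (f u - f s) = poly q' (inverse u)" if u: "u \<noteq> 0" "u\<^sup>2 \<noteq> s\<^sup>2" for u
  proof -
    have "f u - f s = ((inverse u)\<^sup>2 - ?y\<^sup>2) * poly r' (inverse u)"
      using f(1) u(1) s qx by simp
    also have "(inverse u)\<^sup>2 - ?y\<^sup>2 = - (u\<^sup>2 - s\<^sup>2) / (u\<^sup>2 * s\<^sup>2)"
      using u s by (simp add: field_simps)
    finally show ?thesis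
      using u s by (simp add: q'_def field_simps power2_eq_square)
  qed
  have "isCont (\<lambda>u. u\<^sup>2 - s\<^sup>2) 0" by (intro continuous_intros)
  then have "eventually (\<lambda>u. u\<^sup>2 - s\<^sup>2 \<noteq> 0) (at 0)"
    by (intro tendsto_imp_eventually_ne[where c = "- s\<^sup>2"]) (use s in \<open>auto simp: isCont_def\<close>)
  moreover have "eventually (\<lambda>u. u \<noteq> 0) (at (0 :: complex))"
    by (simp add: eventually_at_filter)
  ultimately have ev: "eventually (\<lambda>u. s / (u\<^sup>2 - s\<^sup>2) * f u =
       poly q' (inverse u) + s / (u\<^sup>2 - s\<^sup>2) * f s) (at 0)"
  proof eventually_elim
    case (elim u)
    then have "poly q' (inverse u) = s / (u\<^sup>2 - s\<^sup>2) * (f u - f s)" using eq[of u] by simp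
    then show ?case by (simp add: right_diff_distrib)
  qed
  have an: "(\<lambda>u. s / (u\<^sup>2 - s\<^sup>2) * f s) analytic_on {0}"
    using s by (auto intro!: analytic_intros)
  have "principal_part (\<lambda>u. s / (u\<^sup>2 - s\<^sup>2) * f u) t =
    principal_part (\<lambda>u. poly q' (inverse u)) t + principal_part (\<lambda>u. s / (u\<^sup>2 - s\<^sup>2) * f s) t"
    using has_laurent_poly_inverse[of "\<lambda>u. poly q' (inverse u)" q'] has_laurent_analytic[OF an]
    by (subst principal_part_cong[OF ev]) (auto intro!: has_laurent_add principal_part_add)
  also have "\<dots> = poly q' (inverse t)"
    using principal_part_analytic[OF an]
      principal_part_poly_inverse[of "\<lambda>u. poly q' (inverse u)" q' t]
    by (simp add: q'_def)
  finally show ?thesis using eq[OF t] by simp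
qed

section \<open>Equivalence of the recursions for the Laplace transforms\<close>

abbreviation inv_poly :: "complex poly \<Rightarrow> complex \<Rightarrow> complex" where
  "inv_poly p t \<equiv> poly p (inverse t)"

lemma linear_in_poly_inv_poly: "linear_in_poly inv_poly"
  by (simp add: linear_in_poly_def)

lemma tensor_inv_poly: "tensor inv_poly D ts = tensor poly D (map inverse ts)"
  by (simp add: tensor_def zip_map2 case_prod_unfold o_def)

text \<open>In the variable x = 1/t, differentiation d/dt is the operator -x^2 d/dx.\<close>

definition inv_deriv :: "complex poly \<Rightarrow> complex poly" where
  "inv_deriv p = - pCons 0 (pCons 0 (pderiv p))"

lemma coeff_inv_deriv_0 [simp]: "coeff (inv_deriv p) 0 = 0"
  by (simp add: inv_deriv_def)

lemma has_field_derivative_inv_poly: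
  assumes "t \<noteq> 0"
  shows "((\<lambda>u. inv_poly p u) has_field_derivative inv_poly (inv_deriv p) t) (at t)"
  using assms
  by (auto intro!: derivative_eq_intros simp: inv_deriv_def power2_eq_square)

text \<open>The family \<open>F\<close> is controlled only at nonzero arguments. Equality off 0 is
  equality near any t different from 0, which is enough for the derivative.\<close>

lemma deriv_nonzero_cong:
  assumes "\<And>u. u \<noteq> 0 \<Longrightarrow> f u = h u" "(h has_field_derivative d) (at t)" "(t :: complex) \<noteq> 0"
  shows "deriv f t = d"
proof -
  have "(f has_field_derivative d) (at t)"
    by (rule DERIV_cong_ev[THEN iffD2, OF refl _ refl assms(2)])
      (use assms(1,3) in \<open>auto simp: eventually_nhds intro!: exI[of _ "- {0}"]\<close>)
  then show ?thesis by (rule DERIV_imp_deriv)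
qed

lemma polynomial_in_inverses_imp_tensor:
  assumes "polynomial_in_inverses n F"
  obtains D where "arity D n"
    "\<And>ts. length ts = n \<Longrightarrow> 0 \<notin> set ts \<Longrightarrow> F ts = tensor inv_poly D ts"
proof -
  obtain p where p: "polynomial_in n p"
    "\<And>ts. length ts = n \<Longrightarrow> 0 \<notin> set ts \<Longrightarrow> F ts = p (map inverse ts)"
    using assms unfolding polynomial_in_inverses_def by blast
  obtain D where D: "arity D n" "\<And>xs. length xs = n \<Longrightarrow> p xs = tensor poly D xs"
    using polynomial_in_imp_tensor[OF p(1)] by blast
  show thesis
    by (rule that[OF D(1)]) (simp add: p(2) D(2) tensor_inv_poly)
qed

text \<open>Unstable members are represented by the empty list, so the recursions need no case
  distinction on stability.\<close>

lemma stable_part_tensor_inv_poly: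
  assumes "symmetric_odd_inverse_family F"
  obtains D where "arity D n"
    "\<And>ts. length ts = n \<Longrightarrow> 0 \<notin> set ts \<Longrightarrow> stable_part F g ts = tensor inv_poly D ts"
proof (cases "stable g n")
  case True
  then have "polynomial_in_inverses n (F g)"
    using assms unfolding symmetric_odd_inverse_family_def by blast
  then obtain D where "arity D n"
    "\<And>ts. length ts = n \<Longrightarrow> 0 \<notin> set ts \<Longrightarrow> F g ts = tensor inv_poly D ts"
    using polynomial_in_inverses_imp_tensor by blast
  then show thesis using True by (intro that[of D]) (auto simp: stable_part_def)
next
  case False
  then show thesis by (intro that[of "[]"]) (auto simp: stable_part_def)
qed

lemma stable_part_odd:
  assumes "symmetric_odd_inverse_family F" "u \<noteq> 0" "0 \<notin> set us"
  shows "stable_part F g (- u # us) = - stable_part F g (u # us)"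
proof (cases "stable g (Suc (length us))")
  case True
  then have "\<forall>ts i. length ts = Suc (length us) \<and> 0 \<notin> set ts \<and> i < Suc (length us) \<longrightarrow>
           F g (ts[i := - (ts ! i)]) = - F g ts"
    using assms(1) unfolding symmetric_odd_inverse_family_def by blast
  from this[rule_format, of "u # us" 0] show ?thesis
    using True assms by (simp add: stable_part_def)
qed (simp add: stable_part_def)

lemma nths_list_update_notin: "j \<notin> I \<Longrightarrow> nths (xs[j := u]) I = nths xs I"
proof (induction xs arbitrary: j I)
  case (Cons x xs)
  then show ?case by (cases j) (auto simp: nths_Cons)
qed simp

text \<open>By symmetry the derivative in t_j occurring in (B) is the derivative \<open>d1\<close>
  in the first variable, taken at t_j with entry j removed from the rest.\<close>

lemma stable_part_move_to_front:
  assumes "symmetric_odd_inverse_family F" "u \<noteq> 0" "0 \<notin> set us" "j < length us"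
  shows "stable_part F g (us[j := u]) = stable_part F g (u # nths us (- {j}))"
proof -
  have m: "mset (u # nths us (- {j})) = mset (us[j := u])"
    using mset_nths_compl[of "us[j := u]" "{j}"] assms(4)
    by (simp add: nths_singleton_eq nths_list_update_notin)
  then have l: "length (u # nths us (- {j})) = length us"
    by (metis length_list_update size_mset)
  show ?thesis
  proof (cases "stable g (length us)")
    case True
    then have "\<forall>ts us'. length ts = length us \<and> 0 \<notin> set ts \<and> mset us' = mset ts \<longrightarrow> F g us' = F g ts"
      using assms(1) unfolding symmetric_odd_inverse_family_def by blast
    moreover have "0 \<notin> set (us[j := u])"
      using assms(2,3) set_update_subset_insert by fastforce
    ultimately have "F g (u # nths us (- {j})) = F g (us[j := u])"
      using m by (metis length_list_update)
    then show ?thesis using True l by (simp add: stable_part_def)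
  qed (use l in \<open>simp add: stable_part_def\<close>)
qed

text \<open>Oddness of \<open>F\<close> makes \<open>p\<close> odd, hence its derivative even; this
  evenness is what \<open>principal_part_kernel\<close> requires.\<close>

lemma d1_eq_inv_poly:
  assumes "symmetric_odd_inverse_family F" "0 \<notin> set us"
  obtains q where "coeff q 0 = 0" "\<And>x. poly q (- x) = poly q x"
    "\<And>u. u \<noteq> 0 \<Longrightarrow> d1 F g u us = inv_poly q u"
proof -
  obtain D where D: "arity D (Suc (length us))"
    "\<And>ts. length ts = Suc (length us) \<Longrightarrow> 0 \<notin> set ts \<Longrightarrow> stable_part F g ts = tensor inv_poly D ts"
    using stable_part_tensor_inv_poly[OF assms(1)] by metis
  define p where "p = slice inv_poly D us"
  have G: "stable_part F g (u # us) = inv_poly p u" if "u \<noteq> 0" for u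
    using D(2)[of "u # us"] that assms(2)
    by (simp add: tensor_eq_slice[OF linear_in_poly_inv_poly D(1)] p_def)
  have "pcompose p [:0, -1:] + p = 0"
  proof (rule poly_zero_if_infinite[of "- {0}"])
    show "infinite (- {0 :: complex})"
      using infinite_UNIV_char_0 by (metis finite.emptyI finite.insertI finite_compl)
    show "poly (pcompose p [:0, -1:] + p) x = 0" if "x \<in> - {0}" for x
      using that G[of "inverse x"] G[of "- inverse x"] stable_part_odd[OF assms(1) _ assms(2), of "inverse x" g]
      by (simp add: poly_pcompose add_eq_0_iff2)
  qed
  then have "pderiv (pcompose p [:0, -1:]) = - pderiv p"
    by (metis add_eq_0_iff2 pderiv_minus)
  from arg_cong[OF this, of "\<lambda>q. poly q _"]
  have even: "poly (pderiv p) (- x) = poly (pderiv p) x" for x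
    by (simp add: pderiv_pcompose poly_pcompose pderiv_pCons)
  show thesis
  proof (rule that[of "inv_deriv p"])
    show "poly (inv_deriv p) (- x) = poly (inv_deriv p) x" for x
      by (simp add: inv_deriv_def even)
    show "d1 F g u us = inv_poly (inv_deriv p) u" if "u \<noteq> 0" for u
      unfolding d1_def
      by (rule deriv_nonzero_cong[OF G has_field_derivative_inv_poly]) (use that in auto)
  qed simp
qed

lemma tensor_pair:
  assumes "arity D (Suc (Suc n))"
  shows "tensor u D (x # y # xs) =
    (\<Sum>(c, ps)\<leftarrow>D. c * prod_list (map2 u (tl (tl ps)) xs) * u (hd ps) x * u (hd (tl ps)) y)"
  using assms
proof (induction D)
  case (Cons cp D)
  obtain c p q ps where cp: "cp = (c, p # q # ps)"
    using Cons.prems by (cases cp) (auto simp: length_Suc_conv)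
  then show ?case using Cons by (simp add: mult_ac)
qed simp

lemma has_field_derivative_sum_list:
  assumes "\<And>x. x \<in> set xs \<Longrightarrow> (f x has_field_derivative f' x) (at t)"
  shows "((\<lambda>u. \<Sum>x\<leftarrow>xs. f x u) has_field_derivative (\<Sum>x\<leftarrow>xs. f' x)) (at t)"
  using assms by (induction xs) (auto intro!: derivative_eq_intros)

lemma poly_sum_list: "poly (\<Sum>x\<leftarrow>xs. f x) y = (\<Sum>x\<leftarrow>xs. poly (f x) y)"
  by (induction xs) auto

lemma d12_diag_tensor:
  assumes D: "arity D (Suc (Suc (length us)))"
    "\<And>u v. u \<noteq> 0 \<Longrightarrow> v \<noteq> 0 \<Longrightarrow> stable_part F g (u # v # us) = tensor inv_poly D (u # v # us)"
    and t: "t \<noteq> 0"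
  shows "d12_diag F g t us = (\<Sum>(c, ps)\<leftarrow>D. c * prod_list (map2 inv_poly (tl (tl ps)) us) *
    inv_poly (inv_deriv (hd ps)) t * inv_poly (inv_deriv (hd (tl ps))) t)"
proof -
  define C where "C = (\<lambda>(c, ps). c * prod_list (map2 inv_poly (tl (tl ps)) us))"
  define P where "P = (\<lambda>(c :: complex, ps :: complex poly list). hd ps)"
  define Q where "Q = (\<lambda>(c :: complex, ps :: complex poly list). hd (tl ps))"
  have G: "stable_part F g (u # v # us) = (\<Sum>d\<leftarrow>D. C d * inv_poly (P d) u * inv_poly (Q d) v)"
    if "u \<noteq> 0" "v \<noteq> 0" for u v
    using D(2)[OF that] by (simp add: tensor_pair[OF D(1)] C_def P_def Q_def case_prod_unfold)
  \<comment> \<open>The inner derivative is evaluated at v = t while u still varies, so that the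
    outer derivative sees a function of u alone.\<close>
  have inner: "deriv (\<lambda>v. stable_part F g (u # v # us)) t =
      (\<Sum>d\<leftarrow>D. C d * inv_poly (P d) u * inv_poly (inv_deriv (Q d)) t)" if "u \<noteq> 0" for u
    by (rule deriv_nonzero_cong[OF G])
      (use that t in \<open>auto intro!: has_field_derivative_sum_list DERIV_cmult has_field_derivative_inv_poly\<close>)
  have "d12_diag F g t us =
      (\<Sum>d\<leftarrow>D. C d * inv_poly (inv_deriv (P d)) t * inv_poly (inv_deriv (Q d)) t)"
    unfolding d12_diag_def
    by (rule deriv_nonzero_cong[OF inner])
      (use t in \<open>auto intro!: has_field_derivative_sum_list DERIV_cmult DERIV_cmult_right has_field_derivative_inv_poly\<close>)
  then show ?thesis
    by (simp add: C_def P_def Q_def case_prod_unfold)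
qed

lemma d12_diag_eq_inv_poly:
  assumes "symmetric_odd_inverse_family F" "0 \<notin> set us"
  obtains q where "coeff q 0 = 0" "\<And>u. u \<noteq> 0 \<Longrightarrow> d12_diag F g u us = inv_poly q u"
proof -
  obtain D where D: "arity D (Suc (Suc (length us)))"
    "\<And>ts. length ts = Suc (Suc (length us)) \<Longrightarrow> 0 \<notin> set ts \<Longrightarrow> stable_part F g ts = tensor inv_poly D ts"
    using stable_part_tensor_inv_poly[OF assms(1)] by metis
  define q where "q = (\<Sum>(c, ps)\<leftarrow>D. smult (c * prod_list (map2 inv_poly (tl (tl ps)) us))
      (inv_deriv (hd ps) * inv_deriv (hd (tl ps))))"
  have "d12_diag F g t us = inv_poly q t" if "t \<noteq> 0" for t
    using d12_diag_tensor[OF D(1) D(2) that] assms(2)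
    by (simp add: q_def poly_sum_list case_prod_unfold mult_ac)
  moreover have "coeff q 0 = 0"
    unfolding q_def by (induction D) (auto simp: coeff_mult)
  ultimately show thesis using that by blast
qed

lemma principal_part_add_sums:
  assumes "has_laurent f" "\<And>i I. has_laurent (h i I)" "\<And>j. j < m \<Longrightarrow> has_laurent (k j)"
  shows "principal_part (\<lambda>u. f u + (\<Sum>i\<in>A. \<Sum>I\<in>B. h i I u) + (\<Sum>j<m. k j u)) t =
    principal_part f t + (\<Sum>i\<in>A. \<Sum>I\<in>B. principal_part (h i I) t) + (\<Sum>j<m. principal_part (k j) t)"
proof -
  have 1: "has_laurent (\<lambda>u. \<Sum>I\<in>B. h i I u)" for i
    by (intro has_laurent_sum assms(2))
  have 2: "has_laurent (\<lambda>u. \<Sum>i\<in>A. \<Sum>I\<in>B. h i I u)"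
    by (intro has_laurent_sum assms(2))
  have 3: "has_laurent (\<lambda>u. \<Sum>j<m. k j u)"
    by (intro has_laurent_sum assms(3)) simp
  have "principal_part (\<lambda>u. \<Sum>i\<in>A. \<Sum>I\<in>B. h i I u) t =
      (\<Sum>i\<in>A. \<Sum>I\<in>B. principal_part (h i I) t)"
    unfolding principal_part_sum[OF 1] by (intro sum.cong refl principal_part_sum assms(2))
  moreover have "principal_part (\<lambda>u. \<Sum>j<m. k j u) t = (\<Sum>j<m. principal_part (k j) t)"
    by (intro principal_part_sum assms(3)) simp
  ultimately show ?thesis
    by (simp only: principal_part_add[OF has_laurent_add[OF assms(1) 2] 3]
        principal_part_add[OF assms(1) 2])
qed

text \<open>For fixed \<open>ts\<close>, let \<open>Y\<close> be the right-hand side of (B) with the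
  derivatives in t_j left out. Its principal part is the full right-hand side of (B), by
  \<open>principal_part_kernel\<close>, and the principal part of secant times \<open>Y\<close> is
  the right-hand side of (A). Then \<open>principal_part_sec_iff_cos\<close> applies.\<close>

theorem recursion_A_iff_B:
  assumes F: "symmetric_odd_inverse_family F"
  shows "recursion_A F g n \<longleftrightarrow> recursion_B F g n"
proof -
  define Y1 where "Y1 = (\<lambda>ts u. if g = 0 then 0 else 1/2 * d12_diag F (g - 1) u ts)"
  define Y2 where "Y2 = (\<lambda>ts g1 I u. 1/2 * (d1 F g1 u (nths ts I) * d1 F (g - g1) u (nths ts (- I))))"
  define Y3 where "Y3 = (\<lambda>ts j u. ts ! j / (u\<^sup>2 - (ts ! j)\<^sup>2) * d1 F g u (nths ts (- {j})))"
  define Y where "Y = (\<lambda>ts u. Y1 ts u + (\<Sum>g1\<le>g. \<Sum>I\<in>Pow {..<length ts}. Y2 ts g1 I u) +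
      (\<Sum>j<length ts. Y3 ts j u))"
  have sec: "has_laurent (\<lambda>u. csec (2 * of_real pi * u))"
    by (rule has_laurent_analytic[OF csec_analytic])
  have "(\<forall>t. t \<noteq> 0 \<longrightarrow> - d1 F g t ts =
           (if g = 0 then 0 else
              principal_part (\<lambda>u. 1/2 * csec (2 * of_real pi * u) * d12_diag F (g - 1) u ts) t)
         + (\<Sum>g1\<le>g. \<Sum>I\<in>Pow {..<length ts}.
              principal_part (\<lambda>u. 1/2 * csec (2 * of_real pi * u) *
                 d1 F g1 u (nths ts I) * d1 F (g - g1) u (nths ts (- I))) t)
         + (\<Sum>j<length ts.
              principal_part (\<lambda>u. ts ! j * csec (2 * of_real pi * u) / (u\<^sup>2 - (ts ! j)\<^sup>2) *
                 d1 F g u (nths ts (- {j}))) t)) \<longleftrightarrow>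
      (\<forall>t. t \<noteq> 0 \<and> (\<forall>s\<in>set ts. t\<^sup>2 \<noteq> s\<^sup>2) \<longrightarrow>
        - principal_part (\<lambda>u. cos (2 * of_real pi * u) * d1 F g u ts) t =
           (if g = 0 then 0 else 1/2 * d12_diag F (g - 1) t ts)
         + 1/2 * (\<Sum>g1\<le>g. \<Sum>I\<in>Pow {..<length ts}.
              d1 F g1 t (nths ts I) * d1 F (g - g1) t (nths ts (- I)))
         + (\<Sum>j<length ts. ts ! j / (t\<^sup>2 - (ts ! j)\<^sup>2) *
              (d1 F g t (nths ts (- {j})) -
               deriv (\<lambda>u. stable_part F g (ts[j := u])) (ts ! j))))"
    (is "(\<forall>t. t \<noteq> 0 \<longrightarrow> _ = ?A t) \<longleftrightarrow> (\<forall>t. _ \<longrightarrow> _ = ?B t)")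
    if ts: "0 \<notin> set ts" for ts
  proof -
    have ts': "0 \<notin> set (nths ts I)" for I
      using ts by (rule notin_set_nthsI)
    have nz: "ts ! j \<noteq> 0" if "j < length ts" for j
      using ts that by (metis nth_mem)
    have Y1: "\<exists>q. coeff q 0 = 0 \<and> (\<forall>u. u \<noteq> 0 \<longrightarrow> Y1 ts u = inv_poly q u)"
    proof -
      obtain q where "coeff q 0 = 0" "\<And>u. u \<noteq> 0 \<Longrightarrow> d12_diag F (g - 1) u ts = inv_poly q u"
        using d12_diag_eq_inv_poly[OF F ts] by blast
      then show ?thesis
        by (intro exI[of _ "if g = 0 then 0 else smult (1/2) q"]) (simp add: Y1_def)
    qed
    have Y2: "\<exists>q. coeff q 0 = 0 \<and> (\<forall>u. u \<noteq> 0 \<longrightarrow> Y2 ts g1 I u = inv_poly q u)" for g1 I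
    proof -
      obtain q where "coeff q 0 = 0" "\<And>u. u \<noteq> 0 \<Longrightarrow> d1 F g1 u (nths ts I) = inv_poly q u"
        using d1_eq_inv_poly[OF F ts'] by metis
      moreover obtain r where "coeff r 0 = 0"
          "\<And>u. u \<noteq> 0 \<Longrightarrow> d1 F (g - g1) u (nths ts (- I)) = inv_poly r u"
        using d1_eq_inv_poly[OF F ts'] by metis
      ultimately show ?thesis
        by (intro exI[of _ "smult (1/2) (q * r)"]) (simp add: Y2_def coeff_mult)
    qed
    have L1: "has_laurent (Y1 ts)"
      using Y1 has_laurent_poly_inverse by metis
    have L2: "has_laurent (Y2 ts g1 I)" for g1 I
      using Y2 has_laurent_poly_inverse by metis
    have L3: "has_laurent (Y3 ts j)" if "j < length ts" for j
    proof -
      have "has_laurent (\<lambda>u. d1 F g u (nths ts (- {j})))"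
        using d1_eq_inv_poly[OF F ts'] has_laurent_poly_inverse by metis
      moreover have "(\<lambda>u. ts ! j / (u\<^sup>2 - (ts ! j)\<^sup>2)) analytic_on {0}"
        using nz[OF that] by (auto intro!: analytic_intros)
      ultimately show ?thesis
        unfolding Y3_def by (intro has_laurent_mult[OF has_laurent_analytic])
    qed
    note L = L1 L2 L3
    note M = has_laurent_mult[OF sec L1] has_laurent_mult[OF sec L2] has_laurent_mult[OF sec L3]
    have LY: "has_laurent (Y ts)"
      unfolding Y_def by (intro has_laurent_add has_laurent_sum L) auto
    have A: "?A t = principal_part (\<lambda>u. csec (2 * of_real pi * u) * Y ts u) t" for t
    proof -
      have "(\<lambda>u. csec (2 * of_real pi * u) * Y ts u) = (\<lambda>u. csec (2 * of_real pi * u) * Y1 ts u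
          + (\<Sum>g1\<le>g. \<Sum>I\<in>Pow {..<length ts}. csec (2 * of_real pi * u) * Y2 ts g1 I u)
          + (\<Sum>j<length ts. csec (2 * of_real pi * u) * Y3 ts j u))"
        by (simp add: Y_def distrib_left sum_distrib_left)
      then have "principal_part (\<lambda>u. csec (2 * of_real pi * u) * Y ts u) t =
          principal_part (\<lambda>u. csec (2 * of_real pi * u) * Y1 ts u) t
          + (\<Sum>g1\<le>g. \<Sum>I\<in>Pow {..<length ts}. principal_part (\<lambda>u. csec (2 * of_real pi * u) * Y2 ts g1 I u) t)
          + (\<Sum>j<length ts. principal_part (\<lambda>u. csec (2 * of_real pi * u) * Y3 ts j u) t)"
        using principal_part_add_sums[OF M] by simp
      also have "principal_part (\<lambda>u. csec (2 * of_real pi * u) * Y1 ts u) t = (if g = 0 then 0 else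
              principal_part (\<lambda>u. 1/2 * csec (2 * of_real pi * u) * d12_diag F (g - 1) u ts) t)"
        by (simp add: Y1_def mult_ac)
      finally show ?thesis by (simp add: Y2_def Y3_def mult_ac)
    qed
    have B: "?B t = principal_part (Y ts) t" if t: "t \<noteq> 0" "\<forall>s\<in>set ts. t\<^sup>2 \<noteq> s\<^sup>2" for t
    proof -
      have "principal_part (Y ts) t = principal_part (Y1 ts) t
          + (\<Sum>g1\<le>g. \<Sum>I\<in>Pow {..<length ts}. principal_part (Y2 ts g1 I) t)
          + (\<Sum>j<length ts. principal_part (Y3 ts j) t)"
        unfolding Y_def by (rule principal_part_add_sums[OF L])
      moreover have "principal_part (Y1 ts) t = Y1 ts t"
        using Y1 principal_part_poly_inverse t(1) by metis
      moreover have "principal_part (Y2 ts g1 I) t = Y2 ts g1 I t" for g1 I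
        using Y2 principal_part_poly_inverse t(1) by metis
      moreover have "principal_part (Y3 ts j) t = ts ! j / (t\<^sup>2 - (ts ! j)\<^sup>2) *
              (d1 F g t (nths ts (- {j})) - deriv (\<lambda>u. stable_part F g (ts[j := u])) (ts ! j))"
        if j: "j < length ts" for j
      proof -
        obtain q where q: "coeff q 0 = 0" "\<And>x. poly q (- x) = poly q x"
          "\<And>u. u \<noteq> 0 \<Longrightarrow> d1 F g u (nths ts (- {j})) = inv_poly q u"
          using d1_eq_inv_poly[OF F ts'] by metis
        have "deriv (\<lambda>u. stable_part F g (ts[j := u])) (ts ! j) = d1 F g (ts ! j) (nths ts (- {j}))"
          unfolding d1_def using nz[OF j] stable_part_move_to_front[OF F _ ts j]
          by (intro deriv_cong_ev) (auto simp: eventually_nhds intro!: exI[of _ "- {0}"])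
        then show ?thesis
          unfolding Y3_def using principal_part_kernel[OF q(3,1,2) nz[OF j] t(1)] t(2) j by simp
      qed
      ultimately have "principal_part (Y ts) t = Y1 ts t
          + (\<Sum>g1\<le>g. \<Sum>I\<in>Pow {..<length ts}. Y2 ts g1 I t)
          + (\<Sum>j<length ts. ts ! j / (t\<^sup>2 - (ts ! j)\<^sup>2) *
              (d1 F g t (nths ts (- {j})) - deriv (\<lambda>u. stable_part F g (ts[j := u])) (ts ! j)))"
        by simp
      then show ?thesis
        by (simp add: Y1_def Y2_def sum_distrib_left)
    qed
    obtain q where q: "coeff q 0 = 0" "\<And>u. u \<noteq> 0 \<Longrightarrow> d1 F g u ts = inv_poly q u"
      using d1_eq_inv_poly[OF F ts] by metis
    \<comment> \<open>The points excluded in (B) are the entries of \<open>ts\<close> and their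
      negatives, a finite set.\<close>
    have X: "(\<forall>s\<in>set ts. t\<^sup>2 \<noteq> s\<^sup>2) \<longleftrightarrow> t \<notin> set ts \<union> uminus ` set ts" for t
      by (auto simp: power2_eq_iff)
    have "(\<forall>t. t \<noteq> 0 \<longrightarrow> - d1 F g t ts = ?A t) \<longleftrightarrow> (\<forall>t. t \<noteq> 0 \<and> t \<notin> set ts \<union> uminus ` set ts \<longrightarrow>
        - principal_part (\<lambda>u. cos (2 * of_real pi * u) * d1 F g u ts) t = principal_part (Y ts) t)"
      unfolding A by (rule principal_part_sec_iff_cos[OF q(2,1) LY]) auto
    also have "\<dots> \<longleftrightarrow> (\<forall>t. t \<noteq> 0 \<and> (\<forall>s\<in>set ts. t\<^sup>2 \<noteq> s\<^sup>2) \<longrightarrow>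
        - principal_part (\<lambda>u. cos (2 * of_real pi * u) * d1 F g u ts) t = ?B t)"
    proof -
      have "(\<forall>t. P t \<longrightarrow> a t = c t) \<longleftrightarrow> (\<forall>t. P t \<longrightarrow> a t = b t)"
        if "\<And>t. P t \<Longrightarrow> b t = c t" for P and a b c :: "complex \<Rightarrow> complex"
        using that by simp
      then show ?thesis
        unfolding X[symmetric] by this (use B in blast)
    qed
    finally show ?thesis .
  qed
  then show ?thesis
    unfolding recursion_A_def recursion_B_def by meson
qed

section \<open>The Laplace transform of a polynomial\<close>

lemma poly_monom_induct [case_names monom add]:
  fixes p :: "'a :: comm_monoid_add poly"
  assumes "\<And>a i. P (monom a i)" "\<And>p q. P p \<Longrightarrow> P q \<Longrightarrow> P (p + q)"
  shows "P p"
proof -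
  have "P (\<Sum>i\<in>I. monom (coeff p i) i)" if "finite I" for I
    using that
  proof induction
    case empty
    then show ?case using assms(1)[of 0 0] by simp
  qed (auto intro: assms)
  from this[of "{..degree p}"] show ?thesis by (simp add: poly_as_sum_of_monoms)
qed

text \<open>\<open>lap p\<close> is the Laplace transform of \<open>p\<close>, and \<open>lapq p\<close> is the same thing as a polynomial in \<open>1 / t\<close>.\<close>

definition lapq :: "complex poly \<Rightarrow> complex poly" where
  "lapq p = (\<Sum>i\<le>degree p. monom (fact i * coeff p i) (Suc i))"

definition lap :: "complex poly \<Rightarrow> complex \<Rightarrow> complex" where
  "lap p t = poly (lapq p) (inverse t)"

lemma coeff_lapq: "coeff (lapq p) n = (case n of 0 \<Rightarrow> 0 | Suc i \<Rightarrow> fact i * coeff p i)"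
  by (cases n) (auto simp: lapq_def coeff_sum not_le coeff_eq_0)

lemma lapq_add: "lapq (p + q) = lapq p + lapq q"
  by (rule poly_eqI) (auto simp: coeff_lapq algebra_simps split: nat.split)

lemma lapq_smult: "lapq (smult c p) = smult c (lapq p)"
  by (rule poly_eqI) (auto simp: coeff_lapq split: nat.split)

lemma linear_in_poly_lap: "linear_in_poly lap"
  by (simp add: linear_in_poly_def lap_def lapq_add lapq_smult)

lemmas lap_linear = linear_in_polyD[OF linear_in_poly_lap]

lemma lapq_monom: "lapq (monom a i) = monom (fact i * a) (Suc i)"
  by (rule poly_eqI) (auto simp: coeff_lapq split: nat.split)

lemma lap_monom: "lap (monom a i) t = fact i * a / t ^ Suc i"
  by (simp add: lap_def lapq_monom poly_monom field_simps)

lemma tensor_lap: "tensor lap D ts = tensor inv_poly (map (\<lambda>(c, ps). (c, map lapq ps)) D) ts"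
  by (simp add: tensor_def lap_def o_def case_prod_unfold zip_map1)

text \<open>The rule that multiplication by b becomes -d/dt; on coefficients it is (i + 1)! = (i +
  1) i!. The weights b' and b'' of the recursions produce the derivatives in (A) and (B) in this
  way.\<close>

lemma inv_deriv_lapq: "inv_deriv (lapq p) = - lapq (pCons 0 p)"
proof (rule poly_eqI)
  fix n
  show "coeff (inv_deriv (lapq p)) n = coeff (- lapq (pCons 0 p)) n"
    by (cases n; cases "n - 1")
      (auto simp: inv_deriv_def coeff_pCons coeff_pderiv coeff_lapq split: nat.split)
qed

lemma has_field_derivative_lap:
  "t \<noteq> 0 \<Longrightarrow> (lap p has_field_derivative - lap (pCons 0 p) t) (at t)"
  using has_field_derivative_inv_poly[of t "lapq p"]
  by (simp add: inv_deriv_lapq lap_def[abs_def])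

section \<open>Inverse transform and convolution of polynomials\<close>

definition unlapq :: "complex poly \<Rightarrow> complex poly" where
  "unlapq q = (\<Sum>i\<le>degree q. monom (coeff q (Suc i) / fact i) i)"

lemma coeff_unlapq: "coeff (unlapq q) i = coeff q (Suc i) / fact i"
  by (auto simp: unlapq_def coeff_sum not_le coeff_eq_0)

lemma unlapq_add: "unlapq (p + q) = unlapq p + unlapq q"
  by (rule poly_eqI) (auto simp: coeff_unlapq add_divide_distrib)

lemma lapq_unlapq: "coeff q 0 = 0 \<Longrightarrow> lapq (unlapq q) = q"
  by (rule poly_eqI) (auto simp: coeff_lapq coeff_unlapq split: nat.split)

text \<open>Defined through the transforms, so that \<open>lap_conv\<close> is algebra valid for
  every t; \<open>has_integral_conv\<close> identifies it with the convolution integral.\<close>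

definition conv :: "complex poly \<Rightarrow> complex poly \<Rightarrow> complex poly" where
  "conv p q = unlapq (lapq p * lapq q)"

lemma lap_conv: "lap (conv p q) t = lap p t * lap q t"
  unfolding lap_def conv_def by (subst lapq_unlapq) (auto simp: coeff_mult coeff_lapq)

lemma conv_add: "conv (p + p') q = conv p q + conv p' q" "conv p (q + q') = conv p q + conv p q'"
  by (simp_all add: conv_def lapq_add unlapq_add algebra_simps)

lemma conv_monom:
  "conv (monom a i) (monom b j) = monom (fact i * fact j / fact (Suc (i + j)) * a * b) (Suc (i + j))"
  by (rule poly_eqI) (auto simp: conv_def lapq_monom mult_monom coeff_unlapq)

text \<open>The Beta integral, by induction on i. Integration by parts trades a power of x for a
  power of b - x, so j must be arbitrary.\<close>

lemma has_integral_power_convolution: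
  assumes "0 \<le> b"
  shows "((\<lambda>x. x ^ i * (b - x) ^ j) has_integral
    (fact i * fact j / fact (Suc (i + j)) * b ^ Suc (i + j))) {0..b :: real}"
proof (induction i arbitrary: j)
  case 0
  have "((\<lambda>x. (b - x) ^ j) has_integral
      (- ((b - b) ^ Suc j) / Suc j - - ((b - 0) ^ Suc j) / Suc j)) {0..b}"
  proof (rule fundamental_theorem_of_calculus[OF assms])
    show "((\<lambda>x. - ((b - x) ^ Suc j) / Suc j) has_vector_derivative (b - x) ^ j) (at x within {0..b})" for x
      unfolding has_real_derivative_iff_has_vector_derivative[symmetric]
      by (rule derivative_eq_intros refl | simp del: of_nat_Suc power_Suc)+
  qed
  moreover have "fact 0 * fact j / fact (Suc (0 + j)) = 1 / real (Suc j)"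
    by (simp add: divide_simps)
  ultimately show ?case by simp
next
  case (Suc i)
  \<comment> \<open>The integrand is the derivative of x^(i+1) (b - x)^(j+1), which vanishes at both
    ends of the interval.\<close>
  have "((\<lambda>x. (real i + 1) * x ^ i * (b - x) ^ Suc j - (real j + 1) * x ^ Suc i * (b - x) ^ j) has_integral
      (b ^ Suc i * (b - b) ^ Suc j - 0 ^ Suc i * (b - 0) ^ Suc j)) {0..b}"
  proof (rule fundamental_theorem_of_calculus[OF assms])
    show "((\<lambda>x. x ^ Suc i * (b - x) ^ Suc j) has_vector_derivative
        (real i + 1) * x ^ i * (b - x) ^ Suc j - (real j + 1) * x ^ Suc i * (b - x) ^ j) (at x within {0..b})" for x
      unfolding has_real_derivative_iff_has_vector_derivative[symmetric]
      by (rule derivative_eq_intros refl | simp add: algebra_simps del: power_Suc)+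
  qed
  from has_integral_diff[OF has_integral_mult_right[OF Suc[of "Suc j"], of "real i + 1"] this]
  have "((\<lambda>x. (real j + 1) * (x ^ Suc i * (b - x) ^ j)) has_integral
      ((real i + 1) * (fact i * fact (Suc j) / fact (Suc (i + Suc j)) * b ^ Suc (i + Suc j)))) {0..b}"
    by (simp add: mult.assoc del: power_Suc fact_Suc)
  moreover have "(real j + 1) * y / (real j + 1) = y" for y
    by simp
  moreover have "(real i + 1) * (fact i * fact (Suc j) / A * B) / (real j + 1) = fact (Suc i) * fact j / A * B"
    for A B :: real
  proof -
    have "fact (Suc j) = (real j + 1) * fact j" "fact (Suc i) = (real i + 1) * fact i"
      by (simp_all add: algebra_simps)
    moreover have "x * (y * (r * z) / A * B) / r = x * y * z / A * B" if "r \<noteq> 0" for x y z r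
      using that by simp
    moreover have "real j + 1 \<noteq> 0" by simp
    ultimately show ?thesis by metis
  qed
  ultimately show ?case
    using has_integral_divide[of "\<lambda>x. (real j + 1) * (x ^ Suc i * (b - x) ^ j)" _ "{0..b}" "real j + 1"]
    by (metis (no_types, lifting) add_Suc_shift has_integral_cong)
qed

lemma has_integral_conv:
  assumes "0 \<le> b"
  shows "((\<lambda>x. poly p (of_real x) * poly q (of_real (b - x))) has_integral poly (conv p q) (of_real b))
    {0..b :: real}"
proof (induction p rule: poly_monom_induct)
  case (monom a i)
  show ?case
  proof (induction q rule: poly_monom_induct)
    case (monom c j)
    have "((\<lambda>x. of_real (x ^ i * (b - x) ^ j) * (a * c)) has_integral
        of_real (fact i * fact j / fact (Suc (i + j)) * b ^ Suc (i + j)) * (a * c)) {0..b}"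
      by (intro has_integral_mult_left has_integral_of_real has_integral_power_convolution assms)
    then show ?case
      by (simp add: conv_monom poly_monom mult_ac del: fact_Suc power_Suc)
  next
    case (add q q')
    from has_integral_add[OF this] show ?case
      by (simp add: conv_add distrib_left)
  qed
next
  case (add p p')
  from has_integral_add[OF this] show ?case
    by (simp add: conv_add distrib_right)
qed

lemma LINT_conv:
  assumes "0 \<le> b"
  shows "(LINT x:{0..b}|lborel. poly p (of_real x) * poly q (of_real (b - x))) = poly (conv p q) (of_real b)"
proof -
  have "set_integrable lborel {0..b} (\<lambda>x. poly p (of_real x) * poly q (of_real (b - x)))"
    by (intro borel_integrable_atLeastAtMost' continuous_intros)
  then show ?thesis
    using set_borel_integral_eq_integral(2) has_integral_conv[OF assms, of p q]
    by (metis integral_unique)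
qed

section \<open>Imaginary shifts and multiplication by the cosine\<close>

definition shift_mean :: "complex poly \<Rightarrow> complex poly" where
  "shift_mean p = smult (1/2) (pcompose p [:2 * of_real pi * \<i>, 1:] + pcompose p [:- (2 * of_real pi * \<i>), 1:])"

lemma poly_shift_mean:
  "poly (shift_mean p) x = (poly p (x + 2 * of_real pi * \<i>) + poly p (x - 2 * of_real pi * \<i>)) / 2"
  by (simp add: shift_mean_def poly_pcompose algebra_simps)

lemma fls_prpart_const_mult: "fls_prpart (fls_const c * L) = smult c (fls_prpart L)"
  for L :: "complex fls"
  by (rule poly_eqI) simp

text \<open>Multiplying a Laplace transform by \<open>exp (c u)\<close> translates the original function by \<open>c\<close>,
  modulo functions that are regular at \<open>0\<close>.\<close>

lemma prpart_exp_lap: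
  "\<exists>L. lap p has_laurent_expansion L \<and>
     (\<forall>c. fls_prpart (fps_to_fls (fps_exp c) * L) = lapq (pcompose p [:c, 1:]))"
proof (induction p)
  case 0
  show ?case by (intro exI[of _ 0]) (auto simp: lap_def[abs_def] lapq_def)
next
  case (pCons a p)
  then obtain L where L: "lap p has_laurent_expansion L"
    "\<And>c. fls_prpart (fps_to_fls (fps_exp c) * L) = lapq (pcompose p [:c, 1:])" by blast
  let ?L = "fls_const a * fls_X_inv - fls_deriv L"
  have const: "lap [:a:] u = a * inverse u" for u
    using lap_monom[of a 0 u] by (simp add: monom_0 field_simps)
  have lapq_const: "lapq [:a:] = [:0, a:]"
    using lapq_monom[of a 0] by (simp add: monom_0 monom_Suc)
  have eq: "lap (pCons a p) u = a * inverse u - deriv (lap p) u" if "u \<noteq> 0" for u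
  proof -
    have "lap (pCons a p) u = lap ([:a:] + pCons 0 p) u" by simp
    then show ?thesis
      using DERIV_imp_deriv[OF has_field_derivative_lap[OF that, of p]]
      by (simp only: lap_linear const diff_minus_eq_add)
  qed
  have "(\<lambda>u. a * inverse u - deriv (lap p) u) has_laurent_expansion fls_const a * inverse fls_X - fls_deriv L"
    by (intro laurent_expansion_intros L)
  moreover have "eventually (\<lambda>u. lap (pCons a p) u = a * inverse u - deriv (lap p) u) (at 0)"
    unfolding eventually_at_filter by (intro always_eventually allI impI eq)
  ultimately have "lap (pCons a p) has_laurent_expansion ?L"
    unfolding fls_inverse_X by (rule has_laurent_expansion_transfer[rotated])
  moreover have "fls_prpart (fps_to_fls (fps_exp c) * ?L) = lapq (pcompose (pCons a p) [:c, 1:])" for c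
  proof -
    let ?E = "fps_to_fls (fps_exp c)"
    have dE: "fls_deriv ?E = fls_const c * ?E"
      by (simp add: fls_deriv_fps_to_fls fls_times_fps_to_fls)
    \<comment> \<open>The product rule for exp(c u) L. On the side of polynomials it says that x
      p(x) is translated to (x + c) p(x + c).\<close>
    have *: "?E * fls_deriv L = fls_deriv (?E * L) - fls_const c * (?E * L)"
      by (simp add: dE algebra_simps)
    have "fls_prpart (?E * fls_deriv L) = - lapq (pCons 0 (pcompose p [:c, 1:])) - smult c (lapq (pcompose p [:c, 1:]))"
      unfolding * using inv_deriv_lapq[of "pcompose p [:c, 1:]"]
      by (simp only: fls_prpart_minus fls_prpart_deriv fls_prpart_const_mult L(2)) (simp add: inv_deriv_def)
    moreover have "fls_prpart (?E * (fls_const a * fls_X_inv)) = [:0, a:]"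
    proof -
      have "?E * (fls_const a * fls_X_inv) = fls_const a * (fls_X_inv * ?E)"
        by (simp only: mult_ac)
      also have "fls_prpart \<dots> = [:0, a:]"
        by (rule poly_eqI) (auto simp: fls_X_inv_times_conv_shift coeff_pCons split: nat.split)
      finally show ?thesis .
    qed
    ultimately have "fls_prpart (?E * ?L) = lapq [:a:] + lapq (pCons 0 (pcompose p [:c, 1:])) +
        lapq (smult c (pcompose p [:c, 1:]))"
      by (simp add: right_diff_distrib lapq_const lapq_smult)
    moreover have "pcompose (pCons a p) [:c, 1:] =
        [:a:] + pCons 0 (pcompose p [:c, 1:]) + smult c (pcompose p [:c, 1:])"
      by (simp add: pcompose_pCons)
    ultimately show ?thesis by (simp only: lapq_add)
  qed
  ultimately show ?case by blast
qed

text \<open>The cosine is the average of exp(2 pi i u) and exp(-2 pi i u), and each exponential acts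
  as a translation by \<open>prpart_exp_lap\<close>.\<close>

lemma principal_part_cos_lap:
  "principal_part (\<lambda>u. cos (2 * of_real pi * u) * lap p u) t = lap (shift_mean p) t"
proof -
  let ?c = "2 * of_real pi * \<i>"
  obtain L where L: "lap p has_laurent_expansion L"
    "\<And>c. fls_prpart (fps_to_fls (fps_exp c) * L) = lapq (pcompose p [:c, 1:])"
    using prpart_exp_lap by blast
  have e: "(\<lambda>u. exp (c * u)) has_laurent_expansion fps_to_fls (fps_exp c)" for c :: complex
    by (intro has_laurent_expansion_fps has_fps_expansion_exp)
  have "(\<lambda>u. 1/2 * (exp (?c * u) * lap p u + exp (- ?c * u) * lap p u)) has_laurent_expansion
     fls_const (1/2) * (fps_to_fls (fps_exp ?c) * L + fps_to_fls (fps_exp (- ?c)) * L)"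
    by (intro laurent_expansion_intros e L)
  moreover have "(\<lambda>u. cos (2 * of_real pi * u) * lap p u) =
      (\<lambda>u. 1/2 * (exp (?c * u) * lap p u + exp (- ?c * u) * lap p u))"
    by (auto simp: cos_exp_eq algebra_simps)
  ultimately show ?thesis
    by (simp only: principal_part_eq fls_prpart_const_mult fls_prpart_plus L(2) lap_def shift_mean_def
        lapq_smult lapq_add)
qed

text \<open>The algebraic form of the Laplace transform of \<open>(r (b + c) + r (b - c)) / 2\<close> in \<open>b\<close> and \<open>c\<close>.\<close>

definition splits :: "complex poly \<Rightarrow> bool" where
  "splits r \<longleftrightarrow> (\<exists>L. (\<forall>b c. (poly r (b + c) + poly r (b - c)) / 2 =
        (\<Sum>(\<alpha>, p, q)\<leftarrow>L. \<alpha> * poly p b * poly q c)) \<and>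
     (\<forall>t s. t \<noteq> 0 \<and> s \<noteq> 0 \<and> t\<^sup>2 \<noteq> s\<^sup>2 \<longrightarrow>
        (\<Sum>(\<alpha>, p, q)\<leftarrow>L. \<alpha> * lap p t * lap q s) = s / (t\<^sup>2 - s\<^sup>2) * (lap r s - lap r t)))"

lemma splits_0: "splits 0"
  unfolding splits_def by (rule exI[of _ "[]"]) (simp add: lap_linear)

lemma splits_add:
  assumes "splits p" "splits q"
  shows "splits (p + q)"
proof -
  obtain L where L: "\<forall>b c. (poly p (b + c) + poly p (b - c)) / 2 =
        (\<Sum>(\<alpha>, p, q)\<leftarrow>L. \<alpha> * poly p b * poly q c)"
     "\<forall>t s. t \<noteq> 0 \<and> s \<noteq> 0 \<and> t\<^sup>2 \<noteq> s\<^sup>2 \<longrightarrow>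
        (\<Sum>(\<alpha>, p, q)\<leftarrow>L. \<alpha> * lap p t * lap q s) = s / (t\<^sup>2 - s\<^sup>2) * (lap p s - lap p t)"
    using assms(1) unfolding splits_def by blast
  obtain M where M: "\<forall>b c. (poly q (b + c) + poly q (b - c)) / 2 =
        (\<Sum>(\<alpha>, p, q)\<leftarrow>M. \<alpha> * poly p b * poly q c)"
     "\<forall>t s. t \<noteq> 0 \<and> s \<noteq> 0 \<and> t\<^sup>2 \<noteq> s\<^sup>2 \<longrightarrow>
        (\<Sum>(\<alpha>, p, q)\<leftarrow>M. \<alpha> * lap p t * lap q s) = s / (t\<^sup>2 - s\<^sup>2) * (lap q s - lap q t)"
    using assms(2) unfolding splits_def by blast
  show ?thesis
    unfolding splits_def
    by (rule exI[of _ "L @ M"])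
      (use L M in \<open>auto simp: lap_linear distrib_left right_diff_distrib add_divide_distrib
        simp flip: L(1)[rule_format] M(1)[rule_format]\<close>)
qed

lemma sum_list_upt_map: "(\<Sum>x\<leftarrow>map f [0..<Suc m]. h x) = (\<Sum>i\<le>m. h (f i))"
  for h :: "'a \<Rightarrow> complex"
  by (simp add: o_def interv_sum_list_conv_sum_set_nat atLeast0LessThan lessThan_Suc_atMost del: upt_Suc)

text \<open>Only even powers of c survive in the average of (b + c)^N and (b - c)^N. Under the
  transform the factorials (N - 2i)! and (2i)! cancel the binomial coefficient, leaving a geometric
  sum in 1/t^2 and 1/s^2, whose closed form is the divided difference.\<close>

lemma splits_odd_monom:
  "splits (monom a (Suc (2 * m)))"
proof -
  let ?N = "Suc (2 * m)"
  let ?L = "map (\<lambda>i. (a * of_nat (?N choose (2 * i)), monom 1 (?N - 2 * i), monom 1 (2 * i))) [0..<Suc m]"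
  have "(poly (monom a ?N) (b + c) + poly (monom a ?N) (b - c)) / 2 =
      (\<Sum>(\<alpha>, p, q)\<leftarrow>?L. \<alpha> * poly p b * poly q c)" for b c
  proof -
    have "(c + b) ^ ?N + (- c + b) ^ ?N =
        (\<Sum>k\<le>?N. of_nat (?N choose k) * (c ^ k + (- c) ^ k) * b ^ (?N - k))"
      unfolding binomial_ring by (simp add: algebra_simps flip: sum.distrib del: power_Suc)
    also have "\<dots> = (\<Sum>k\<in>{k. k \<le> ?N \<and> even k}. of_nat (?N choose k) * (c ^ k + (- c) ^ k) * b ^ (?N - k))"
      by (rule sum.mono_neutral_right) (auto simp: power_minus_odd)
    also have "\<dots> = (\<Sum>i\<le>m. of_nat (?N choose (2 * i)) * (c ^ (2 * i) + (- c) ^ (2 * i)) * b ^ (?N - 2 * i))"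
      by (rule sum.reindex_bij_witness[of _ "\<lambda>i. 2 * i" "\<lambda>k. k div 2"]) auto
    also have "\<dots> = (\<Sum>i\<le>m. 2 * (of_nat (?N choose (2 * i)) * b ^ (?N - 2 * i) * c ^ (2 * i)))"
    proof (intro sum.cong refl)
      have "(- c) ^ (2 * i) = c ^ (2 * i)" for i by (simp add: power_mult)
      then show "of_nat (?N choose (2 * i)) * (c ^ (2 * i) + (- c) ^ (2 * i)) * b ^ (?N - 2 * i) =
          2 * (of_nat (?N choose (2 * i)) * b ^ (?N - 2 * i) * c ^ (2 * i))" for i
        by (simp only: mult_2 [symmetric] mult_ac)
    qed
    finally have *: "(c + b) ^ ?N + (- c + b) ^ ?N =
        (\<Sum>i\<le>m. 2 * (of_nat (?N choose (2 * i)) * b ^ (?N - 2 * i) * c ^ (2 * i)))" .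
    have "(poly (monom a ?N) (b + c) + poly (monom a ?N) (b - c)) / 2 =
        a * ((c + b) ^ ?N + (- c + b) ^ ?N) / 2"
      by (simp only: poly_monom add.commute[of b c] diff_conv_add_uminus add.commute[of b "- c"] distrib_left)
    also have "\<dots> = (\<Sum>i\<le>m. a * of_nat (?N choose (2 * i)) * b ^ (?N - 2 * i) * c ^ (2 * i))"
      unfolding * by (simp only: sum_distrib_left sum_divide_distrib) (simp only: mult_ac times_divide_eq_left[symmetric], simp)
    also have "\<dots> = (\<Sum>(\<alpha>, p, q)\<leftarrow>?L. \<alpha> * poly p b * poly q c)"
      unfolding sum_list_upt_map by (simp only: prod.case poly_monom mult_1)
    finally show ?thesis .
  qed
  moreover have "(\<Sum>(\<alpha>, p, q)\<leftarrow>?L. \<alpha> * lap p t * lap q s) =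
      s / (t\<^sup>2 - s\<^sup>2) * (lap (monom a ?N) s - lap (monom a ?N) t)"
    if "t \<noteq> 0" "s \<noteq> 0" "t\<^sup>2 \<noteq> s\<^sup>2" for t s
  proof -
    \<comment> \<open>In the inverse variables every summand is a monomial.\<close>
    define y z where "y = inverse t" and "z = inverse s"
    have yz: "y\<^sup>2 \<noteq> z\<^sup>2" "t = inverse y" "s = inverse z" "y \<noteq> 0" "z \<noteq> 0"
      using that by (auto simp: y_def z_def power_inverse)
    have summand: "a * of_nat (?N choose (2 * i)) * lap (monom 1 (?N - 2 * i)) t * lap (monom 1 (2 * i)) s =
        fact ?N * a * (y\<^sup>2 * z) * ((y\<^sup>2) ^ (m - i) * (z\<^sup>2) ^ i)" if "i \<le> m" for i
    proof -
      have "Suc (?N - 2 * i) = 2 + 2 * (m - i)" using that by simp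
      then have "y ^ Suc (?N - 2 * i) = y\<^sup>2 * (y\<^sup>2) ^ (m - i)"
        by (simp only: power_add power_mult)
      moreover have "z ^ Suc (2 * i) = z * (z\<^sup>2) ^ i"
        by (simp add: power_mult)
      moreover have "of_nat (?N choose (2 * i)) * (fact (?N - 2 * i) * fact (2 * i)) = (fact ?N :: complex)"
        using binomial_fact_lemma[of "2 * i" ?N] that
        by (metis (no_types, lifting) le_SucI mult.commute mult_le_mono2 of_nat_fact of_nat_mult)
      ultimately show ?thesis
        unfolding lap_monom yz(2,3) power_inverse
        by (simp add: divide_inverse mult_ac del: power_Suc fact_Suc binomial_Suc_Suc)
    qed
    have "(\<Sum>(\<alpha>, p, q)\<leftarrow>?L. \<alpha> * lap p t * lap q s) =
        (\<Sum>i\<le>m. fact ?N * a * (y\<^sup>2 * z) * ((y\<^sup>2) ^ (m - i) * (z\<^sup>2) ^ i))"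
      unfolding sum_list_upt_map prod.case by (intro sum.cong refl summand) simp
    also have "\<dots> = fact ?N * a * (y\<^sup>2 * z) * (\<Sum>i\<le>m. (y\<^sup>2) ^ (m - i) * (z\<^sup>2) ^ i)"
      by (simp add: sum_distrib_left)
    \<comment> \<open>The geometric sum telescopes; t^2 and s^2 being different keeps the
      denominator nonzero.\<close>
    also have "(\<Sum>i\<le>m. (y\<^sup>2) ^ (m - i) * (z\<^sup>2) ^ i) = ((y\<^sup>2) ^ Suc m - (z\<^sup>2) ^ Suc m) / (y\<^sup>2 - z\<^sup>2)"
    proof -
      have "(z\<^sup>2) ^ Suc m - (y\<^sup>2) ^ Suc m = (z\<^sup>2 - y\<^sup>2) * (\<Sum>i\<le>m. (y\<^sup>2) ^ (m - i) * (z\<^sup>2) ^ i)"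
        unfolding diff_power_eq_sum lessThan_Suc_atMost by (simp only: mult.commute)
      then have "(y\<^sup>2) ^ Suc m - (z\<^sup>2) ^ Suc m = (\<Sum>i\<le>m. (y\<^sup>2) ^ (m - i) * (z\<^sup>2) ^ i) * (y\<^sup>2 - z\<^sup>2)"
        by (metis minus_diff_eq mult_minus_left mult.commute)
      then show ?thesis using yz(1) by (simp add: eq_divide_eq)
    qed
    also have "fact ?N * a * (y\<^sup>2 * z) * (((y\<^sup>2) ^ Suc m - (z\<^sup>2) ^ Suc m) / (y\<^sup>2 - z\<^sup>2)) =
       (y\<^sup>2 * z) / (z\<^sup>2 - y\<^sup>2) * (fact ?N * a * (z\<^sup>2) ^ Suc m - fact ?N * a * (y\<^sup>2) ^ Suc m)"
      using yz(1) by (simp add: field_simps del: power_Suc fact_Suc)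
    also have "(y\<^sup>2 * z) / (z\<^sup>2 - y\<^sup>2) = s / (t\<^sup>2 - s\<^sup>2)"
    proof -
      have "t\<^sup>2 - s\<^sup>2 = (z\<^sup>2 - y\<^sup>2) / (y\<^sup>2 * z\<^sup>2)"
        unfolding yz(2,3) using yz(4,5) by (simp add: field_simps)
      then have "s / (t\<^sup>2 - s\<^sup>2) = (s * z) * (y\<^sup>2 * z) / (z\<^sup>2 - y\<^sup>2)"
        by (simp add: power2_eq_square)
      also have "s * z = 1" using yz(3,5) by simp
      finally show ?thesis by simp
    qed
    also have "fact ?N * a * (z\<^sup>2) ^ Suc m - fact ?N * a * (y\<^sup>2) ^ Suc m = lap (monom a ?N) s - lap (monom a ?N) t"
      unfolding lap_monom yz(2,3) power_inverse
      by (simp add: divide_inverse power_mult power2_eq_square del: fact_Suc)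
    finally show ?thesis .
  qed
  ultimately show ?thesis unfolding splits_def by blast
qed

lemma odd_poly_coeff:
  assumes "\<And>x. poly r (- x) = - poly r x" "even i"
  shows "coeff r i = (0 :: complex)"
proof -
  have "pcompose r [:0, -1:] = - r"
    using assms(1) by (simp add: poly_pcompose fun_eq_iff flip: poly_eq_poly_eq_iff)
  then have "(- 1) ^ i * coeff r i = - coeff r i"
    using coeff_pcompose_linear[of r "-1" i] by simp
  then show ?thesis using assms(2) by (simp add: equal_neg_zero)
qed

lemma splits_odd:
  assumes "\<And>x. poly r (- x) = - poly r x"
  shows "splits r"
proof -
  have monom: "splits (monom (coeff r i) i)" for i
  proof (cases "even i")
    case True
    then show ?thesis using odd_poly_coeff[OF assms] splits_0 by simp
  next
    case False
    then obtain m where "i = Suc (2 * m)" by (auto elim: oddE)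
    then show ?thesis using splits_odd_monom by simp
  qed
  have "splits (\<Sum>i\<in>I. monom (coeff r i) i)" if "finite I" for I
    using that by induction (auto intro: splits_0 splits_add monom)
  from this[of "{..degree r}"] show ?thesis by (simp add: poly_as_sum_of_monoms)
qed

section \<open>Laplace integrals\<close>

lemma power_le_exp:
  fixes y :: real
  assumes "0 \<le> y"
  shows "y ^ k \<le> fact k * exp y"
proof -
  have "(\<Sum>n\<in>{k}. y ^ n /\<^sub>R fact n) \<le> (\<Sum>n. y ^ n /\<^sub>R fact n)"
    by (rule sum_le_suminf[OF summable_exp_generic]) (use assms in auto)
  then show ?thesis by (simp add: exp_def field_simps)
qed

lemma integrable_exp_abs:
  fixes a :: real
  assumes "a > 0"
  shows "integrable lborel (\<lambda>x. exp (- (a * \<bar>x\<bar>)))"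
proof -
  have "((\<lambda>x. - exp (- (a * x)) / a) \<longlongrightarrow> - 0 / a) at_top"
    by (intro tendsto_intros filterlim_compose[OF exp_at_bot] filterlim_uminus_at_top[THEN iffD1]
        filterlim_tendsto_pos_mult_at_top[OF tendsto_const assms] filterlim_ident) (use assms in auto)
  then have "(\<integral>\<^sup>+x. ennreal (exp (- (a * x))) * indicator {0 ..} x \<partial>lborel) = - 0 / a - - exp (- (a * 0)) / a"
    by (intro nn_integral_FTC_atLeast) (use assms in \<open>auto intro!: derivative_eq_intros\<close>)
  then have fin: "(\<integral>\<^sup>+x. ennreal (exp (- (a * x))) * indicator {0 ..} x \<partial>lborel) < \<infinity>"
    by (simp only: ennreal_less_top infinity_ennreal_def)
  have half: "integrable lborel (\<lambda>x. indicator {0..} x *\<^sub>R exp (- (a * x)))"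
  proof (rule integrableI_bounded)
    have "ennreal (norm (indicator {0..} x *\<^sub>R exp (- (a * x)))) =
        ennreal (exp (- (a * x))) * indicator {0 ..} x" for x :: real
      by (auto simp: indicator_def)
    then show "(\<integral>\<^sup>+x. ennreal (norm (indicator {0..} x *\<^sub>R exp (- (a * x)))) \<partial>lborel) < \<infinity>"
      using fin by simp
  qed simp
  \<comment> \<open>The reflected copy, in the shape of an affine substitution; the two half lines
    together dominate the function on the whole line.\<close>
  have "integrable lborel (\<lambda>x. indicator {0..} (0 + (-1) * x) *\<^sub>R exp (- (a * (0 + (-1) * x))))"
    by (rule lborel_integrable_real_affine[OF half]) simp
  from Bochner_Integration.integrable_add[OF half this] show ?thesis
    by (rule Bochner_Integration.integrable_bound) (auto simp: indicator_def)
qed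

text \<open>Half of the exponential decay absorbs the power: apply y^k <= k! exp(y) to y = a |x| /
  2, which is where the factor (2/a)^k comes from.\<close>

lemma integrable_power_exp_abs:
  fixes a :: real
  assumes "a > 0"
  shows "integrable lborel (\<lambda>x. \<bar>x\<bar> ^ k * exp (- (a * \<bar>x\<bar>)))"
proof -
  have "integrable lborel (\<lambda>x. fact k * (2 / a) ^ k * exp (- (a / 2 * \<bar>x\<bar>)))"
    using assms by (intro integrable_mult_right integrable_exp_abs) simp
  then show ?thesis
  proof (rule Bochner_Integration.integrable_bound)
    show "AE x in lborel. norm (\<bar>x\<bar> ^ k * exp (- (a * \<bar>x\<bar>))) \<le>
        norm (fact k * (2 / a) ^ k * exp (- (a / 2 * \<bar>x\<bar>)))"
    proof (rule AE_I2)
      fix x :: real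
      have "(a / 2 * \<bar>x\<bar>) ^ k \<le> fact k * exp (a / 2 * \<bar>x\<bar>)"
        using assms by (intro power_le_exp) simp
      then have "(2 / a) ^ k * (a / 2 * \<bar>x\<bar>) ^ k \<le> (2 / a) ^ k * (fact k * exp (a / 2 * \<bar>x\<bar>))"
        using assms by (intro mult_left_mono) auto
      moreover have "(2 / a) ^ k * (a / 2 * \<bar>x\<bar>) ^ k = \<bar>x\<bar> ^ k"
        using assms by (simp flip: power_mult_distrib)
      ultimately have "\<bar>x\<bar> ^ k * exp (- (a * \<bar>x\<bar>)) \<le>
          (2 / a) ^ k * (fact k * exp (a / 2 * \<bar>x\<bar>)) * exp (- (a * \<bar>x\<bar>))"
        by (intro mult_right_mono) auto
      also have "\<dots> = fact k * (2 / a) ^ k * exp (- (a / 2 * \<bar>x\<bar>))"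
        by (simp add: mult_ac flip: exp_add)
      finally show "norm (\<bar>x\<bar> ^ k * exp (- (a * \<bar>x\<bar>))) \<le>
          norm (fact k * (2 / a) ^ k * exp (- (a / 2 * \<bar>x\<bar>)))"
        using assms by simp
    qed
  qed simp
qed

lemma LINT_half_line_derivative:
  fixes f F :: "real \<Rightarrow> complex"
  assumes "\<And>x. (F has_vector_derivative f x) (at x)" "\<And>x. isCont f x"
    and "set_integrable lborel {0<..} f" "(F \<longlongrightarrow> 0) at_top"
  shows "(LINT x:{0<..}|lborel. f x) = - F 0"
proof -
  have cont: "isCont F 0"
    using assms(1) has_vector_derivative_continuous by blast
  have "(LBINT x=ereal 0..\<infinity>. f x) = 0 - F 0"
  proof (rule interval_integral_FTC_integrable)
    show "((F \<circ> real_of_ereal) \<longlongrightarrow> F 0) (at_right (ereal 0))"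
      using cont by (simp add: ereal_tendsto_simps1 isCont_def filterlim_at_split)
    show "((F \<circ> real_of_ereal) \<longlongrightarrow> 0) (at_left \<infinity>)"
      using assms(4) by (simp add: ereal_tendsto_simps1)
  qed (use assms in auto)
  then show ?thesis by (simp add: interval_integral_to_infinity_eq)
qed

lemma norm_monom_exp: "norm (of_real x ^ k * exp (- (of_real x * t))) = \<bar>x\<bar> ^ k * exp (- (Re t * x))"
  by (simp add: norm_mult norm_power mult.commute)

lemma set_integrable_monom_exp:
  fixes t :: complex
  assumes "Re t > 0"
  shows "set_integrable lborel {0<..} (\<lambda>x. of_real x ^ k * exp (- (of_real x * t)))"
  unfolding set_integrable_def
  by (rule Bochner_Integration.integrable_bound[OF integrable_power_exp_abs[OF assms, of k]])
    (auto simp: indicator_def norm_monom_exp)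

lemma tendsto_monom_exp:
  fixes t :: complex
  assumes "Re t > 0"
  shows "((\<lambda>x. of_real x ^ k * exp (- (of_real x * t))) \<longlongrightarrow> 0) at_top"
proof (rule tendsto_norm_zero_cancel)
  let ?a = "Re t"
  have "((\<lambda>x. inverse ?a ^ k * ((?a * x) ^ k / exp (?a * x))) \<longlongrightarrow> inverse ?a ^ k * 0) at_top"
    by (intro tendsto_mult tendsto_const filterlim_compose[OF tendsto_power_div_exp_0]
        filterlim_tendsto_pos_mult_at_top[OF tendsto_const assms] filterlim_ident)
  moreover have "eventually (\<lambda>x. inverse ?a ^ k * ((?a * x) ^ k / exp (?a * x)) =
      norm (of_real x ^ k * exp (- (of_real x * t)))) at_top"
    using eventually_ge_at_top[of 0]
    by eventually_elim
      (use assms in \<open>simp only: norm_monom_exp, simp add: power_mult_distrib exp_minus field_simps\<close>)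
  ultimately show "((\<lambda>x. norm (of_real x ^ k * exp (- (of_real x * t)))) \<longlongrightarrow> 0) at_top"
    by (simp add: Lim_transform_eventually)
qed

lemma LINT_monom_exp:
  fixes t :: complex
  assumes "Re t > 0"
  shows "(LINT x:{0<..}|lborel. of_real x ^ k * exp (- (of_real x * t))) = fact k / t ^ Suc k"
proof (induction k)
  case 0
  have t: "t \<noteq> 0" using assms by auto
  have "(LINT x:{0<..}|lborel. - t * (of_real x ^ 0 * exp (- (of_real x * t)))) =
      - (of_real 0 ^ 0 * exp (- (of_real 0 * t)))"
  proof (rule LINT_half_line_derivative)
    show "((\<lambda>x. complex_of_real x ^ 0 * exp (- (of_real x * t))) has_vector_derivative
        - t * (of_real x ^ 0 * exp (- (of_real x * t)))) (at x)" for x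
      by (rule has_vector_derivative_eq_rhs, rule has_vector_derivative_real_field)
        (auto intro!: derivative_eq_intros)
    show "set_integrable lborel {0<..} (\<lambda>x. - t * (of_real x ^ 0 * exp (- (of_real x * t))))"
      by (intro set_integrable_mult_right set_integrable_monom_exp assms)
    show "((\<lambda>x. of_real x ^ 0 * exp (- (of_real x * t))) \<longlongrightarrow> 0) at_top"
      by (rule tendsto_monom_exp[OF assms])
  qed (auto intro!: continuous_intros)
  then have "- t * (LINT x:{0<..}|lborel. of_real x ^ 0 * exp (- (of_real x * t))) = - 1"
    unfolding set_integral_mult_right by simp
  then show ?case using t by (simp add: field_simps)
next
  case (Suc k)
  have t: "t \<noteq> 0" using assms by auto
  \<comment> \<open>Integration by parts: the integrand is the derivative of x^(k+1) exp(-x t),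
    which vanishes at 0 and at infinity.\<close>
  have "(LINT x:{0<..}|lborel. of_nat (Suc k) * (of_real x ^ k * exp (- (of_real x * t))) -
      t * (of_real x ^ Suc k * exp (- (of_real x * t)))) = - (of_real 0 ^ Suc k * exp (- (of_real 0 * t)))"
  proof (rule LINT_half_line_derivative)
    show "((\<lambda>x. complex_of_real x ^ Suc k * exp (- (of_real x * t))) has_vector_derivative
       of_nat (Suc k) * (of_real x ^ k * exp (- (of_real x * t))) -
        t * (of_real x ^ Suc k * exp (- (of_real x * t)))) (at x)" for x
    proof (rule has_vector_derivative_real_field)
      show "((\<lambda>z. z ^ Suc k * exp (- (z * t))) has_field_derivative
        of_nat (Suc k) * (of_real x ^ k * exp (- (of_real x * t))) -
          t * (of_real x ^ Suc k * exp (- (of_real x * t)))) (at (of_real x))"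
        by (rule derivative_eq_intros refl | simp add: algebra_simps del: power_Suc)+
    qed
  qed (auto intro!: continuous_intros tendsto_monom_exp set_integrable_mult_right set_integral_diff
      set_integrable_monom_exp assms simp del: power_Suc of_nat_Suc)
  then have "of_nat (Suc k) * (fact k / t ^ Suc k) -
      t * (LINT x:{0<..}|lborel. of_real x ^ Suc k * exp (- (of_real x * t))) = 0"
    by (subst (asm) set_integral_diff)
      (auto intro!: set_integrable_mult_right set_integrable_monom_exp assms simp: Suc
        simp del: power_Suc of_nat_Suc)
  then show ?case using t by (simp add: field_simps)
qed

lemma
  fixes t :: complex
  assumes "Re t > 0"
  shows set_integrable_poly_exp:
      "set_integrable lborel {0<..} (\<lambda>x. poly p (of_real x) * exp (- (of_real x * t)))" (is "?I p")
    and LINT_poly_exp: "(LINT x:{0<..}|lborel. poly p (of_real x) * exp (- (of_real x * t))) = lap p t"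
      (is "?V p")
proof -
  have "?I p \<and> ?V p"
  proof (induction p rule: poly_monom_induct)
    case (monom a i)
    show ?case
      using set_integrable_monom_exp[OF assms, of i] LINT_monom_exp[OF assms, of i]
      by (simp add: poly_monom lap_monom mult.assoc del: power_Suc) 
  next
    case (add p q)
    then show ?case
      by (simp add: distrib_right lap_linear set_integral_add)
  qed
  then show "?I p" "?V p" by auto
qed

lemma laplace_integral_product:
  assumes "length ps = n" "length ts = n" "\<forall>t\<in>set ts. Re t > 0"
  defines "f \<equiv> \<lambda>b. prod_list (map2 poly ps (map (\<lambda>i. complex_of_real (b i)) [0..<n])) *
    exp (- (\<Sum>i<n. complex_of_real (b i) * ts ! i))"
  shows "set_integrable (\<Pi>\<^sub>M i\<in>{..<n}. lborel) (\<Pi>\<^sub>E i\<in>{..<n}. {0<..}) f"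
    and "(LINT b:(\<Pi>\<^sub>E i\<in>{..<n}. {0<..})|(\<Pi>\<^sub>M i\<in>{..<n}. lborel). f b) = prod_list (map2 lap ps ts)"
proof -
  interpret product_sigma_finite "\<lambda>i :: nat. lborel :: real measure" ..
  \<comment> \<open>Each factor carries its own half-line indicator, so the product vanishes off the
    box and Fubini applies on the full product space.\<close>
  define h where "h = (\<lambda>i x. indicator {0<..} x *\<^sub>R (poly (ps ! i) (complex_of_real x) * exp (- (of_real x * ts ! i))))"
  have "Re (ts ! i) > 0" if "i < n" for i using assms that by simp
  note h = set_integrable_poly_exp[OF this, unfolded set_integrable_def]
    LINT_poly_exp[OF this, unfolded set_lebesgue_integral_def]
  have eq: "indicator (\<Pi>\<^sub>E i\<in>{..<n}. {0<..}) b *\<^sub>R f b = (\<Prod>i\<in>{..<n}. h i (b i))"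
    if "b \<in> space (\<Pi>\<^sub>M i\<in>{..<n}. lborel)" for b
  proof -
    have ext: "b \<in> extensional {..<n}" using that by (simp add: space_PiM PiE_def)
    have "prod_list (map2 poly ps (map (\<lambda>i. complex_of_real (b i)) [0..<n])) =
        (\<Prod>i<n. poly (ps ! i) (of_real (b i)))"
      using assms(1) by (simp add: prod.list_conv_set_nth lessThan_atLeast0)
    then have f: "f b = (\<Prod>i<n. poly (ps ! i) (complex_of_real (b i)) * exp (- (of_real (b i) * ts ! i)))"
      unfolding f_def by (simp add: exp_sum prod.distrib flip: sum_negf)
    show ?thesis
    proof (cases "\<forall>i<n. b i > 0")
      case True
      then show ?thesis using ext by (simp add: f h_def PiE_def)
    next
      case False
      then obtain i where i: "i < n" "\<not> b i > 0" by blast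
      then have "h i (b i) = 0" by (simp add: h_def)
      then have "(\<Prod>i\<in>{..<n}. h i (b i)) = 0" using i by auto
      moreover have "b \<notin> (\<Pi>\<^sub>E i\<in>{..<n}. {0<..})" using i by (auto simp: PiE_def Pi_def)
      ultimately show ?thesis by simp
    qed
  qed
  have int: "integrable lborel (h i)" if "i \<in> {..<n}" for i
    unfolding h_def using h(1) that by simp
  show "set_integrable (\<Pi>\<^sub>M i\<in>{..<n}. lborel) (\<Pi>\<^sub>E i\<in>{..<n}. {0<..}) f"
    unfolding set_integrable_def
    using product_integrable_prod[of "{..<n}" h, OF _ int] by (subst Bochner_Integration.integrable_cong[OF refl eq]) auto
  have "(LINT b:(\<Pi>\<^sub>E i\<in>{..<n}. {0<..})|(\<Pi>\<^sub>M i\<in>{..<n}. lborel). f b) =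
      (\<Prod>i\<in>{..<n}. integral\<^sup>L lborel (h i))"
    unfolding set_lebesgue_integral_def
    using product_integral_prod[of "{..<n}" h, OF _ int] by (subst Bochner_Integration.integral_cong[OF refl eq]) auto
  also have "\<dots> = (\<Prod>i\<in>{..<n}. lap (ps ! i) (ts ! i))"
    by (intro prod.cong refl) (simp add: h h_def)
  also have "\<dots> = prod_list (map2 lap ps ts)"
    using assms(1,2) by (simp add: prod.list_conv_set_nth lessThan_atLeast0)
  finally show "(LINT b:(\<Pi>\<^sub>E i\<in>{..<n}. {0<..})|(\<Pi>\<^sub>M i\<in>{..<n}. lborel). f b) = prod_list (map2 lap ps ts)" .
qed

text \<open>Integrability is carried through the induction because the Lebesgue integral is additive
  only on integrable functions.\<close>

lemma laplace_integral_tensor: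
  assumes "arity D n" "length ts = n" "\<forall>t\<in>set ts. Re t > 0"
  shows "set_integrable (\<Pi>\<^sub>M i\<in>{..<n}. lborel) (\<Pi>\<^sub>E i\<in>{..<n}. {0<..})
      (\<lambda>b. tensor poly D (map (\<lambda>i. complex_of_real (b i)) [0..<n]) *
        exp (- (\<Sum>i<n. complex_of_real (b i) * ts ! i))) \<and>
    (LINT b:(\<Pi>\<^sub>E i\<in>{..<n}. {0<..})|(\<Pi>\<^sub>M i\<in>{..<n}. lborel).
      tensor poly D (map (\<lambda>i. complex_of_real (b i)) [0..<n]) *
        exp (- (\<Sum>i<n. complex_of_real (b i) * ts ! i))) = tensor lap D ts"
  using assms(1)
proof (induction D)
  case Nil
  then show ?case by (simp add: set_integrable_def)
next
  case (Cons cp D)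
  obtain c ps where cp: "cp = (c, ps)" by (cases cp)
  then have "length ps = n" "arity D n" using Cons.prems by auto
  note 1 = laplace_integral_product[OF this(1) assms(2,3)] and 2 = Cons.IH[OF this(2)]
  show ?case
    unfolding cp tensor_Cons distrib_right mult.assoc
    using 1 2 by (subst set_integral_add) (auto intro!: set_integral_add set_integrable_mult_right)
qed

lemma infinite_Re_pos: "infinite {t :: complex. Re t > 0}"
proof
  assume "finite {t :: complex. Re t > 0}"
  then have "finite (Re ` {t :: complex. Re t > 0})" by (rule finite_imageI)
  moreover have "{0 :: real<..} \<subseteq> Re ` {t :: complex. Re t > 0}"
    by (auto intro!: image_eqI[of _ _ "complex_of_real _"])
  ultimately show False using infinite_Ioi finite_subset by blast
qed

text \<open>\<open>F\<close> is given by the integral only for Re t_i > 0 and elsewhere as a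
  polynomial in the 1/t_i. Inversion preserves the right half plane, which is infinite, so this
  polynomial and the one read off from \<open>D\<close> agree everywhere.\<close>

lemma laplace_transform_tensor:
  assumes "arity D n" "\<And>xs. length xs = n \<Longrightarrow> f xs = tensor poly D xs" "is_laplace_transform n f F"
    and "length ts = n" "0 \<notin> set ts"
  shows "F ts = tensor lap D ts"
proof -
  let ?D = "map (\<lambda>(c, ps). (c, map lapq ps)) D"
  have ar: "arity ?D n" using assms(1) by (auto simp: arity_def)
  have "polynomial_in_inverses n F" using assms(3) unfolding is_laplace_transform_def by blast
  then obtain E where E: "arity E n"
    "\<And>ts. length ts = n \<Longrightarrow> 0 \<notin> set ts \<Longrightarrow> F ts = tensor inv_poly E ts"
    using polynomial_in_inverses_imp_tensor by blast
  have "tensor poly E xs = tensor poly ?D xs" if xs: "length xs = n" "set xs \<subseteq> {t. Re t > 0}" for xs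
  proof -
    define us where "us = map inverse xs"
    have us: "length us = n" "\<forall>t\<in>set us. Re t > 0" and xs': "xs = map inverse us"
    proof -
      show "length us = n" using xs by (simp add: us_def)
      show "xs = map inverse us" by (simp add: us_def o_def)
      have "Re (inverse t) > 0" if "t \<in> set xs" for t
      proof -
        have "Re t > 0" using that xs by auto
        then have "(Re t)\<^sup>2 + (Im t)\<^sup>2 > 0" by (simp add: add_pos_nonneg)
        with \<open>Re t > 0\<close> show ?thesis by (simp add: inverse_complex.sel)
      qed
      then show "\<forall>t\<in>set us. Re t > 0" by (auto simp: us_def)
    qed
    then have nz: "0 \<notin> set us" by force
    have "F us = tensor lap D us"
      using assms(3) us laplace_integral_tensor[OF assms(1) us] assms(2)
      unfolding is_laplace_transform_def by simp
    then show ?thesis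
      using E(2)[OF us(1) nz] by (simp add: tensor_lap tensor_inv_poly xs')
  qed
  then have "tensor poly E (map inverse ts) = tensor poly ?D (map inverse ts)"
    using tensor_unique[OF linear_in_poly_poly infinite_Re_pos E(1) ar] assms(4) by simp
  then show ?thesis
    using E(2)[OF assms(4,5)] by (simp add: tensor_lap tensor_inv_poly)
qed

section \<open>Super volumes and their Laplace transforms\<close>

lemma is_even_coeff:
  assumes "is_even p" "odd i"
  shows "coeff p i = 0"
proof -
  have "pcompose p [:0, -1:] = p"
    using assms(1) by (simp add: is_even_def poly_pcompose fun_eq_iff flip: poly_eq_poly_eq_iff)
  then have "(- 1) ^ i * coeff p i = coeff p i"
    using coeff_pcompose_linear[of p "-1" i] by simp
  then show ?thesis using assms(2) by simp
qed

text \<open>Even powers x^(2k) have transforms proportional to the odd powers 1/t^(2k+1).\<close>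

lemma lap_uminus:
  assumes "is_even p"
  shows "lap p (- t) = - lap p t"
proof -
  have "pcompose (lapq p) [:0, -1:] = - lapq p"
  proof (rule poly_eqI)
    fix n
    show "coeff (pcompose (lapq p) [:0, -1:]) n = coeff (- lapq p) n"
    proof (cases n)
      case (Suc i)
      then show ?thesis
        using is_even_coeff[OF assms, of i] by (cases "even i") (auto simp: coeff_pcompose_linear coeff_lapq)
    qed (simp add: coeff_lapq poly_0_coeff_0)
  qed
  then have "poly (pcompose (lapq p) [:0, -1:]) (inverse t) = - poly (lapq p) (inverse t)"
    by simp
  then show ?thesis by (simp add: lap_def poly_pcompose)
qed

definition even_tensor :: "(complex \<times> complex poly list) list \<Rightarrow> bool" where
  "even_tensor D \<longleftrightarrow> (\<forall>(c, ps)\<in>set D. \<forall>p\<in>set ps. is_even p)"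

lemma prod_list_lap_uminus:
  assumes "length ps = length ts" "i < length ts" "\<forall>p\<in>set ps. is_even p"
  shows "prod_list (map2 lap ps (ts[i := - (ts ! i)])) = - prod_list (map2 lap ps ts)"
  using assms
proof (induction ps ts arbitrary: i rule: list_induct2)
  case (Cons p ps t ts)
  then show ?case by (cases i) (auto simp: lap_uminus)
qed simp

lemma tensor_lap_uminus:
  assumes "even_tensor D" "arity D (length ts)" "i < length ts"
  shows "tensor lap D (ts[i := - (ts ! i)]) = - tensor lap D ts"
  using assms by (induction D) (auto simp: even_tensor_def prod_list_lap_uminus)

lemma tensor_permute:
  assumes "p permutes {..<n}" "arity D n" "length xs = n"
  shows "tensor u (map (\<lambda>(c, ps). (c, permute_list p ps)) D) (permute_list p xs) = tensor u D xs"
  using assms(2)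
proof (induction D)
  case (Cons d D)
  obtain c ps where d: "d = (c, ps)" by (cases d)
  have l: "length ps = n" using Cons.prems d by simp
  have "map2 u (permute_list p ps) (permute_list p xs) = permute_list p (map2 u ps xs)"
    using assms l by (simp add: permute_list_map flip: permute_list_zip[OF assms(1)])
  then have "prod_list (map2 u (permute_list p ps) (permute_list p xs)) = prod_list (map2 u ps xs)"
    using assms l by (simp flip: prod_mset_prod_list)
  then show ?case using Cons by (simp add: d)
qed simp

lemma super_volume_tensor:
  assumes "super_volume_family V"
  obtains D where "arity D n" "even_tensor D"
    "\<And>xs. length xs = n \<Longrightarrow> stable_part V g xs = tensor poly D xs"
proof (cases "stable g n")
  case True
  then have V: "polynomial_in n (V g)"
    "\<And>bs i. length bs = n \<Longrightarrow> i < n \<Longrightarrow> V g (bs[i := - (bs ! i)]) = V g bs"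
    using assms unfolding super_volume_family_def by blast+
  obtain D where "arity D n" "\<And>xs. length xs = n \<Longrightarrow> V g xs = tensor poly D xs"
    "\<And>c ps p. (c, ps) \<in> set D \<Longrightarrow> p \<in> set ps \<Longrightarrow> is_even p"
    using polynomial_in_imp_even_tensor[OF V] by blast
  then show thesis using True by (intro that[of D]) (auto simp: stable_part_def even_tensor_def)
next
  case False
  then show thesis by (intro that[of "[]"]) (auto simp: stable_part_def even_tensor_def)
qed

lemma laplace_family_tensor:
  assumes "super_volume_family V" "laplace_transform_family V F" "stable g n"
  obtains D where "arity D n" "even_tensor D"
    "\<And>xs. length xs = n \<Longrightarrow> V g xs = tensor poly D xs"
    "\<And>ts. length ts = n \<Longrightarrow> 0 \<notin> set ts \<Longrightarrow> F g ts = tensor lap D ts"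
proof -
  obtain D where D: "arity D n" "even_tensor D"
    "\<And>xs. length xs = n \<Longrightarrow> stable_part V g xs = tensor poly D xs"
    using super_volume_tensor[OF assms(1)] by blast
  have V: "V g xs = tensor poly D xs" if "length xs = n" for xs
    using D(3)[OF that] assms(3) that by (simp add: stable_part_def)
  have "is_laplace_transform n (V g) (F g)"
    using assms(2,3) unfolding laplace_transform_family_def by blast
  from laplace_transform_tensor[OF D(1) V this] show thesis
    using that[of D] D(1,2) V by blast
qed

lemma stable_part_laplace_tensor:
  assumes "super_volume_family V" "laplace_transform_family V F"
  obtains D where "arity D n" "even_tensor D"
    "\<And>xs. length xs = n \<Longrightarrow> stable_part V g xs = tensor poly D xs"
    "\<And>ts. length ts = n \<Longrightarrow> 0 \<notin> set ts \<Longrightarrow> stable_part F g ts = tensor lap D ts"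
proof (cases "stable g n")
  case True
  obtain D where "arity D n" "even_tensor D"
    "\<And>xs. length xs = n \<Longrightarrow> V g xs = tensor poly D xs"
    "\<And>ts. length ts = n \<Longrightarrow> 0 \<notin> set ts \<Longrightarrow> F g ts = tensor lap D ts"
    using laplace_family_tensor[OF assms True] by blast
  then show thesis using True by (intro that[of D]) (auto simp: stable_part_def)
next
  case False
  then show thesis by (intro that[of "[]"]) (auto simp: stable_part_def even_tensor_def)
qed

text \<open>Permuting the factors of \<open>D\<close> gives another list for the same symmetric
  volume; by \<open>tensor_unique\<close> the two lists also have the same transform, which is the
  symmetry of \<open>F\<close>. Oddness holds because the factors of \<open>D\<close> are
  even.\<close>

lemma laplace_family_symmetric_odd:
  assumes "super_volume_family V" "laplace_transform_family V F"
  shows "symmetric_odd_inverse_family F"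
  unfolding symmetric_odd_inverse_family_def
proof (intro allI impI)
  fix g n assume st: "stable g n"
  obtain D where D: "arity D n" "even_tensor D"
    "\<And>xs. length xs = n \<Longrightarrow> V g xs = tensor poly D xs"
    "\<And>ts. length ts = n \<Longrightarrow> 0 \<notin> set ts \<Longrightarrow> F g ts = tensor lap D ts"
    using laplace_family_tensor[OF assms st] by blast
  have sym: "V g cs = V g bs" if "length bs = n" "mset cs = mset bs" for bs cs
    using assms(1) st that unfolding super_volume_family_def by blast
  have "F g us = F g ts" if ts: "length ts = n" "0 \<notin> set ts" "mset us = mset ts" for ts us
  proof -
    obtain p where p: "p permutes {..<length ts}" "permute_list p ts = us"
      using mset_eq_permutation[OF ts(3)] by blast
    let ?E = "map (\<lambda>(c, ps). (c, permute_list p ps)) D"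
    note perm = tensor_permute[OF p(1)[unfolded ts(1)] D(1)]
    have us: "length us = n" "0 \<notin> set us"
      using ts by (metis size_mset, metis set_mset_mset)
    have E: "arity ?E n" using D(1) by (auto simp: arity_def)
    have "tensor poly D xs = tensor poly ?E xs" if xs: "length xs = n" for xs
    proof -
      \<comment> \<open>The preimage of an arbitrary \<open>xs\<close> under the permutation;
        \<open>tensor_permute\<close> at \<open>ys\<close> evaluates the permuted list at
        \<open>xs\<close>.\<close>
      define ys where "ys = permute_list (inv p) xs"
      have inv: "inv p permutes {..<n}" using p(1) ts(1) permutes_inv by blast
      have ys: "length ys = n" "permute_list p ys = xs"
      proof -
        show "length ys = n" using xs by (simp add: ys_def)
        have "permute_list p (permute_list (inv p) xs) = permute_list (inv p \<circ> p) xs"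
          using p(1) ts(1) xs by (intro permute_list_compose[symmetric]) simp
        also have "inv p \<circ> p = id" using p(1) permutes_inv_o(2) by blast
        finally show "permute_list p ys = xs" by (simp add: ys_def)
      qed
      have "mset ys = mset xs" using inv xs by (simp add: ys_def)
      then have "V g ys = V g xs" using sym xs by blast
      then show ?thesis using perm[OF ys(1), of poly] D(3) xs ys by simp
    qed
    then have "tensor lap D us = tensor lap ?E us"
      by (intro tensor_unique[OF linear_in_poly_lap infinite_UNIV_char_0 D(1) E]) (use us in auto)
    also have "\<dots> = tensor lap D ts" using perm[OF ts(1)] p(2) by simp
    finally show ?thesis using D(4) ts us by simp
  qed
  moreover have "F g (ts[i := - (ts ! i)]) = - F g ts" if "length ts = n" "0 \<notin> set ts" "i < n" for ts i
  proof -
    have "ts ! i \<noteq> 0" using that by (metis nth_mem)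
    then have "0 \<notin> set (ts[i := - (ts ! i)])"
      using that set_update_subset_insert[of ts i "- (ts ! i)"] by auto
    then show ?thesis using that D tensor_lap_uminus[OF D(2)] by simp
  qed
  moreover have "polynomial_in_inverses n (F g)"
    using assms(2) st unfolding laplace_transform_family_def is_laplace_transform_def by blast
  ultimately show "polynomial_in_inverses n (F g) \<and>
      (\<forall>ts us. length ts = n \<and> 0 \<notin> set ts \<and> mset us = mset ts \<longrightarrow> F g us = F g ts) \<and>
      (\<forall>ts i. length ts = n \<and> 0 \<notin> set ts \<and> i < n \<longrightarrow> F g (ts[i := - (ts ! i)]) = - F g ts)"
    by blast
qed

section \<open>The Laplace transform of the recursion with shifts\<close>

text \<open>A functional \<open>\<Phi>\<close> of the evaluation \<open>u\<close> covers both sides of the Laplace transform: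
  \<open>\<Phi> poly\<close> is a function of the lengths and \<open>\<Phi> lap\<close> is its transform.\<close>

definition rep :: "nat \<Rightarrow> ((complex poly \<Rightarrow> complex \<Rightarrow> complex) \<Rightarrow> complex list \<Rightarrow> complex) \<Rightarrow> bool" where
  "rep m \<Phi> \<longleftrightarrow> (\<exists>E. arity E m \<and>
     (\<forall>u xs. linear_in_poly u \<longrightarrow> length xs = m \<longrightarrow> \<Phi> u xs = tensor u E xs))"

lemma rep_tensor: "arity E m \<Longrightarrow> rep m (\<lambda>u. tensor u E)"
  unfolding rep_def by blast

lemma rep_zero: "rep m (\<lambda>u xs. 0)"
  unfolding rep_def by (rule exI[of _ "[]"]) simp

lemma rep_add:
  assumes "rep m \<Phi>" "rep m \<Psi>"
  shows "rep m (\<lambda>u xs. \<Phi> u xs + \<Psi> u xs)"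
proof -
  obtain D E where "arity D m" "\<And>u xs. linear_in_poly u \<Longrightarrow> length xs = m \<Longrightarrow> \<Phi> u xs = tensor u D xs"
    "arity E m" "\<And>u xs. linear_in_poly u \<Longrightarrow> length xs = m \<Longrightarrow> \<Psi> u xs = tensor u E xs"
    using assms unfolding rep_def by blast
  then show ?thesis unfolding rep_def by (intro exI[of _ "D @ E"]) simp
qed

lemma rep_scale:
  assumes "rep m \<Phi>"
  shows "rep m (\<lambda>u xs. c * \<Phi> u xs)"
proof -
  obtain D where "arity D m" "\<And>u xs. linear_in_poly u \<Longrightarrow> length xs = m \<Longrightarrow> \<Phi> u xs = tensor u D xs"
    using assms unfolding rep_def by blast
  then show ?thesis
    unfolding rep_def
    by (intro exI[of _ "map (\<lambda>(a, ps). (c * a, ps)) D"]) (simp add: arity_map_scale tensor_map_scale)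
qed

lemma rep_sum: "(\<And>i. i \<in> I \<Longrightarrow> rep m (\<Phi> i)) \<Longrightarrow> rep m (\<lambda>u xs. \<Sum>i\<in>I. \<Phi> i u xs)"
  by (induction I rule: infinite_finite_induct) (auto intro: rep_zero rep_add)

lemma rep_cong:
  assumes "\<And>u xs. linear_in_poly u \<Longrightarrow> length xs = m \<Longrightarrow> \<Phi> u xs = \<Psi> u xs" "rep m \<Psi>"
  shows "rep m \<Phi>"
  using assms unfolding rep_def by auto

lemma infinite_of_real_pos: "infinite (complex_of_real ` {0<..})"
  using infinite_Ioi finite_imageD[of complex_of_real "{0<..}"] by (auto simp: inj_on_def)

text \<open>The transfer from lengths to transforms: positive real lengths suffice because they form
  an infinite set.\<close>

lemma rep_unique:
  assumes "rep m \<Phi>" "rep m \<Psi>"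
    and "\<And>bs. length bs = m \<Longrightarrow> \<forall>b\<in>set bs. b > 0 \<Longrightarrow>
           \<Phi> poly (map complex_of_real bs) = \<Psi> poly (map complex_of_real bs)"
    and "length ts = m"
  shows "\<Phi> lap ts = \<Psi> lap ts"
proof -
  obtain D E where D: "arity D m" "\<And>u xs. linear_in_poly u \<Longrightarrow> length xs = m \<Longrightarrow> \<Phi> u xs = tensor u D xs"
    and E: "arity E m" "\<And>u xs. linear_in_poly u \<Longrightarrow> length xs = m \<Longrightarrow> \<Psi> u xs = tensor u E xs"
    using assms(1,2) unfolding rep_def by blast
  note infinite_of_real_pos
  moreover have "tensor poly D xs = tensor poly E xs"
    if xs: "length xs = m" "set xs \<subseteq> complex_of_real ` {0<..}" for xs
  proof -
    have "map complex_of_real (map Re xs) = map (\<lambda>x. x) xs"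
      unfolding map_map o_def by (rule map_cong) (use xs in auto)
    moreover have "\<forall>b\<in>set (map Re xs). b > 0" using xs by auto
    ultimately show ?thesis
      using assms(3)[of "map Re xs"] xs D(2) E(2) linear_in_poly_poly by simp
  qed
  ultimately have "tensor lap D ts = tensor lap E ts"
    using tensor_unique[OF linear_in_poly_lap _ D(1) E(1)] assms(4) by blast
  then show ?thesis using D(2) E(2) assms(4) linear_in_poly_lap by simp
qed

lemma rep_merge:
  assumes "length ps = length (nths [0..<m] I)" "length qs = length (nths [0..<m] (- I))"
  shows "rep (Suc m) (\<lambda>u xs. u p (hd xs) * (prod_list (map2 u ps (nths (tl xs) I)) *
      prod_list (map2 u qs (nths (tl xs) (- I)))))"
proof -
  obtain rs where rs: "length rs = m" "\<And>(u :: complex poly \<Rightarrow> complex \<Rightarrow> complex) xs. length xs = m \<Longrightarrow>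
      prod_list (map2 u ps (nths xs I)) * prod_list (map2 u qs (nths xs (- I))) = prod_list (map2 u rs xs)"
    using merge_nths[OF assms] by blast
  show ?thesis
    unfolding rep_def
  proof (intro exI conjI allI impI)
    show "arity [(1, p # rs)] (Suc m)" using rs(1) by simp
    fix u :: "complex poly \<Rightarrow> complex \<Rightarrow> complex" and xs :: "complex list"
    assume "length xs = Suc m"
    then show "u p (hd xs) * (prod_list (map2 u ps (nths (tl xs) I)) *
      prod_list (map2 u qs (nths (tl xs) (- I)))) = tensor u [(1, p # rs)] xs"
      using rs(2)[of "tl xs" u] by (cases xs) auto
  qed
qed

text \<open>\<open>pCons 0 p\<close> is b p(b), so the weights b' and b'' of the recursions are
  built into the convolution. Its transform is the product of the derivatives of the two transforms;
  the signs cancel.\<close>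

definition conv1 :: "complex poly \<Rightarrow> complex poly \<Rightarrow> complex poly" where
  "conv1 p q = conv (pCons 0 p) (pCons 0 q)"

lemma unlapq_smult: "unlapq (smult c p) = smult c (unlapq p)"
  by (rule poly_eqI) (auto simp: coeff_unlapq)

lemma unlapq_0 [simp]: "unlapq 0 = 0"
  by (rule poly_eqI) (auto simp: coeff_unlapq)

lemma lapq_0 [simp]: "lapq 0 = 0"
  by (rule poly_eqI) (auto simp: coeff_lapq split: nat.split)

lemma conv1_linear:
  "conv1 (p + p') q = conv1 p q + conv1 p' q" "conv1 p (q + q') = conv1 p q + conv1 p q'"
  "conv1 (smult c p) q = smult c (conv1 p q)" "conv1 p (smult c q) = smult c (conv1 p q)"
  "conv1 0 q = 0" "conv1 p 0 = 0"
proof -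
  have e: "pCons 0 (a + b) = pCons 0 a + pCons 0 b" "pCons 0 (smult c a) = smult c (pCons 0 a)"
    for a b :: "complex poly" by simp_all
  show "conv1 (p + p') q = conv1 p q + conv1 p' q" "conv1 p (q + q') = conv1 p q + conv1 p q'"
    unfolding conv1_def e by (simp_all only: conv_add)
  show "conv1 (smult c p) q = smult c (conv1 p q)" "conv1 p (smult c q) = smult c (conv1 p q)"
    unfolding conv1_def e
    by (simp_all only: conv_def lapq_smult unlapq_smult mult_smult_left mult_smult_right)
  show "conv1 0 q = 0" "conv1 p 0 = 0" by (simp_all add: conv1_def conv_def)
qed

lemma slice_simps:
  "slice u [] xs = 0"
  "slice u ((c, ps) # D) xs = smult (c * prod_list (map2 u (tl ps) xs)) (hd ps) + slice u D xs"
  by (simp_all add: slice_def)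

text \<open>For the products of two volumes. As \<open>conv1\<close> is bilinear, both lists can be
  expanded; in a single pair the first factors are convolved and the remaining ones are interleaved
  along \<open>I\<close> and its complement.\<close>

lemma rep_conv1_slices:
  assumes "arity D (Suc (length (nths [0..<m] I)))" "arity E (Suc (length (nths [0..<m] (- I))))"
  shows "rep (Suc m) (\<lambda>u xs. u (conv1 (slice u D (nths (tl xs) I)) (slice u E (nths (tl xs) (- I)))) (hd xs))"
  using assms(1)
proof (induction D)
  case Nil
  show ?case by (rule rep_cong[OF _ rep_zero]) (simp add: slice_simps conv1_linear linear_in_polyD)
next
  case (Cons d D)
  obtain c ps where d: "d = (c, ps)" by (cases d)
  have ps: "length (tl ps) = length (nths [0..<m] I)" using Cons.prems d by simp
  have "rep (Suc m) (\<lambda>u xs. c * (prod_list (map2 u (tl ps) (nths (tl xs) I)) *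
      u (conv1 (hd ps) (slice u E (nths (tl xs) (- I)))) (hd xs)))"
    using assms(2)
  proof (induction E)
    case Nil
    show ?case by (rule rep_cong[OF _ rep_zero]) (simp add: slice_simps conv1_linear linear_in_polyD)
  next
    case (Cons e E)
    obtain c' qs where e: "e = (c', qs)" by (cases e)
    have qs: "length (tl qs) = length (nths [0..<m] (- I))" using Cons.prems e by simp
    show ?case
      by (rule rep_cong[OF _ rep_add[OF rep_scale[OF rep_scale[OF rep_merge[OF ps qs]]] Cons.IH],
            of _ c c' "conv1 (hd ps) (hd qs)"])
        (use Cons.prems in \<open>simp_all add: e slice_simps conv1_linear linear_in_polyD distrib_left mult_ac\<close>)
  qed
  from rep_add[OF this Cons.IH] show ?case
    by (rule rep_cong[rotated])
      (use Cons.prems in \<open>simp_all add: d slice_simps conv1_linear linear_in_polyD mult_ac\<close>)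
qed

definition map_head :: "(complex poly \<Rightarrow> complex poly) \<Rightarrow>
    (complex \<times> complex poly list) list \<Rightarrow> (complex \<times> complex poly list) list" where
  "map_head \<phi> D = map (\<lambda>(c, ps). (c, \<phi> (hd ps) # tl ps)) D"

lemma arity_map_head: "arity D (Suc n) \<Longrightarrow> arity (map_head \<phi> D) (Suc n)"
  by (auto simp: arity_def map_head_def)

lemma slice_map_head:
  assumes "\<And>p q. \<phi> (p + q) = \<phi> p + \<phi> q" "\<And>c p. \<phi> (smult c p) = smult c (\<phi> p)"
  shows "slice u (map_head \<phi> D) xs = \<phi> (slice u D xs)"
proof (induction D)
  case Nil
  have "\<phi> 0 = 0" using assms(2)[of 0 0] by simp
  then show ?case by (simp add: slice_simps map_head_def)
next
  case (Cons d D)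
  then show ?case by (cases d) (simp add: slice_simps map_head_def assms)
qed

lemma rep_slice:
  assumes "\<And>p q. \<phi> (p + q) = \<phi> p + \<phi> q" "\<And>c p. \<phi> (smult c p) = smult c (\<phi> p)" "arity D (Suc m)"
  shows "rep (Suc m) (\<lambda>u xs. u (\<phi> (slice u D (tl xs))) (hd xs))"
proof (rule rep_cong[OF _ rep_tensor[OF arity_map_head[OF assms(3), of \<phi>]]])
  fix u and xs :: "complex list" assume "linear_in_poly u" "length xs = Suc m"
  then show "u (\<phi> (slice u D (tl xs))) (hd xs) = tensor u (map_head \<phi> D) xs"
    using tensor_eq_slice[OF _ arity_map_head[OF assms(3), of \<phi>], of u "hd xs" "tl xs"]
    by (cases xs) (simp_all add: slice_map_head assms)
qed

text \<open>For the term of genus g - 1: the factors in b' and b - b' merge into one polynomial in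
  b.\<close>

definition contract :: "(complex \<times> complex poly list) list \<Rightarrow> (complex \<times> complex poly list) list" where
  "contract D = map (\<lambda>(c, ps). (c, conv1 (hd ps) (hd (tl ps)) # tl (tl ps))) D"

lemma arity_contract: "arity D (Suc (Suc n)) \<Longrightarrow> arity (contract D) (Suc n)"
  by (auto simp: arity_def contract_def)

lemma poly_conv1_integral:
  assumes "0 \<le> b"
  shows "(LINT x:{0..b}|lborel. of_real (x * (b - x)) * poly p (of_real x) * poly q (of_real b - of_real x)) =
    poly (conv1 p q) (of_real b)"
  using LINT_conv[OF assms, of "pCons 0 p" "pCons 0 q"] by (simp add: conv1_def mult_ac)

lemma LINT_contract:
  assumes "arity D (Suc (Suc n))" "0 \<le> b"
  shows "set_integrable lborel {0..b} (\<lambda>x. of_real (x * (b - x)) * tensor poly D (of_real x # (of_real b - of_real x) # xs)) \<and>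
    (LINT x:{0..b}|lborel. of_real (x * (b - x)) * tensor poly D (of_real x # (of_real b - of_real x) # xs)) =
    tensor poly (contract D) (of_real b # xs)"
  using assms(1)
proof (induction D)
  case Nil
  then show ?case by (simp add: contract_def set_integrable_def)
next
  case (Cons d D)
  obtain c p q ps where d: "d = (c, p # q # ps)" using Cons.prems by (cases d) (auto simp: length_Suc_conv)
  have IH: "set_integrable lborel {0..b} (\<lambda>x. of_real (x * (b - x)) * tensor poly D (of_real x # (of_real b - of_real x) # xs))"
    "(LINT x:{0..b}|lborel. of_real (x * (b - x)) * tensor poly D (of_real x # (of_real b - of_real x) # xs)) =
    tensor poly (contract D) (of_real b # xs)"
    using Cons by (auto simp: d)
  have int: "set_integrable lborel {0..b} (\<lambda>x. (c * prod_list (map2 poly ps xs)) *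
      (of_real (x * (b - x)) * poly p (of_real x) * poly q (of_real b - of_real x)))"
    by (intro borel_integrable_atLeastAtMost' continuous_intros)
  have eq: "of_real (x * (b - x)) * tensor poly (d # D) (of_real x # (of_real b - of_real x) # xs) =
     (c * prod_list (map2 poly ps xs)) * (of_real (x * (b - x)) * poly p (of_real x) * poly q (of_real b - of_real x)) +
     of_real (x * (b - x)) * tensor poly D (of_real x # (of_real b - of_real x) # xs)" for x
    by (simp add: d distrib_left mult_ac)
  show ?case
    unfolding eq
    using set_integral_add[OF int IH(1)] IH(2) poly_conv1_integral[OF assms(2), of p q]
    by (simp add: contract_def d)
qed

lemma rep_sum_list: "(\<And>x. x \<in> set L \<Longrightarrow> rep m (\<Phi> x)) \<Longrightarrow> rep m (\<lambda>u xs. \<Sum>x\<leftarrow>L. \<Phi> x u xs)"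
  by (induction L) (auto intro: rep_zero rep_add)

text \<open>The term in b + b_j and b - b_j mixes two variables, so it is not an operation on the
  first factor alone. For an even factor p the polynomial b p(b) is odd, and
  \<open>splits_odd\<close> separates b from b_j. Induction on \<open>D\<close> adds up these
  contributions.\<close>

lemma rep_reflect:
  assumes "j < m" "arity D (Suc (length (nths [0..<m] (- {j}))))" "even_tensor D"
  shows "\<exists>\<Phi>. rep (Suc m) \<Phi> \<and>
    (\<forall>b xs. length xs = m \<longrightarrow> \<Phi> poly (b # xs) =
       ((b + xs ! j) * tensor poly D ((b + xs ! j) # nths xs (- {j})) +
        (b - xs ! j) * tensor poly D ((b - xs ! j) # nths xs (- {j}))) / 2) \<and>
    (\<forall>t ts. length ts = m \<and> t \<noteq> 0 \<and> ts ! j \<noteq> 0 \<and> t\<^sup>2 \<noteq> (ts ! j)\<^sup>2 \<longrightarrow> \<Phi> lap (t # ts) =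
       ts ! j / (t\<^sup>2 - (ts ! j)\<^sup>2) * (lap (pCons 0 (slice lap D (nths ts (- {j})))) (ts ! j) -
         lap (pCons 0 (slice lap D (nths ts (- {j})))) t))"
  using assms(2,3)
proof (induction D)
  case Nil
  show ?case
    by (rule exI[of _ "\<lambda>u xs. 0"]) (simp add: rep_zero slice_simps lap_linear)
next
  case (Cons d D)
  obtain c p ps where d: "d = (c, p # ps)" and ps: "length ps = length (nths [0..<m] (- {j}))"
    using Cons.prems by (cases d) (auto simp: length_Suc_conv)
  have D: "arity D (Suc (length (nths [0..<m] (- {j}))))" "even_tensor D" and even: "is_even p"
    using Cons.prems by (auto simp: d even_tensor_def)
  obtain \<Phi> where \<Phi>: "rep (Suc m) \<Phi>"
    "\<And>b xs. length xs = m \<Longrightarrow> \<Phi> poly (b # xs) =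
       ((b + xs ! j) * tensor poly D ((b + xs ! j) # nths xs (- {j})) +
        (b - xs ! j) * tensor poly D ((b - xs ! j) # nths xs (- {j}))) / 2"
    "\<And>t ts. length ts = m \<and> t \<noteq> 0 \<and> ts ! j \<noteq> 0 \<and> t\<^sup>2 \<noteq> (ts ! j)\<^sup>2 \<Longrightarrow> \<Phi> lap (t # ts) =
       ts ! j / (t\<^sup>2 - (ts ! j)\<^sup>2) * (lap (pCons 0 (slice lap D (nths ts (- {j})))) (ts ! j) -
         lap (pCons 0 (slice lap D (nths ts (- {j})))) t)"
    using Cons.IH[OF D] by blast
  have "splits (pCons 0 p)"
    using even by (intro splits_odd) (simp add: is_even_def)
  then obtain L where L: "\<And>b c. (poly (pCons 0 p) (b + c) + poly (pCons 0 p) (b - c)) / 2 =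
        (\<Sum>(\<alpha>, p, q)\<leftarrow>L. \<alpha> * poly p b * poly q c)"
     "\<And>t s. t \<noteq> 0 \<and> s \<noteq> 0 \<and> t\<^sup>2 \<noteq> s\<^sup>2 \<Longrightarrow>
        (\<Sum>(\<alpha>, p, q)\<leftarrow>L. \<alpha> * lap p t * lap q s) =
        s / (t\<^sup>2 - s\<^sup>2) * (lap (pCons 0 p) s - lap (pCons 0 p) t)"
    unfolding splits_def by blast
  define S where "S = (\<lambda>(u :: complex poly \<Rightarrow> complex \<Rightarrow> complex) b c.
    (\<Sum>(\<alpha>, p, q)\<leftarrow>L. \<alpha> * u p b * u q c))"
  define \<Psi> where "\<Psi> = (\<lambda>u xs. c * (S u (hd xs) (tl xs ! j) *
    prod_list (map2 u ps (nths (tl xs) (- {j})))) + \<Phi> u xs)"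
  \<comment> \<open>The factor in b_j goes back to position j: this is the interleaving for the
    position set {j}.\<close>
  have "rep (Suc m) (\<lambda>u xs. \<Sum>x\<leftarrow>L. fst x * (u (fst (snd x)) (hd xs) *
      (prod_list (map2 u [snd (snd x)] (nths (tl xs) {j})) * prod_list (map2 u ps (nths (tl xs) (- {j}))))))"
    by (intro rep_sum_list rep_scale rep_merge) (use assms(1) ps in \<open>simp_all add: nths_singleton_eq\<close>)
  moreover have "(\<Sum>x\<leftarrow>L. fst x * (u (fst (snd x)) (hd xs) *
      (prod_list (map2 u [snd (snd x)] (nths (tl xs) {j})) * prod_list (map2 u ps (nths (tl xs) (- {j})))))) =
      S u (hd xs) (tl xs ! j) * prod_list (map2 u ps (nths (tl xs) (- {j})))"
    if "length xs = Suc m" for u :: "complex poly \<Rightarrow> complex \<Rightarrow> complex" and xs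
    using that assms(1)
    by (simp add: S_def nths_singleton_eq case_prod_unfold mult.assoc flip: sum_list_mult_const)
  ultimately have "rep (Suc m) (\<lambda>u xs. S u (hd xs) (tl xs ! j) *
      prod_list (map2 u ps (nths (tl xs) (- {j}))))"
    by (elim rep_cong[rotated]) simp
  then have "rep (Suc m) \<Psi>"
    unfolding \<Psi>_def by (intro rep_add rep_scale \<Phi>(1))
  moreover have "\<Psi> poly (b # xs) =
       ((b + xs ! j) * tensor poly (d # D) ((b + xs ! j) # nths xs (- {j})) +
        (b - xs ! j) * tensor poly (d # D) ((b - xs ! j) # nths xs (- {j}))) / 2"
    if "length xs = m" for b xs
  proof -
    have S: "S poly b (xs ! j) = (poly (pCons 0 p) (b + xs ! j) + poly (pCons 0 p) (b - xs ! j)) / 2"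
      unfolding S_def by (rule L(1)[symmetric])
    show ?thesis
      unfolding \<Psi>_def list.sel S \<Phi>(2)[OF that] by (simp add: d field_simps)
  qed
  moreover have "\<Psi> lap (t # ts) =
       ts ! j / (t\<^sup>2 - (ts ! j)\<^sup>2) * (lap (pCons 0 (slice lap (d # D) (nths ts (- {j})))) (ts ! j) -
         lap (pCons 0 (slice lap (d # D) (nths ts (- {j})))) t)"
    if ts: "length ts = m \<and> t \<noteq> 0 \<and> ts ! j \<noteq> 0 \<and> t\<^sup>2 \<noteq> (ts ! j)\<^sup>2" for t ts
  proof -
    let ?c = "c * prod_list (map2 lap ps (nths ts (- {j})))"
    have e: "lap (pCons 0 (slice lap (d # D) (nths ts (- {j})))) s =
        ?c * lap (pCons 0 p) s + lap (pCons 0 (slice lap D (nths ts (- {j})))) s" for s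
    proof -
      have "pCons 0 (slice lap (d # D) (nths ts (- {j}))) =
          smult ?c (pCons 0 p) + pCons 0 (slice lap D (nths ts (- {j})))"
        by (simp add: d slice_simps)
      then show ?thesis by (simp only: lap_linear)
    qed
    have S: "S lap t (ts ! j) = ts ! j / (t\<^sup>2 - (ts ! j)\<^sup>2) * (lap (pCons 0 p) (ts ! j) - lap (pCons 0 p) t)"
      unfolding S_def using ts by (intro L(2)) auto
    have alg: "c * (k * (a - b) * P) + k * (A - B) = k * ((c * P * a + A) - (c * P * b + B))"
      for k a b P A B :: complex
      by (simp add: algebra_simps)
    show ?thesis
      unfolding e \<Psi>_def \<Phi>(3)[OF ts] list.sel S by (rule alg)
  qed
  ultimately show ?case by blast
qed

lemma d1_laplace:
  assumes "arity D (Suc (length us))" "t \<noteq> 0"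
    and "\<And>u. u \<noteq> 0 \<Longrightarrow> stable_part F g (u # us) = tensor lap D (u # us)"
  shows "d1 F g t us = - lap (pCons 0 (slice lap D us)) t"
  unfolding d1_def
  by (rule deriv_nonzero_cong[OF _ has_field_derivative_lap])
    (use assms tensor_eq_slice[OF linear_in_poly_lap assms(1)] in auto)

text \<open>Each derivative is multiplication by minus the length, and the two signs cancel. On the
  diagonal the transforms are multiplied at the same t, which is the transform of a
  convolution.\<close>

lemma d12_diag_laplace:
  assumes "arity D (Suc (Suc (length us)))" "t \<noteq> 0"
    and "\<And>u v. u \<noteq> 0 \<Longrightarrow> v \<noteq> 0 \<Longrightarrow> stable_part F g (u # v # us) = tensor lap D (u # v # us)"
  shows "d12_diag F g t us = tensor lap (contract D) (t # us)"
proof -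
  let ?D = "map (\<lambda>(c, ps). (c, map lapq ps)) D"
  have "arity ?D (Suc (Suc (length us)))" using assms(1) by (auto simp: arity_def)
  then have "d12_diag F g t us = (\<Sum>(c, ps)\<leftarrow>?D. c * prod_list (map2 inv_poly (tl (tl ps)) us) *
    inv_poly (inv_deriv (hd ps)) t * inv_poly (inv_deriv (hd (tl ps))) t)"
    by (rule d12_diag_tensor) (use assms(2,3) in \<open>simp_all add: tensor_lap\<close>)
  also have "\<dots> = tensor lap (contract D) (t # us)"
    using assms(1)
  proof (induction D)
    case (Cons d D)
    obtain c p q ps where d: "d = (c, p # q # ps)" using Cons.prems by (cases d) (auto simp: length_Suc_conv)
    have "prod_list (map2 inv_poly (map lapq ps) us) = prod_list (map2 lap ps us)"
      by (simp add: zip_map1 case_prod_unfold lap_def o_def)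
    then show ?case
      using Cons by (simp add: d contract_def conv1_def lap_conv inv_deriv_lapq) (simp add: lap_def)
  qed (simp add: contract_def)
  finally show ?thesis .
qed

text \<open>The left-hand side of (B) is the transform of the left-hand side of (N); the sign in
  front cancels the one from differentiation.\<close>

lemma principal_part_cos_d1:
  assumes "arity D (Suc (length us))"
    and "\<And>u. u \<noteq> 0 \<Longrightarrow> stable_part F g (u # us) = tensor lap D (u # us)"
  shows "- principal_part (\<lambda>u. cos (2 * of_real pi * u) * d1 F g u us) t =
    lap (shift_mean (pCons 0 (slice lap D us))) t"
proof -
  let ?p = "pCons 0 (slice lap D us)"
  have L: "has_laurent (\<lambda>u. cos (2 * of_real pi * u) * lap ?p u)"
    by (intro has_laurent_mult has_laurent_analytic[OF cos_analytic] has_laurent_poly_inverse[of _ "lapq ?p"])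
      (simp add: lap_def)
  have "principal_part (\<lambda>u. cos (2 * of_real pi * u) * d1 F g u us) t =
      principal_part (\<lambda>u. - (cos (2 * of_real pi * u) * lap ?p u)) t"
  proof (rule principal_part_cong)
    show "eventually (\<lambda>u. cos (2 * of_real pi * u) * d1 F g u us =
        - (cos (2 * of_real pi * u) * lap ?p u)) (at 0)"
      unfolding eventually_at_filter
      by (intro always_eventually allI impI) (simp add: d1_laplace[OF assms(1) _ assms(2)])
    show "has_laurent (\<lambda>u. - (cos (2 * of_real pi * u) * lap ?p u))"
      using has_laurent_mult[OF has_laurent_analytic L, of "\<lambda>u. - 1"] by simp
  qed
  also have "\<dots> = - lap (shift_mean ?p) t"
    using principal_part_uminus[OF L] principal_part_cos_lap by simp
  finally show ?thesis by simp
qed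

text \<open>Each term of (N) is written as a functional of the reading \<open>u\<close>. Under
  \<open>poly\<close> the functionals give (N), under \<open>lap\<close> the terms of (B), and
  \<open>rep_unique\<close> passes from one to the other.\<close>

theorem recursion_N_imp_B:
  assumes fam: "super_volume_family V" "laplace_transform_family V F" and n: "n \<ge> 1"
    and N: "recursion_N V g n"
  shows "recursion_B F g n"
proof -
  \<comment> \<open>One list for each genus and arity, serving the volume and its transform at once;
    this is what ties the two readings together.\<close>
  have "\<forall>h k. \<exists>D. arity D k \<and> even_tensor D \<and>
      (\<forall>xs. length xs = k \<longrightarrow> stable_part V h xs = tensor poly D xs) \<and>
      (\<forall>ts. length ts = k \<longrightarrow> 0 \<notin> set ts \<longrightarrow> stable_part F h ts = tensor lap D ts)"
  proof (intro allI)
    fix h k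
    obtain D where "arity D k" "even_tensor D"
      "\<And>xs. length xs = k \<Longrightarrow> stable_part V h xs = tensor poly D xs"
      "\<And>ts. length ts = k \<Longrightarrow> 0 \<notin> set ts \<Longrightarrow> stable_part F h ts = tensor lap D ts"
      using stable_part_laplace_tensor[OF fam] by blast
    then show "\<exists>D. arity D k \<and> even_tensor D \<and>
      (\<forall>xs. length xs = k \<longrightarrow> stable_part V h xs = tensor poly D xs) \<and>
      (\<forall>ts. length ts = k \<longrightarrow> 0 \<notin> set ts \<longrightarrow> stable_part F h ts = tensor lap D ts)" by blast
  qed
  then obtain D where D: "\<And>h k. arity (D h k) k" "\<And>h k. even_tensor (D h k)"
    "\<And>h k xs. length xs = k \<Longrightarrow> stable_part V h xs = tensor poly (D h k) xs"
    "\<And>h k ts. length ts = k \<Longrightarrow> 0 \<notin> set ts \<Longrightarrow> stable_part F h ts = tensor lap (D h k) ts"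
    by metis
  have sym: "symmetric_odd_inverse_family F" by (rule laplace_family_symmetric_odd[OF fam])
  obtain m where m: "n = Suc m" using n by (cases n) auto
  \<comment> \<open>The list for a volume in one distinguished variable and the variables at
    positions \<open>I\<close>; its arity depends on \<open>I\<close> but not on the values.\<close>
  define K where "K = (\<lambda>h I. D h (Suc (length (nths [0..<m] I))))"
  have len: "length (nths xs I) = length (nths [0..<m] I)" if "length xs = m" for xs :: "complex list" and I
    by (rule length_nths_cong) (simp add: that)
  have V_slice: "stable_part V h (x # xs) = poly (slice poly (D h (Suc (length xs))) xs) x" for h x xs
    using D(3)[of "x # xs" _ h] tensor_eq_slice[OF linear_in_poly_poly D(1)] by simp
  have VK: "stable_part V h (x # nths xs I) = poly (slice poly (K h I) (nths xs I)) x"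
    if "length xs = m" for h x xs I
    using V_slice[of h x "nths xs I"] by (simp add: K_def len[OF that])
  have d1K: "d1 F h t (nths ts I) = - lap (pCons 0 (slice lap (K h I) (nths ts I))) t"
    if "length ts = m" "0 \<notin> set ts" "t \<noteq> 0" for h t ts I
    by (rule d1_laplace) (use that D(1) D(4)[of "_ # nths ts I"] notin_set_nthsI[OF that(2)] in \<open>auto simp: K_def len\<close>)
  define \<Phi>1 where "\<Phi>1 = (\<lambda>(u :: complex poly \<Rightarrow> complex \<Rightarrow> complex) xs. u (shift_mean (pCons 0 (slice u (D g n) (tl xs)))) (hd xs))"
  have "rep n \<Phi>1"
    unfolding \<Phi>1_def m
    by (rule rep_slice[where \<phi> = "\<lambda>p. shift_mean (pCons 0 p)"])
      (use D(1) in \<open>simp_all add: fun_eq_iff poly_shift_mean field_simps flip: poly_eq_poly_eq_iff\<close>)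
  \<comment> \<open>For g = 0 the truncated difference g - 1 is again 0, so the scalar has to remove
    this term.\<close>
  define \<Phi>2 where "\<Phi>2 = (\<lambda>(u :: complex poly \<Rightarrow> complex \<Rightarrow> complex) xs. (if g = 0 then 0 else 1/2) * tensor u (contract (D (g - 1) (Suc n))) xs)"
  have "rep n \<Phi>2"
    unfolding \<Phi>2_def m by (intro rep_scale rep_tensor arity_contract D(1))
  define \<Phi>3 where "\<Phi>3 = (\<lambda>g1 I (u :: complex poly \<Rightarrow> complex \<Rightarrow> complex) xs. u (conv1 (slice u (K g1 I) (nths (tl xs) I))
      (slice u (K (g - g1) (- I)) (nths (tl xs) (- I)))) (hd xs))"
  have "rep n (\<Phi>3 g1 I)" for g1 I
    unfolding \<Phi>3_def m K_def by (intro rep_conv1_slices D(1))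
  define R where "R = (\<lambda>j \<Phi>. rep (Suc m) \<Phi> \<and>
    (\<forall>b xs. length xs = m \<longrightarrow> \<Phi> poly (b # xs) =
       ((b + xs ! j) * tensor poly (K g (- {j})) ((b + xs ! j) # nths xs (- {j})) +
        (b - xs ! j) * tensor poly (K g (- {j})) ((b - xs ! j) # nths xs (- {j}))) / 2) \<and>
    (\<forall>t ts. length ts = m \<and> t \<noteq> 0 \<and> ts ! j \<noteq> 0 \<and> t\<^sup>2 \<noteq> (ts ! j)\<^sup>2 \<longrightarrow> \<Phi> lap (t # ts) =
       ts ! j / (t\<^sup>2 - (ts ! j)\<^sup>2) * (lap (pCons 0 (slice lap (K g (- {j})) (nths ts (- {j})))) (ts ! j) -
         lap (pCons 0 (slice lap (K g (- {j})) (nths ts (- {j})))) t)))"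
  have "\<forall>j. \<exists>\<Phi>. j < m \<longrightarrow> R j \<Phi>"
  proof
    fix j
    show "\<exists>\<Phi>. j < m \<longrightarrow> R j \<Phi>"
      using rep_reflect[of j m "K g (- {j})"] D(1,2) unfolding K_def R_def by blast
  qed
  from choice[OF this] obtain \<Phi>4 where R: "\<forall>j. j < m \<longrightarrow> R j (\<Phi>4 j)" ..
  have \<Phi>4: "\<And>j. j < m \<Longrightarrow> rep (Suc m) (\<Phi>4 j)"
    "\<And>j b xs. j < m \<Longrightarrow> length xs = m \<Longrightarrow> \<Phi>4 j poly (b # xs) =
       ((b + xs ! j) * tensor poly (K g (- {j})) ((b + xs ! j) # nths xs (- {j})) +
        (b - xs ! j) * tensor poly (K g (- {j})) ((b - xs ! j) # nths xs (- {j}))) / 2"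
    "\<And>j t ts. j < m \<Longrightarrow> length ts = m \<and> t \<noteq> 0 \<and> ts ! j \<noteq> 0 \<and> t\<^sup>2 \<noteq> (ts ! j)\<^sup>2 \<Longrightarrow> \<Phi>4 j lap (t # ts) =
       ts ! j / (t\<^sup>2 - (ts ! j)\<^sup>2) * (lap (pCons 0 (slice lap (K g (- {j})) (nths ts (- {j})))) (ts ! j) -
         lap (pCons 0 (slice lap (K g (- {j})) (nths ts (- {j})))) t)"
    using R unfolding R_def by blast+
  define \<Psi> where "\<Psi> = (\<lambda>u xs. \<Phi>2 u xs + 1/2 * (\<Sum>g1\<le>g. \<Sum>I\<in>Pow {..<m}. \<Phi>3 g1 I u xs) +
      (\<Sum>j<m. \<Phi>4 j u xs))"
  have "rep n \<Psi>"
    unfolding \<Psi>_def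
    by (intro rep_add rep_scale rep_sum \<open>rep n \<Phi>2\<close> \<open>\<And>g1 I. rep n (\<Phi>3 g1 I)\<close>)
      (use \<Phi>4(1) m in auto)
  have on_lengths: "\<Phi>1 poly (map complex_of_real bs') = \<Psi> poly (map complex_of_real bs')"
    if bs': "length bs' = n" "\<forall>b\<in>set bs'. b > 0" for bs'
  proof -
    obtain b bs where b: "bs' = b # bs" "length bs = m" using bs'(1) m by (auto simp: length_Suc_conv)
    let ?bs = "map complex_of_real bs"
    have lb: "length ?bs = m" using b by simp
    have b0: "b > 0" using bs' b by simp
    have e: "1/2 * ((of_real b + 2 * of_real pi * \<i>) * stable_part V g ((of_real b + 2 * of_real pi * \<i>) # ?bs)
        + (of_real b - 2 * of_real pi * \<i>) * stable_part V g ((of_real b - 2 * of_real pi * \<i>) # ?bs)) =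
       (if g = 0 then 0 else
          1/2 * (LINT x:{0..b}|lborel.
             of_real (x * (b - x)) * stable_part V (g - 1) (map of_real (x # (b - x) # bs))))
     + 1/2 * (\<Sum>g1\<le>g. \<Sum>I\<in>Pow {..<length bs}.
          LINT x:{0..b}|lborel.
             of_real (x * (b - x)) * stable_part V g1 (map of_real (x # nths bs I)) *
             stable_part V (g - g1) (map of_real ((b - x) # nths bs (- I))))
     + 1/2 * (\<Sum>j<length bs.
          of_real (b + bs ! j) * stable_part V g (map of_real ((b + bs ! j) # nths bs (- {j})))
        + of_real (b - bs ! j) * stable_part V g (map of_real ((b - bs ! j) # nths bs (- {j}))))"
      (is "?L = ?Q + 1/2 * ?R + 1/2 * ?S")
      using N[unfolded recursion_N_def Let_def, rule_format, of b bs] bs' b m by simp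
    have eL: "?L = \<Phi>1 poly (map complex_of_real bs')"
      using lb m by (simp add: V_slice \<Phi>1_def b poly_shift_mean algebra_simps)
    have eQ: "?Q = \<Phi>2 poly (map complex_of_real bs')"
    proof -
      have a: "arity (D (g - 1) (Suc n)) (Suc (Suc m))" using D(1) m by simp
      have "stable_part V (g - 1) (map of_real (x # (b - x) # bs)) =
          tensor poly (D (g - 1) (Suc n)) (of_real x # (of_real b - of_real x) # ?bs)" for x
        using D(3)[of "of_real x # (of_real b - of_real x) # ?bs"] lb m by simp
      then show ?thesis
        using LINT_contract[OF a, of b ?bs] b0 by (simp add: \<Phi>2_def b)
    qed
    have eR: "?R = (\<Sum>g1\<le>g. \<Sum>I\<in>Pow {..<m}. \<Phi>3 g1 I poly (map complex_of_real bs'))"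
    proof -
      have "(LINT x:{0..b}|lborel.
             of_real (x * (b - x)) * stable_part V g1 (map of_real (x # nths bs I)) *
             stable_part V (g - g1) (map of_real ((b - x) # nths bs (- I)))) =
          \<Phi>3 g1 I poly (map complex_of_real bs')" for g1 I
        using poly_conv1_integral[of b "slice poly (K g1 I) (nths ?bs I)"
            "slice poly (K (g - g1) (- I)) (nths ?bs (- I))"] b0
        by (simp add: \<Phi>3_def b VK[OF lb] flip: nths_map)
      then show ?thesis using b(2) by simp
    qed
    have eS: "1/2 * ?S = (\<Sum>j<m. \<Phi>4 j poly (map complex_of_real bs'))"
    proof -
      have "stable_part V g (x # nths ?bs (- {j})) = tensor poly (K g (- {j})) (x # nths ?bs (- {j}))" for x j
        using D(3)[of "x # nths ?bs (- {j})"] by (simp add: K_def len[OF lb])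
      then have "1/2 * (of_real (b + bs ! j) * stable_part V g (map of_real ((b + bs ! j) # nths bs (- {j})))
        + of_real (b - bs ! j) * stable_part V g (map of_real ((b - bs ! j) # nths bs (- {j})))) =
        \<Phi>4 j poly (map complex_of_real bs')" if "j < m" for j
        using that lb b(2) \<Phi>4(2)[OF that lb, of "of_real b"] by (simp add: b(1) flip: nths_map)
      then show ?thesis
        unfolding sum_distrib_left using b(2) by (intro sum.cong) auto
    qed
    show ?thesis unfolding \<Psi>_def eL[symmetric] eQ[symmetric] eR[symmetric] eS[symmetric] by (rule e)
  qed
  show ?thesis
    unfolding recursion_B_def
  proof (intro allI impI, elim conjE)
    fix t :: complex and ts :: "complex list"
    assume t: "t \<noteq> 0" and lts: "length ts = n - 1" and ts: "0 \<notin> set ts" "\<forall>s\<in>set ts. t\<^sup>2 \<noteq> s\<^sup>2"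
    have l: "length ts = m" "length (t # ts) = n" using lts m by simp_all
    have "- principal_part (\<lambda>u. cos (2 * of_real pi * u) * d1 F g u ts) t = \<Phi>1 lap (t # ts)"
      unfolding \<Phi>1_def list.sel
      by (rule principal_part_cos_d1) (use D(1,4) l ts in auto)
    also have "\<dots> = \<Psi> lap (t # ts)" 
      by (rule rep_unique[OF \<open>rep n \<Phi>1\<close> \<open>rep n \<Psi>\<close> _ l(2)]) (rule on_lengths)
    also have "\<dots> = (if g = 0 then 0 else 1/2 * d12_diag F (g - 1) t ts)
         + 1/2 * (\<Sum>g1\<le>g. \<Sum>I\<in>Pow {..<length ts}.
              d1 F g1 t (nths ts I) * d1 F (g - g1) t (nths ts (- I)))
         + (\<Sum>j<length ts. ts ! j / (t\<^sup>2 - (ts ! j)\<^sup>2) *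
              (d1 F g t (nths ts (- {j})) -
               deriv (\<lambda>u. stable_part F g (ts[j := u])) (ts ! j)))"
    proof -
      have "\<Phi>2 lap (t # ts) = (if g = 0 then 0 else 1/2 * d12_diag F (g - 1) t ts)"
      proof -
        have "d12_diag F (g - 1) t ts = tensor lap (contract (D (g - 1) (Suc n))) (t # ts)"
          by (rule d12_diag_laplace) (use D(1,4) l ts t m in auto)
        then show ?thesis by (simp add: \<Phi>2_def)
      qed
      moreover have "\<Phi>3 g1 I lap (t # ts) = d1 F g1 t (nths ts I) * d1 F (g - g1) t (nths ts (- I))" for g1 I
        by (simp add: \<Phi>3_def conv1_def lap_conv d1K[OF l(1) ts(1) t])
      moreover have "\<Phi>4 j lap (t # ts) = ts ! j / (t\<^sup>2 - (ts ! j)\<^sup>2) *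
              (d1 F g t (nths ts (- {j})) - deriv (\<lambda>u. stable_part F g (ts[j := u])) (ts ! j))"
        if j: "j < m" for j
      proof -
        have s: "ts ! j \<noteq> 0" "t\<^sup>2 \<noteq> (ts ! j)\<^sup>2" using ts j l by (metis nth_mem)+
        have "deriv (\<lambda>u. stable_part F g (ts[j := u])) (ts ! j) = d1 F g (ts ! j) (nths ts (- {j}))"
          unfolding d1_def using s(1) stable_part_move_to_front[OF sym _ ts(1)] j l
          by (intro deriv_cong_ev) (auto simp: eventually_nhds intro!: exI[of _ "- {0}"])
        then show ?thesis
          using \<Phi>4(3)[OF j] s t l(1) d1K[OF l(1) ts(1)] by simp
      qed
      ultimately show ?thesis unfolding \<Psi>_def by (simp add: l(1))
    qed
    finally show "- principal_part (\<lambda>u. cos (2 * of_real pi * u) * d1 F g u ts) t =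
           (if g = 0 then 0 else 1/2 * d12_diag F (g - 1) t ts)
         + 1/2 * (\<Sum>g1\<le>g. \<Sum>I\<in>Pow {..<length ts}.
              d1 F g1 t (nths ts I) * d1 F (g - g1) t (nths ts (- I)))
         + (\<Sum>j<length ts. ts ! j / (t\<^sup>2 - (ts ! j)\<^sup>2) *
              (d1 F g t (nths ts (- {j})) -
               deriv (\<lambda>u. stable_part F g (ts[j := u])) (ts ! j)))" .
  qed
qed

section \<open>The Stanford--Witten kernel\<close>

text \<open>The rate is at choice. Later it is 1/8, half of the decay rate 1/4 of the kernel, so
  that a product with the kernel still decays exponentially.\<close>

lemma poly_norm_le_exp:
  fixes p :: "complex poly" and a :: real
  assumes "a > 0"
  shows "\<exists>C\<ge>0. \<forall>z. norm (poly p z) \<le> C * exp (a * norm z)"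
proof (induction p rule: poly_monom_induct)
  case (monom c i)
  show ?case
  proof (intro exI conjI allI)
    show "0 \<le> norm c * (fact i / a ^ i)" using assms by simp
    fix z :: complex
    have "(a * norm z) ^ i \<le> fact i * exp (a * norm z)"
      using assms by (intro power_le_exp) simp
    then have "norm z ^ i \<le> fact i / a ^ i * exp (a * norm z)"
      using assms by (simp add: power_mult_distrib field_simps)
    from mult_left_mono[OF this, of "norm c"]
    show "norm (poly (monom c i) z) \<le> norm c * (fact i / a ^ i) * exp (a * norm z)"
      by (simp add: poly_monom norm_mult norm_power mult.assoc)
  qed
next
  case (add p q)
  then obtain C D where "C \<ge> 0" "D \<ge> 0" "\<And>z. norm (poly p z) \<le> C * exp (a * norm z)"
    "\<And>z. norm (poly q z) \<le> D * exp (a * norm z)" by blast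
  then show ?case
    by (intro exI[of _ "C + D"]) (auto simp: distrib_right intro!: norm_triangle_mono)
qed

definition sech4 :: "real \<Rightarrow> real" where
  "sech4 u = 1 / cosh (u / 4)"

lemma sech4_le: "\<bar>sech4 u\<bar> \<le> 2 * exp (- (\<bar>u\<bar> / 4))"
proof -
  have "exp (\<bar>u\<bar> / 4) \<le> 2 * cosh (u / 4)"
    by (cases "u \<ge> 0") (auto simp: cosh_def)
  moreover have "cosh (u / 4) > 0" by simp
  ultimately show ?thesis
    by (simp add: sech4_def exp_minus field_simps abs_divide)
qed

lemma continuous_sech4: "continuous_on A sech4"
  unfolding sech4_def[abs_def] by (intro continuous_intros) auto

lemma measurable_sech4 [measurable]: "sech4 \<in> borel_measurable borel"
  by (intro borel_measurable_continuous_onI continuous_sech4)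

lemma measurable_poly_of_real [measurable]:
  "(\<lambda>x. poly p (complex_of_real x)) \<in> borel_measurable borel"
  by (intro borel_measurable_continuous_onI continuous_intros)

lemma poly_exp_decay_bound:
  fixes f :: "real \<Rightarrow> complex"
  assumes "\<And>u. norm (f u) \<le> K * exp (- (\<bar>u\<bar> / 4))"
  shows "\<exists>C. \<forall>u. norm (poly p (of_real u) * f u) \<le> C * exp (- (1/8 * \<bar>u\<bar>))"
proof -
  obtain C where C: "C \<ge> 0" "\<And>z. norm (poly p z) \<le> C * exp (1/8 * norm z)"
    using poly_norm_le_exp[of "1/8" p] by auto
  show ?thesis
  proof (intro exI allI)
    fix u :: real
    have "norm (poly p (of_real u) * f u) \<le> (C * exp (1/8 * \<bar>u\<bar>)) * (K * exp (- (\<bar>u\<bar> / 4)))"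
      unfolding norm_mult using C(1) C(2)[of "of_real u"] assms[of u]
      by (intro mult_mono) auto
    also have "\<dots> = C * K * (exp (1/8 * \<bar>u\<bar>) * exp (- (\<bar>u\<bar> / 4)))" by simp
    also have "exp (1/8 * \<bar>u\<bar>) * exp (- (\<bar>u\<bar> / 4)) = exp (- (1/8 * \<bar>u\<bar>))"
      by (simp flip: exp_add)
    finally show "norm (poly p (of_real u) * f u) \<le> C * K * exp (- (1/8 * \<bar>u\<bar>))" .
  qed
qed

lemma integrable_poly_exp_decay:
  fixes f :: "real \<Rightarrow> complex"
  assumes [measurable]: "f \<in> borel_measurable borel"
    and "\<And>u. norm (f u) \<le> K * exp (- (\<bar>u\<bar> / 4))"
  shows "integrable lborel (\<lambda>u. poly p (of_real u) * f u)"
proof -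
  obtain C where C: "\<And>u. norm (poly p (of_real u) * f u) \<le> C * exp (- (1/8 * \<bar>u\<bar>))"
    using poly_exp_decay_bound[OF assms(2)] by blast
  have "integrable lborel (\<lambda>u. C * exp (- (1/8 * \<bar>u\<bar>)))"
    by (intro integrable_mult_right integrable_exp_abs) simp
  then show ?thesis
  proof (rule Bochner_Integration.integrable_bound)
    show "AE u in lborel. norm (poly p (of_real u) * f u) \<le> norm (C * exp (- (1/8 * \<bar>u\<bar>)))"
      by (intro AE_I2 order_trans[OF C]) simp
  qed simp
qed

lemma integrable_poly_sech4:
  "integrable lborel (\<lambda>u. poly p (complex_of_real u) * of_real (sech4 u))"
  by (rule integrable_poly_exp_decay[of _ 2]) (use sech4_le in auto)

lemma integrable_poly_shift_sech4:
  "integrable lborel (\<lambda>u. poly p (complex_of_real u + b) * of_real (sech4 u))"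
  using integrable_poly_sech4[of "pcompose p [:b, 1:]"] by (simp add: poly_pcompose add.commute)

text \<open>The numerator bounds a polynomial, the denominator stems from the lower bound for sinh(z
  / 4) in \<open>norm_sinh_ge\<close>; the larger exponential rate wins.\<close>

lemma tendsto_abs_exp_decay:
  assumes "F = at_top \<or> F = at_bot"
  shows "((\<lambda>x :: real. K * (exp (\<bar>x\<bar> / 8) / (exp (\<bar>x\<bar> / 4) - 1))) \<longlongrightarrow> 0) F"
proof -
  have "((\<lambda>x :: real. K * (exp (x / 8) / (exp (x / 4) - 1))) \<longlongrightarrow> 0) at_top"
    by real_asymp
  moreover have "filterlim (\<lambda>x :: real. \<bar>x\<bar>) at_top F"
    using assms filterlim_at_infinity_imp_norm_at_top[of "\<lambda>x :: real. x" F]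
      filterlim_at_top_imp_at_infinity[of "\<lambda>x :: real. x" F] filterlim_at_bot_imp_at_infinity[of "\<lambda>x :: real. x" F]
    by (auto simp: filterlim_ident)
  ultimately show ?thesis by (rule filterlim_compose)
qed

lemma norm_sinh_ge: "norm (sinh z) \<ge> (exp \<bar>Re z\<bar> - 1) / 2" for z :: complex
proof -
  have "norm (exp z) - norm (exp (- z)) \<le> norm (exp z - exp (- z))"
    by (rule norm_triangle_ineq2)
  moreover have "norm (exp (- z)) - norm (exp z) \<le> norm (exp z - exp (- z))"
    using norm_triangle_ineq2[of "exp (- z)" "exp z"] by (simp only: norm_minus_commute)
  ultimately have "exp \<bar>Re z\<bar> - exp (- \<bar>Re z\<bar>) \<le> norm (exp z - exp (- z))"
    unfolding norm_exp_eq_Re by (cases "Re z \<ge> 0") simp_all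
  moreover have "exp (- \<bar>Re z\<bar>) \<le> 1" by simp
  ultimately have "exp \<bar>Re z\<bar> - 1 \<le> norm (exp z - exp (- z))" by linarith
  then show ?thesis by (simp add: sinh_field_def norm_divide)
qed

text \<open>A zero means exp(z) = exp(-z), and the exponential is injective on points whose
  imaginary parts differ by less than 2 pi.\<close>

lemma sinh_nonzero_strip:
  assumes "\<bar>Im z\<bar> < pi" "z \<noteq> (0 :: complex)"
  shows "sinh z \<noteq> 0"
proof
  assume "sinh z = 0"
  then have "exp z = exp (- z)" by (simp add: sinh_field_def)
  moreover have "\<bar>Im z - Im (- z)\<bar> < 2 * pi"
    using assms(1) by simp
  ultimately have "z = - z" using exp_complex_eqI by blast
  from arg_cong[OF this, of Re] arg_cong[OF this, of Im] show False
    using assms(2) by (simp add: complex_eq_iff)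
qed

text \<open>Shifting contours, in terms of a primitive: \<open>z p(z) / sinh (z / 4)\<close> is holomorphic in a strip around
  \<open>\<bar>Im z\<bar> \<le> 2 \<pi>\<close>, and \<open>sinh (u / 4 \<plusminus> \<i> \<pi> / 2) = \<plusminus> \<i> cosh (u / 4)\<close>.\<close>

lemma integral_shifted_sech4_aux:
  "(\<integral>u. (poly (pCons 0 p) (of_real u + 2 * of_real pi * \<i>) + poly (pCons 0 p) (of_real u - 2 * of_real pi * \<i>)) *
     of_real (sech4 u) \<partial>lborel) = 0"
proof -
  let ?c = "2 * of_real pi * \<i>"
  \<comment> \<open>The strip must contain the lines Im z = 2 pi and Im z = -2 pi in its interior,
    but no zero of sinh(z / 4) besides 0; the next zeros have imaginary parts 4 pi and -4
    pi.\<close>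
  define S where "S = {z. Im z < 3 * pi} \<inter> {z. Im z > - 3 * pi}"
  have S: "convex S" "open S" unfolding S_def
    by (intro convex_Int convex_halfspace_Im_lt convex_halfspace_Im_gt)
      (intro open_Int open_halfspace_Im_lt open_halfspace_Im_gt)
  \<comment> \<open>sinh(z / 4) / z with its removable singularity filled in, so that p /
    \<open>sc\<close> is z p(z) / sinh(z / 4) without a pole at 0.\<close>
  define sc where "sc = (\<lambda>z :: complex. if z = 0 then deriv (\<lambda>z. sinh (z / 4)) 0 else (sinh (z / 4) - sinh (0 / 4)) / (z - 0))"
  have "sc holomorphic_on UNIV"
    unfolding sc_def
    by (rule pole_lemma) (auto intro!: holomorphic_intros simp: sinh_field_def)
  have "((\<lambda>z :: complex. sinh (z / 4)) has_field_derivative 1 / 4) (at 0)"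
    by (auto intro!: derivative_eq_intros)
  then have sc0: "sc 0 = 1 / 4" by (simp add: sc_def DERIV_imp_deriv)
  have sc: "sc z = sinh (z / 4) / z" if "z \<noteq> 0" for z using that by (simp add: sc_def)
  have sc_nz: "sc z \<noteq> 0" if "z \<in> S" for z
  proof (cases "z = 0")
    case False
    have "\<bar>Im z\<bar> < 3 * pi" using that by (auto simp: S_def)
    then have "\<bar>Im (z / 4)\<bar> < pi" using pi_gt_zero by simp
    then show ?thesis using sinh_nonzero_strip[of "z / 4"] False by (simp add: sc)
  qed (simp add: sc0)
  define h where "h = (\<lambda>z. poly p z / sc z)"
  have "h holomorphic_on S"
    unfolding h_def using sc_nz holomorphic_on_subset[OF \<open>sc holomorphic_on UNIV\<close>]
    by (intro holomorphic_intros) auto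
  then obtain H where H0: "\<And>z. z \<in> S \<Longrightarrow> (H has_field_derivative h z) (at z within S)"
    using holomorphic_convex_primitive'[OF S, of h] by blast
  have H: "(H has_field_derivative h z) (at z)" if "z \<in> S" for z
    using H0[OF that] unfolding at_within_open[OF that S(2)] .
  have inS: "of_real u + ?c \<in> S" "of_real u - ?c \<in> S" for u
    by (auto simp: S_def)
  have hz: "h z = poly (pCons 0 p) z / sinh (z / 4)" if "z \<noteq> 0" for z
    using that by (simp add: h_def sc)
  have sh: "sinh ((of_real u + ?c) / 4) = \<i> * of_real (cosh (u / 4))"
    "sinh ((of_real u - ?c) / 4) = - \<i> * of_real (cosh (u / 4))" for u
  proof -
    have "(of_real u + ?c) / 4 = of_real (u / 4) + of_real (pi / 2) * \<i>"
      "(of_real u - ?c) / 4 = of_real (u / 4) - of_real (pi / 2) * \<i>"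
      by (simp_all add: field_simps)
    moreover have e: "exp (of_real (pi / 2) * \<i>) = \<i>"
      by (metis cis_conv_exp cis_pi_half mult.commute)
    moreover have "exp (- (of_real (pi / 2) * \<i>)) = - \<i>"
      unfolding exp_minus e by simp
    moreover have "cosh (complex_of_real (u / 4)) = of_real (cosh (u / 4))"
      by (simp add: cosh_field_def exp_of_real[symmetric] exp_minus)
    ultimately show "sinh ((of_real u + ?c) / 4) = \<i> * of_real (cosh (u / 4))"
      "sinh ((of_real u - ?c) / 4) = - \<i> * of_real (cosh (u / 4))"
      by (simp_all only: sinh_add sinh_diff sinh_field_def[of "of_real (pi / 2) * \<i>"]
          cosh_field_def[of "of_real (pi / 2) * \<i>"]) simp_all
  qed
  \<comment> \<open>The primitive is differenced across the strip. Since G' = g and \<open>G\<close>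
    tends to 0 at both ends, the integral of \<open>g\<close> is 0.\<close>
  define G where "G = (\<lambda>u. H (of_real u + ?c) - H (of_real u - ?c))"
  define g where "g = (\<lambda>u. - \<i> * ((poly (pCons 0 p) (of_real u + ?c) + poly (pCons 0 p) (of_real u - ?c)) *
     of_real (sech4 u)))"
  have hg: "h (of_real u + ?c) - h (of_real u - ?c) = g u" for u
  proof -
    have nz: "of_real u + ?c \<noteq> 0" "of_real u - ?c \<noteq> 0" by (auto simp: complex_eq_iff)
    have "A / (\<i> * C) - B / (- \<i> * C) = - \<i> * ((A + B) * (1 / C))" if "C \<noteq> 0" for A B C :: complex
      using that by (simp add: field_simps)
    then show ?thesis
      unfolding hz[OF nz(1)] hz[OF nz(2)] sh g_def sech4_def of_real_divide of_real_1 by simp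
  qed
  have "(LBINT u=-\<infinity>..\<infinity>. g u) = 0 - 0"
  proof (rule interval_integral_FTC_integrable)
    show "(G has_vector_derivative g u) (at u)" for u
    proof -
      have "((\<lambda>z. H (z + ?c) - H (z - ?c)) has_field_derivative h (of_real u + ?c) - h (of_real u - ?c)) (at (of_real u))"
      proof -
        have "((\<lambda>z. H (z + d)) has_field_derivative h (of_real u + d)) (at (of_real u))"
          if "of_real u + d \<in> S" for d
          using H[OF that] by (simp add: DERIV_shift)
        from DERIV_diff[OF this[of ?c] this[of "- ?c"]] show ?thesis
          using inS[of u] by simp
      qed
      then show ?thesis
        unfolding G_def hg by (rule has_vector_derivative_real_field)
    qed
    show "isCont g u" for u
      unfolding g_def sech4_def by (intro continuous_intros) auto
    show "set_integrable lborel (einterval (- \<infinity>) \<infinity>) g"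
      using integrable_poly_shift_sech4[of "pCons 0 p" ?c] integrable_poly_shift_sech4[of "pCons 0 p" "- ?c"]
      by (simp add: set_integrable_def g_def distrib_right einterval_def del: poly_pCons)
    obtain C where C: "C \<ge> 0" "\<And>z. norm (poly (pCons 0 p) z) \<le> C * exp (1/8 * norm z)"
      using poly_norm_le_exp[of "1/8" "pCons 0 p"] by auto
    \<comment> \<open>4 pi is the length of the vertical segment, exp(pi / 4) comes from |z| <= |u|
      + 2 pi at rate 1/8, and 2 from the denominator of the bound for sinh.\<close>
    define K where "K = 2 * C * exp (pi / 4) * (4 * pi)"
    have bound: "norm (G u) \<le> K * (exp (\<bar>u\<bar> / 8) / (exp (\<bar>u\<bar> / 4) - 1))" if u: "u \<noteq> 0" for u
    proof -
      let ?B = "C * exp (1/8 * (\<bar>u\<bar> + 2 * pi)) / ((exp (\<bar>u\<bar> / 4) - 1) / 2)"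
      have "norm (H (of_real u + ?c) - H (of_real u - ?c)) \<le> ?B * norm ((of_real u + ?c) - (of_real u - ?c))"
      proof (rule field_differentiable_bound[where S = "closed_segment (of_real u - ?c) (of_real u + ?c)" and f' = h])
        fix z assume z: "z \<in> closed_segment (of_real u - ?c) (of_real u + ?c)"
        then obtain s where s: "0 \<le> s" "s \<le> 1" "z = (1 - s) *\<^sub>R (of_real u - ?c) + s *\<^sub>R (of_real u + ?c)"
          unfolding in_segment by blast
        have Re: "Re z = u" and Im: "Im z = 2 * pi * (2 * s - 1)"
          unfolding s(3) by (simp_all add: algebra_simps)
        have "\<bar>2 * s - 1\<bar> \<le> 1" using s by auto
        then have ImB: "\<bar>Im z\<bar> \<le> 2 * pi" unfolding Im abs_mult by (simp add: mult_left_le)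
        then have "Im z < 3 * pi" "Im z > - 3 * pi" using pi_gt_zero by linarith+
        then have "z \<in> S" by (simp add: S_def)
        then show "(H has_field_derivative h z) (at z within closed_segment (of_real u - ?c) (of_real u + ?c))"
          using H has_field_derivative_at_within by blast
        have z0: "z \<noteq> 0" using Re u by auto
        have "norm z \<le> \<bar>u\<bar> + 2 * pi" using cmod_le[of z] Re ImB by simp
        then have "norm (poly (pCons 0 p) z) \<le> C * exp (1/8 * (\<bar>u\<bar> + 2 * pi))"
          using C(1) by (intro order_trans[OF C(2)] mult_left_mono) auto
        moreover have "norm (sinh (z / 4)) \<ge> (exp (\<bar>u\<bar> / 4) - 1) / 2"
          using norm_sinh_ge[of "z / 4"] Re by simp
        moreover have "(exp (\<bar>u\<bar> / 4) - 1) / 2 > 0" using u by simp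
        ultimately show "norm (h z) \<le> ?B"
          unfolding hz[OF z0] norm_divide using C(1) by (intro frac_le) auto
      qed auto
      also have "norm ((of_real u + ?c) - (of_real u - ?c)) = 4 * pi"
        by (simp add: norm_mult)
      also have "?B * (4 * pi) = K * (exp (\<bar>u\<bar> / 8) / (exp (\<bar>u\<bar> / 4) - 1))"
        by (simp add: K_def distrib_left exp_add mult_ac)
      finally show ?thesis by (simp add: G_def)
    qed
    have G0: "(G \<longlongrightarrow> 0) F" if F: "F = at_top \<or> F = at_bot" for F
    proof (rule Lim_null_comparison[OF _ tendsto_abs_exp_decay[OF F]])
      have "eventually (\<lambda>u :: real. u \<noteq> 0) F"
        using F eventually_gt_at_top[of "0 :: real"] eventually_gt_at_bot[of "0 :: real"]
        by (auto elim: eventually_mono)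
      then show "eventually (\<lambda>u. norm (G u) \<le> K * (exp (\<bar>u\<bar> / 8) / (exp (\<bar>u\<bar> / 4) - 1))) F"
        by eventually_elim (rule bound)
    qed
    show "((G \<circ> real_of_ereal) \<longlongrightarrow> 0) (at_right (- \<infinity>))" "((G \<circ> real_of_ereal) \<longlongrightarrow> 0) (at_left \<infinity>)"
      using G0 by (auto simp: ereal_tendsto_simps1)
  qed auto
  then have "(\<integral>u. g u \<partial>lborel) = 0"
    by (simp add: interval_lebesgue_integral_def set_lebesgue_integral_def einterval_def)
  then show ?thesis
    unfolding g_def by (subst (asm) integral_mult_right_zero) simp
qed

lemma integral_sech4: "(\<integral>u. sech4 u \<partial>lborel) = 4 * pi"
proof -
  have int: "integrable lborel sech4"
    by (rule Bochner_Integration.integrable_bound[OF integrable_mult_right[OF integrable_exp_abs[of "1/4"], of 2]])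
      (use sech4_le in \<open>auto intro: order_trans[OF sech4_le]\<close>)
  have "(LBINT u=-\<infinity>..\<infinity>. sech4 u) = 4 * (pi / 2) - 4 * - (pi / 2)"
  proof (rule interval_integral_FTC_integrable)
    \<comment> \<open>The Gudermannian function is the primitive: 1 + sinh^2 = cosh^2 reduces its
      derivative to 1 / cosh.\<close>
    show "((\<lambda>u. 4 * arctan (sinh (u / 4))) has_vector_derivative sech4 u) (at u)" for u
    proof -
      have "1 + (sinh (u / 4))\<^sup>2 = (cosh (u / 4))\<^sup>2" by (simp add: cosh_square_eq)
      then show ?thesis
        unfolding has_real_derivative_iff_has_vector_derivative[symmetric]
        by (auto intro!: derivative_eq_intros simp: sech4_def field_simps power2_eq_square)
    qed
    show "isCont sech4 u" for u
      using continuous_sech4[of UNIV] by (simp add: continuous_on_eq_continuous_at)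
    show "set_integrable lborel (einterval (- \<infinity>) \<infinity>) sech4"
      using int by (simp add: set_integrable_def einterval_def)
    have "((\<lambda>u. 4 * arctan (sinh (u / 4))) \<longlongrightarrow> 4 * (pi / 2)) at_top"
      by (intro tendsto_intros filterlim_compose[OF tendsto_arctan_at_top] filterlim_compose[OF sinh_real_at_top])
        real_asymp
    then show "(((\<lambda>u. 4 * arctan (sinh (u / 4))) \<circ> real_of_ereal) \<longlongrightarrow> 4 * (pi / 2)) (at_left \<infinity>)"
      by (simp add: ereal_tendsto_simps1)
    have "((\<lambda>u. 4 * arctan (sinh (u / 4))) \<longlongrightarrow> 4 * - (pi / 2)) at_bot"
      by (intro tendsto_mult tendsto_const filterlim_compose[OF tendsto_arctan_at_bot] filterlim_compose[OF sinh_real_at_bot])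
        real_asymp
    then show "(((\<lambda>u. 4 * arctan (sinh (u / 4))) \<circ> real_of_ereal) \<longlongrightarrow> 4 * - (pi / 2)) (at_right (- \<infinity>))"
      by (simp add: ereal_tendsto_simps1)
  qed auto
  then show ?thesis
    by (simp add: interval_lebesgue_integral_def set_lebesgue_integral_def einterval_def)
qed

text \<open>Write p = a + x q: the constant contributes 2 a times the mass 4 pi, and x q contributes
  0 by the contour shift. On generating functions this is cos(2 pi s) * 4 pi sec(2 pi s) = 4
  pi.\<close>

lemma integral_shifted_sech4:
  "(\<integral>u. (poly p (of_real u + 2 * of_real pi * \<i>) + poly p (of_real u - 2 * of_real pi * \<i>)) *
     of_real (sech4 u) \<partial>lborel) = 8 * of_real pi * poly p 0"
proof (cases p)
  case (pCons a q)
  let ?c = "2 * of_real pi * \<i>"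
  let ?g = "\<lambda>u. (poly (pCons 0 q) (of_real u + ?c) + poly (pCons 0 q) (of_real u - ?c)) * of_real (sech4 u)"
  have "integrable lborel ?g"
    using integrable_poly_shift_sech4[of "pCons 0 q" ?c] integrable_poly_shift_sech4[of "pCons 0 q" "- ?c"]
    by (simp add: distrib_right del: poly_pCons)
  moreover have "integrable lborel (\<lambda>u. 2 * a * of_real (sech4 u))"
    using integrable_poly_sech4[of "[:2 * a:]"] by simp
  ultimately have "(\<integral>u. 2 * a * of_real (sech4 u) + ?g u \<partial>lborel) =
      (\<integral>u. 2 * a * of_real (sech4 u) \<partial>lborel) + (\<integral>u. ?g u \<partial>lborel)"
    by (intro Bochner_Integration.integral_add)
  moreover have "(\<integral>u. 2 * a * of_real (sech4 u) \<partial>lborel) = 8 * of_real pi * a"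
    using integral_sech4 by simp
  moreover have "2 * a * of_real (sech4 u) + ?g u =
      (poly p (of_real u + ?c) + poly p (of_real u - ?c)) * of_real (sech4 u)" for u
    by (simp add: pCons algebra_simps)
  ultimately show ?thesis
    using integral_shifted_sech4_aux[of q] by (simp add: pCons)
qed

section \<open>Half-line integrals against the Stanford--Witten kernel\<close>

lemma kernel_H_eq: "kernel_H z b = (sech4 (z - b) - sech4 (z + b)) / 2"
  by (simp add: kernel_H_def sech4_def)

lemma measurable_kernel_H [measurable]: "(\<lambda>z. kernel_H z b) \<in> borel_measurable borel"
  unfolding kernel_H_eq by measurable

lemma kernel_H_le: "\<bar>kernel_H z b\<bar> \<le> 2 * exp (\<bar>b\<bar> / 4) * exp (- (\<bar>z\<bar> / 4))"
proof -
  have le: "\<bar>sech4 v\<bar> \<le> 2 * exp (\<bar>b\<bar> / 4) * exp (- (\<bar>z\<bar> / 4))" if "\<bar>z\<bar> - \<bar>b\<bar> \<le> \<bar>v\<bar>" for v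
  proof -
    have "- (\<bar>v\<bar> / 4) \<le> \<bar>b\<bar> / 4 + - (\<bar>z\<bar> / 4)" using that by simp
    then have "exp (- (\<bar>v\<bar> / 4)) \<le> exp (\<bar>b\<bar> / 4 + - (\<bar>z\<bar> / 4))" by (simp only: exp_le_cancel_iff)
    then show ?thesis using sech4_le[of v] by (simp only: exp_add)
  qed
  have "\<bar>kernel_H z b\<bar> \<le> (\<bar>sech4 (z - b)\<bar> + \<bar>sech4 (z + b)\<bar>) / 2"
    unfolding kernel_H_eq by simp
  also have "\<dots> \<le> 2 * exp (\<bar>b\<bar> / 4) * exp (- (\<bar>z\<bar> / 4))"
  proof -
    have "\<bar>z\<bar> - \<bar>b\<bar> \<le> \<bar>z - b\<bar>" "\<bar>z\<bar> - \<bar>b\<bar> \<le> \<bar>z + b\<bar>" by linarith+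
    from le[OF this(1)] le[OF this(2)] show ?thesis by simp
  qed
  finally show ?thesis .
qed

lemma integrable_poly_kernel_H:
  "integrable lborel (\<lambda>z. poly p (complex_of_real z) * of_real (kernel_H z b))"
  by (rule integrable_poly_exp_decay[of _ "2 * exp (\<bar>b\<bar> / 4)"]) (use kernel_H_le in auto)

lemma set_integrable_poly_kernel_H:
  "set_integrable lborel {0<..} (\<lambda>z. poly p (complex_of_real z) * of_real (kernel_H z b))"
  unfolding set_integrable_def by (intro integrable_mult_indicator integrable_poly_kernel_H) simp

text \<open>Binomial expansion of r(u + b); the coefficients of \<open>k\<close> are moments of
  \<open>sech4\<close>.\<close>

lemma sech4_transform_poly:
  "\<exists>k. \<forall>b :: complex. (\<integral>u. poly r (of_real u + b) * of_real (sech4 u) \<partial>lborel) = poly k b"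
proof (induction r rule: poly_monom_induct)
  case (monom a i)
  let ?m = "\<lambda>j. (\<integral>u. poly (monom 1 j) (complex_of_real u) * of_real (sech4 u) \<partial>lborel)"
  show ?case
  proof (intro exI allI)
    fix b :: complex
    have "(\<integral>u. poly (monom a i) (of_real u + b) * of_real (sech4 u) \<partial>lborel) =
      (\<integral>u. (\<Sum>j\<le>i. (a * of_nat (i choose j) * b ^ (i - j)) *
         (poly (monom 1 j) (complex_of_real u) * of_real (sech4 u))) \<partial>lborel)"
      by (intro Bochner_Integration.integral_cong refl)
        (simp add: poly_monom binomial_ring sum_distrib_left sum_distrib_right mult_ac)
    also have "\<dots> = (\<Sum>j\<le>i. (a * of_nat (i choose j) * b ^ (i - j)) * ?m j)"
      by (subst Bochner_Integration.integral_sum) (auto intro!: integrable_mult_right integrable_poly_sech4)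
    also have "\<dots> = poly (\<Sum>j\<le>i. monom (a * of_nat (i choose j) * ?m j) (i - j)) b"
      by (simp add: poly_sum poly_monom mult_ac)
    finally show "(\<integral>u. poly (monom a i) (of_real u + b) * of_real (sech4 u) \<partial>lborel) =
      poly (\<Sum>j\<le>i. monom (a * of_nat (i choose j) * ?m j) (i - j)) b" .
  qed
next
  case (add p q)
  then obtain k l where
    "\<And>b :: complex. (\<integral>u. poly p (of_real u + b) * of_real (sech4 u) \<partial>lborel) = poly k b"
    "\<And>b :: complex. (\<integral>u. poly q (of_real u + b) * of_real (sech4 u) \<partial>lborel) = poly l b" by blast
  then show ?case
    by (intro exI[of _ "k + l"] allI)
      (simp add: distrib_right Bochner_Integration.integral_add[OF integrable_poly_shift_sech4 integrable_poly_shift_sech4])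
qed

text \<open>Both factors of the integrand are odd, so the half line contributes half of the integral
  over the real line, where translating the two parts of the kernel gives the same integral.\<close>

lemma half_line_kernel_H:
  fixes r :: "complex poly"
  assumes odd: "\<And>x. poly r (- x) = - poly r x"
  shows "(LINT x:{0<..}|lborel. poly r (of_real x) * of_real (kernel_H x b)) =
    1/2 * (\<integral>u. poly r (of_real u + of_real b) * of_real (sech4 u) \<partial>lborel)"
proof -
  define f where "f = (\<lambda>x. poly r (complex_of_real x) * of_real (kernel_H x b))"
  have f_int: "integrable lborel f" unfolding f_def by (rule integrable_poly_kernel_H)
  have sech4_minus: "sech4 (- u) = sech4 u" for u by (simp add: sech4_def)
  have "kernel_H (- x) b = - kernel_H x b" for x
  proof -
    have "- x - b = - (x + b)" "- x + b = - (x - b)" by simp_all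
    then show ?thesis unfolding kernel_H_eq by (simp only: sech4_minus) (simp add: field_simps)
  qed
  then have f_even: "f (- x) = f x" for x
    using odd by (simp add: f_def)
  have "poly r 0 = 0" using odd[of 0] by (simp add: eq_neg_iff_add_eq_0 flip: mult_2)
  then have f0: "f 0 = 0" by (simp add: f_def)
  have half: "integrable lborel (\<lambda>x. indicator {0<..} x *\<^sub>R f x)"
    by (intro integrable_mult_indicator f_int) simp
  have half': "(\<integral>x. indicator {0<..} (- x) *\<^sub>R f x \<partial>lborel) = (\<integral>x. indicator {0<..} x *\<^sub>R f x \<partial>lborel)"
    using lborel_integral_real_affine[of "-1" "\<lambda>x. indicator {0<..} x *\<^sub>R f x" 0] f_even by simp
  have half_int': "integrable lborel (\<lambda>x. indicator {0<..} (- x) *\<^sub>R f x)"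
    using lborel_integrable_real_affine[OF half, of "-1" 0] f_even by simp
  have "(\<integral>x. f x \<partial>lborel) = (\<integral>x. indicator {0<..} x *\<^sub>R f x + indicator {0<..} (- x) *\<^sub>R f x \<partial>lborel)"
    by (intro Bochner_Integration.integral_cong refl) (auto simp: indicator_def f0 not_less antisym_conv)
  also have "\<dots> = 2 * (\<integral>x. indicator {0<..} x *\<^sub>R f x \<partial>lborel)"
    by (simp only: Bochner_Integration.integral_add[OF half half_int'] half' mult_2)
  finally have 1: "(\<integral>x. indicator {0<..} x *\<^sub>R f x \<partial>lborel) = 1/2 * (\<integral>x. f x \<partial>lborel)" by simp
  define h where "h = (\<lambda>d x. poly r (complex_of_real x) * of_real (sech4 (x - d)))"
  define w where "w = (\<lambda>u. poly r (of_real u + of_real b) * complex_of_real (sech4 u))"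
  have h: "h d (d + u) = poly r (of_real u + of_real d) * of_real (sech4 u)" for d u
    by (simp add: h_def add.commute)
  have hb: "(\<integral>x. h b x \<partial>lborel) = (\<integral>u. w u \<partial>lborel)"
    using lborel_integral_real_affine[of 1 "h b" b] by (simp add: h w_def)
  have hmb: "(\<integral>x. h (- b) x \<partial>lborel) = - (\<integral>u. w u \<partial>lborel)"
  proof -
    \<comment> \<open>For the translate by -b the variable is also reflected, x = -b - u.
      \<open>sech4\<close> is even and \<open>r\<close> odd, so both parts of the kernel give the
      same integral up to sign.\<close>
    have "h (- b) (- b + - 1 * u) = - w u" for u
      unfolding h w_def using odd[of "of_real u + of_real b"] sech4_minus[of u] by (simp add: algebra_simps)
    then show ?thesis
      using lborel_integral_real_affine[of "- 1" "h (- b)" "- b"] by simp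
  qed
  have h_int: "integrable lborel (h d)" for d
    using lborel_integrable_real_affine[OF integrable_poly_shift_sech4[of r "of_real d"], of 1 "- d"]
    by (simp add: h_def)
  have "(\<integral>x. f x \<partial>lborel) = (\<integral>x. 1/2 * (h b x - h (- b) x) \<partial>lborel)"
    by (intro Bochner_Integration.integral_cong refl) (simp add: f_def h_def kernel_H_eq field_simps)
  also have "\<dots> = (\<integral>u. w u \<partial>lborel)"
    using h_int hb hmb by (simp add: Bochner_Integration.integral_diff)
  finally show ?thesis
    using 1 by (simp add: set_lebesgue_integral_def f_def w_def)
qed

text \<open>The inversion of the kernel: shifting b shifts the argument of r, so
  \<open>integral_shifted_sech4\<close> applied to r(x + b) evaluates the sum of the two shifts to 8
  pi r(b). The factors 1/2 of the half line and of the mean leave 2 pi r(b).\<close>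

lemma kernel_H_transform:
  fixes r :: "complex poly"
  assumes "\<And>x. poly r (- x) = - poly r x"
  shows "\<exists>k. (\<forall>b. (LINT x:{0<..}|lborel. poly r (of_real x) * of_real (kernel_H x b)) = poly k (of_real b)) \<and>
    shift_mean k = smult (2 * of_real pi) r"
proof -
  let ?c = "2 * of_real pi * \<i>"
  obtain k where k: "\<And>b :: complex. (\<integral>u. poly r (of_real u + b) * of_real (sech4 u) \<partial>lborel) = poly k b"
    using sech4_transform_poly by blast
  have "poly (shift_mean (smult (1/2) k)) b = poly (smult (2 * of_real pi) r) b" for b
  proof -
    have "poly k (b + ?c) + poly k (b - ?c) =
       (\<integral>u. poly r (of_real u + (b + ?c)) * of_real (sech4 u) + poly r (of_real u + (b - ?c)) * of_real (sech4 u) \<partial>lborel)"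
      unfolding k[symmetric]
      by (rule Bochner_Integration.integral_add[symmetric]) (rule integrable_poly_shift_sech4)+
    also have "\<dots> = (\<integral>u. (poly (pcompose r [:b, 1:]) (of_real u + ?c) + poly (pcompose r [:b, 1:]) (of_real u - ?c)) *
         of_real (sech4 u) \<partial>lborel)"
      by (intro Bochner_Integration.integral_cong refl) (simp add: poly_pcompose algebra_simps)
    also have "\<dots> = 8 * of_real pi * poly r b"
      unfolding integral_shifted_sech4 by (simp add: poly_pcompose)
    finally have "poly k (b + ?c) + poly k (b - ?c) = 8 * of_real pi * poly r b" .
    moreover have "poly (shift_mean (smult (1/2) k)) b = (poly k (b + ?c) + poly k (b - ?c)) / 4"
      by (simp add: poly_shift_mean)
    ultimately show ?thesis by simp
  qed
  then have "shift_mean (smult (1/2) k) = smult (2 * of_real pi) r"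
    by (simp add: fun_eq_iff flip: poly_eq_poly_eq_iff)
  then show ?thesis
    using half_line_kernel_H[OF assms] k by (intro exI[of _ "smult (1/2) k"]) simp
qed

text \<open>Fubini in the variables \<open>x\<close> and \<open>z = x + y\<close>.\<close>

lemma double_integral_conv:
  fixes k :: "real \<Rightarrow> complex"
  assumes [measurable]: "k \<in> borel_measurable borel"
    and k: "\<And>z. norm (k z) \<le> K * exp (- (\<bar>z\<bar> / 4))"
  shows "0 < x \<Longrightarrow> set_integrable lborel {0<..} (\<lambda>y. poly p (of_real x) * poly q (of_real y) * k (x + y))"
    and "set_integrable lborel {0<..} (\<lambda>x. LINT y:{0<..}|lborel. poly p (of_real x) * poly q (of_real y) * k (x + y))"
    and "(LINT x:{0<..}|lborel. LINT y:{0<..}|lborel. poly p (of_real x) * poly q (of_real y) * k (x + y)) =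
      (LINT z:{0<..}|lborel. poly (conv p q) (of_real z) * k z)"
proof -
  obtain C where C: "C \<ge> 0" "\<And>z. norm (poly p z) \<le> C * exp (1/8 * norm z)"
    using poly_norm_le_exp[of "1/8" p] by auto
  obtain D where D: "D \<ge> 0" "\<And>z. norm (poly q z) \<le> D * exp (1/8 * norm z)"
    using poly_norm_le_exp[of "1/8" q] by auto
  define f where "f = (\<lambda>x y. indicator {0<..} x *\<^sub>R (indicator {0<..} y *\<^sub>R
     (poly p (complex_of_real x) * poly q (complex_of_real y) * k (x + y))))"
  define B where "B = C * D * K"
  \<comment> \<open>Each polynomial costs rate 1/8 and the kernel gives 1/4 in each variable, which
    leaves 1/8.\<close>
  have f_bound: "norm (f x y) \<le> B * exp (- (1/8 * x)) * exp (- (1/8 * y))" if "x > 0" "y > 0" for x y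
  proof -
    have "norm (f x y) = norm (poly p (complex_of_real x)) * norm (poly q (complex_of_real y)) * norm (k (x + y))"
      using that by (simp add: f_def norm_mult)
    also have "\<dots> \<le> (C * exp (1/8 * x)) * (D * exp (1/8 * y)) * (K * exp (- ((x + y) / 4)))"
      using C(1) D(1) C(2)[of "of_real x"] D(2)[of "of_real y"] k[of "x + y"] that
      by (intro mult_mono) (auto intro!: mult_nonneg_nonneg)
    also have "\<dots> = B * (exp (1/8 * x) * exp (1/8 * y) * exp (- ((x + y) / 4)))"
      by (simp add: B_def mult_ac)
    also have "exp (1/8 * x) * exp (1/8 * y) * exp (- ((x + y) / 4)) = exp (- (1/8 * x)) * exp (- (1/8 * y))"
      by (simp add: field_simps flip: exp_add)
    finally show ?thesis by (simp add: mult.assoc)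
  qed
  have f0: "f x y = 0" if "\<not> (x > 0 \<and> y > 0)" for x y
    using that by (auto simp: f_def)
  have "K * exp (- (\<bar>0\<bar> / 4)) \<ge> 0" using order_trans[OF norm_ge_zero k] .
  then have B0: "B \<ge> 0" using C(1) D(1) by (simp add: B_def)
  have f_int: "integrable lborel (f x)" for x
  proof -
    have "integrable lborel (\<lambda>y. B * exp (- (1/8 * x)) * exp (- (1/8 * \<bar>y\<bar>)))"
      by (intro integrable_mult_right integrable_exp_abs) simp
    then show ?thesis
    proof (rule Bochner_Integration.integrable_bound)
      show "AE y in lborel. norm (f x y) \<le> norm (B * exp (- (1/8 * x)) * exp (- (1/8 * \<bar>y\<bar>)))"
      proof (rule AE_I2)
        fix y show "norm (f x y) \<le> norm (B * exp (- (1/8 * x)) * exp (- (1/8 * \<bar>y\<bar>)))"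
          using f_bound[of x y] f0[of x y] B0 by (cases "x > 0 \<and> y > 0") auto
      qed
    qed (simp add: f_def)
  qed
  show "set_integrable lborel {0<..} (\<lambda>y. poly p (of_real x) * poly q (of_real y) * k (x + y))" if "0 < x"
    using f_int[of x] that by (simp add: f_def set_integrable_def)
  define g where "g = (\<lambda>x z. f x (z - x))"
  have shift: "(\<integral>y. f x y \<partial>lborel) = (\<integral>z. g x z \<partial>lborel)" for x
    using lborel_integral_real_affine[of 1 "f x" "- x"] by (simp add: g_def)
  have g_int: "integrable (lborel \<Otimes>\<^sub>M lborel) (case_prod g)"
  proof (rule Bochner_Integration.integrable_bound)
    \<comment> \<open>On the support 0 < x < z, so decay at rate 1/8 in z alone is at least decay at
      rate 1/16 in both x and z, an integrable product.\<close>
    let ?e = "\<lambda>x. exp (- (1/16 * \<bar>x :: real\<bar>))"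
    have e: "integrable lborel ?e" by (rule integrable_exp_abs) simp
    show "integrable (lborel \<Otimes>\<^sub>M lborel) (\<lambda>(x, z). B * (?e x * ?e z))"
    proof (rule lborel_pair.Fubini_integrable)
      show "integrable lborel (\<lambda>x. \<integral>y. norm (case (x, y) of (x, z) \<Rightarrow> B * (?e x * ?e z)) \<partial>lborel)"
        using B0 e by (simp add: norm_mult)
      show "AE x in lborel. integrable lborel (\<lambda>y. case (x, y) of (x, z) \<Rightarrow> B * (?e x * ?e z))"
        using e by simp
    qed measurable
    show "case_prod g \<in> borel_measurable (lborel \<Otimes>\<^sub>M lborel)"
      unfolding g_def f_def by measurable
    show "AE w in lborel \<Otimes>\<^sub>M lborel. norm (case_prod g w) \<le> norm (case w of (x, z) \<Rightarrow> B * (?e x * ?e z))"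
    proof (rule AE_I2, clarify)
      fix x z :: real
      show "norm (g x z) \<le> norm (B * (?e x * ?e z))"
      proof (cases "x > 0 \<and> z - x > 0")
        case True
        then have "norm (g x z) \<le> B * exp (- (1/8 * x)) * exp (- (1/8 * (z - x)))"
          unfolding g_def by (intro f_bound) auto
        also have "\<dots> = B * exp (- (1/8 * z))"
          by (simp add: mult.assoc algebra_simps flip: exp_add)
        also have "\<dots> \<le> B * (?e x * ?e z)"
          using True B0 by (intro mult_left_mono) (auto simp flip: exp_add)
        finally show ?thesis using B0 by simp
      qed (use f0[of x "z - x"] in \<open>auto simp: g_def\<close>)
    qed
  qed
  have outer: "indicator {0<..} x *\<^sub>R (LINT y:{0<..}|lborel. poly p (of_real x) * poly q (of_real y) * k (x + y)) =
      (\<integral>z. g x z \<partial>lborel)" for x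
    unfolding shift[symmetric] f_def set_lebesgue_integral_def by (cases "x > 0") auto
  show "set_integrable lborel {0<..} (\<lambda>x. LINT y:{0<..}|lborel. poly p (of_real x) * poly q (of_real y) * k (x + y))"
    unfolding set_integrable_def outer using lborel_pair.integrable_fst'[OF g_int] by simp
  have inner: "(\<integral>x. g x z \<partial>lborel) = indicator {0<..} z *\<^sub>R (poly (conv p q) (of_real z) * k z)" for z
  proof (cases "z > 0")
    case True
    \<comment> \<open>The open interval arising from the two indicators and the closed one of
      \<open>LINT_conv\<close> differ by two points.\<close>
    have "(\<integral>x. g x z \<partial>lborel) = (\<integral>x. indicator {0..z} x *\<^sub>R (poly p (of_real x) * poly q (of_real (z - x))) * k z \<partial>lborel)"
    proof (rule integral_cong_AE)
      show "AE x in lborel. g x z = indicator {0..z} x *\<^sub>R (poly p (of_real x) * poly q (of_real (z - x))) * k z"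
        using AE_lborel_singleton[of 0] AE_lborel_singleton[of z]
        by eventually_elim (auto simp: g_def f_def indicator_def)
      show "(\<lambda>x. g x z) \<in> borel_measurable lborel"
        unfolding g_def f_def by measurable
      show "(\<lambda>x. indicator {0..z} x *\<^sub>R (poly p (of_real x) * poly q (of_real (z - x))) * k z) \<in> borel_measurable lborel"
        by measurable
    qed
    also have "\<dots> = poly (conv p q) (of_real z) * k z"
      using LINT_conv[of z p q] True unfolding integral_mult_left_zero set_lebesgue_integral_def by simp
    finally show ?thesis using True by simp
  next
    case False
    then have "g x z = 0" for x using f0[of x "z - x"] by (auto simp: g_def)
    then show ?thesis using False by simp
  qed
  show "(LINT x:{0<..}|lborel. LINT y:{0<..}|lborel. poly p (of_real x) * poly q (of_real y) * k (x + y)) =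
      (LINT z:{0<..}|lborel. poly (conv p q) (of_real z) * k z)"
    using lborel_pair.Fubini_integral[OF g_int]
    by (simp only: set_lebesgue_integral_def[of lborel "{0<..}" "\<lambda>x. LINT y:{0<..}|lborel. _ x y"] outer inner
        set_lebesgue_integral_def[of lborel "{0<..}" "\<lambda>z. poly (conv p q) (of_real z) * k z"])
qed

section \<open>From the Stanford--Witten recursion to the recursion with shifts\<close>

lemma is_evenI_coeff:
  assumes "\<And>i. odd i \<Longrightarrow> coeff p i = 0"
  shows "is_even p"
proof -
  have "pcompose p [:0, -1:] = p"
  proof (rule poly_eqI)
    fix n show "coeff (pcompose p [:0, -1:]) n = coeff p n"
      using assms[of n] by (cases "even n") (auto simp: coeff_pcompose_linear)
  qed
  then show ?thesis by (metis is_even_def poly_pcompose poly_pCons poly_0 mult_zero_right add_0 mult_minus1_right add.right_neutral)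
qed

text \<open>For even p the transform of x p is an even polynomial in 1/t. A product of two such is
  even, and inverting the transform lowers every degree by one.\<close>

lemma conv1_odd:
  assumes "is_even p" "is_even q"
  shows "poly (conv1 p q) (- x) = - poly (conv1 p q) x"
proof -
  have e: "is_even (lapq (pCons 0 p))" if "is_even p" for p
    by (rule is_evenI_coeff)
      (use is_even_coeff[OF that] in \<open>auto simp: coeff_lapq coeff_pCons split: nat.split\<close>)
  have "is_even (lapq (pCons 0 p) * lapq (pCons 0 q))"
    using e[OF assms(1)] e[OF assms(2)] by (simp add: is_even_def)
  from is_even_coeff[OF this] have c: "coeff (conv1 p q) i = 0" if "even i" for i
    using that by (simp add: conv1_def conv_def coeff_unlapq)
  have "pcompose (conv1 p q) [:0, -1:] = - conv1 p q"
  proof (rule poly_eqI)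
    fix n show "coeff (pcompose (conv1 p q) [:0, -1:]) n = coeff (- conv1 p q) n"
      using c[of n] by (cases "even n") (auto simp: coeff_pcompose_linear)
  qed
  from arg_cong[OF this, of "\<lambda>p. poly p x"] show ?thesis by (simp add: poly_pcompose)
qed

lemma slice_contract_odd:
  assumes "even_tensor D" "arity D (Suc (Suc n))"
  shows "poly (slice poly (contract D) xs) (- x) = - poly (slice poly (contract D) xs) x"
  using assms
proof (induction D)
  case (Cons d D)
  obtain c p q ps where d: "d = (c, p # q # ps)" using Cons.prems by (cases d) (auto simp: length_Suc_conv)
  then show ?case
    using Cons conv1_odd[of p q x] by (simp add: contract_def slice_simps even_tensor_def)
qed (simp add: contract_def slice_simps)

text \<open>Linearity in \<open>D\<close>, reducing to \<open>double_integral_conv\<close> for one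
  product. Integrability of the inner and of the outer integral is part of the claim so that
  integrals of sums split.\<close>

lemma double_kernel_tensor:
  fixes xs :: "complex list" and b :: real
  assumes "arity D (Suc (Suc n))"
  defines "f \<equiv> \<lambda>D x y. of_real (x * y) * tensor poly D (complex_of_real x # complex_of_real y # xs) *
      of_real (kernel_H (x + y) b)"
  shows "(\<forall>x>0. set_integrable lborel {0<..} (f D x)) \<and>
    set_integrable lborel {0<..} (\<lambda>x. LINT y:{0<..}|lborel. f D x y) \<and>
    (LINT x:{0<..}|lborel. LINT y:{0<..}|lborel. f D x y) =
      (LINT z:{0<..}|lborel. poly (slice poly (contract D) xs) (of_real z) * of_real (kernel_H z b))"
  using assms(1)
proof (induction D)
  case Nil
  then show ?case
    by (simp add: f_def contract_def slice_simps set_integrable_def set_lebesgue_integral_def)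
next
  case (Cons d D)
  obtain c p q ps where d: "d = (c, p # q # ps)" using Cons.prems by (cases d) (auto simp: length_Suc_conv)
  let ?c = "c * prod_list (map2 poly ps xs)"
  define h where "h = (\<lambda>x y. poly (pCons 0 p) (complex_of_real x) * poly (pCons 0 q) (complex_of_real y) *
    complex_of_real (kernel_H (x + y) b))"
  have IH: "\<And>x. x > 0 \<Longrightarrow> set_integrable lborel {0<..} (f D x)"
    "set_integrable lborel {0<..} (\<lambda>x. LINT y:{0<..}|lborel. f D x y)"
    "(LINT x:{0<..}|lborel. LINT y:{0<..}|lborel. f D x y) =
      (LINT z:{0<..}|lborel. poly (slice poly (contract D) xs) (of_real z) * of_real (kernel_H z b))"
    using Cons by (auto simp: d)
  have "(\<lambda>z. complex_of_real (kernel_H z b)) \<in> borel_measurable borel" by measurable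
  moreover have "norm (complex_of_real (kernel_H z b)) \<le> 2 * exp (\<bar>b\<bar> / 4) * exp (- (\<bar>z\<bar> / 4))" for z
    using kernel_H_le[of z b] by simp
  ultimately have h: "x > 0 \<Longrightarrow> set_integrable lborel {0<..} (h x)"
    "set_integrable lborel {0<..} (\<lambda>x. LINT y:{0<..}|lborel. h x y)"
    "(LINT x:{0<..}|lborel. LINT y:{0<..}|lborel. h x y) =
      (LINT z:{0<..}|lborel. poly (conv1 p q) (of_real z) * of_real (kernel_H z b))" for x
    unfolding h_def conv1_def
    using double_integral_conv[of "\<lambda>z. complex_of_real (kernel_H z b)" "2 * exp (\<bar>b\<bar> / 4)"]
    by (simp_all del: poly_pCons)
  have eq: "f (d # D) x y = ?c * h x y + f D x y" for x y
    by (simp add: f_def h_def d algebra_simps)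
  have inner: "(LINT y:{0<..}|lborel. f (d # D) x y) =
      ?c * (LINT y:{0<..}|lborel. h x y) + (LINT y:{0<..}|lborel. f D x y)" if "x > 0" for x
    unfolding eq using h(1)[OF that] IH(1)[OF that] by (subst set_integral_add) auto
  have int: "set_integrable lborel {0<..} (\<lambda>x. ?c * (LINT y:{0<..}|lborel. h x y) + (LINT y:{0<..}|lborel. f D x y))"
    using h(2) IH(2) by (intro set_integral_add set_integrable_mult_right)
  have s: "poly (slice poly (contract (d # D)) xs) z = ?c * poly (conv1 p q) z + poly (slice poly (contract D) xs) z" for z
    by (simp add: d contract_def slice_simps)
  show ?case
  proof (intro conjI allI impI)
    show "set_integrable lborel {0<..} (f (d # D) x)" if "x > 0" for x
      unfolding eq using h(1)[OF that] IH(1)[OF that] by (intro set_integral_add set_integrable_mult_right)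
    show "set_integrable lborel {0<..} (\<lambda>x. LINT y:{0<..}|lborel. f (d # D) x y)"
      by (rule set_integrable_cong[THEN iffD2, OF refl refl _ int]) (simp add: inner)
    have "(LINT x:{0<..}|lborel. LINT y:{0<..}|lborel. f (d # D) x y) =
        (LINT x:{0<..}|lborel. ?c * (LINT y:{0<..}|lborel. h x y) + (LINT y:{0<..}|lborel. f D x y))"
      by (rule set_lebesgue_integral_cong) (auto simp: inner)
    also have "\<dots> = ?c * (LINT x:{0<..}|lborel. LINT y:{0<..}|lborel. h x y) +
        (LINT x:{0<..}|lborel. LINT y:{0<..}|lborel. f D x y)"
      using h(2) IH(2) by (subst set_integral_add) auto
    also have "\<dots> = (LINT z:{0<..}|lborel. ?c * (poly (conv1 p q) (of_real z) * of_real (kernel_H z b)) +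
        poly (slice poly (contract D) xs) (of_real z) * of_real (kernel_H z b))"
      unfolding h(3) IH(3) using set_integrable_poly_kernel_H
      by (subst set_integral_add) auto
    finally show "(LINT x:{0<..}|lborel. LINT y:{0<..}|lborel. f (d # D) x y) =
      (LINT z:{0<..}|lborel. poly (slice poly (contract (d # D)) xs) (of_real z) * of_real (kernel_H z b))"
      unfolding s by (simp add: algebra_simps)
  qed
qed

lemma double_kernel_transform:
  assumes "arity D (Suc (Suc n))" "even_tensor D"
  shows "\<exists>k. (\<forall>b. (LINT x:{0<..}|lborel. LINT y:{0<..}|lborel.
        of_real (x * y) * tensor poly D (complex_of_real x # complex_of_real y # xs) *
        of_real (kernel_H (x + y) b)) = poly k (of_real b)) \<and>
    shift_mean k = smult (2 * of_real pi) (slice poly (contract D) xs)"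
  using kernel_H_transform[OF slice_contract_odd[OF assms(2,1)], of xs]
    double_kernel_tensor[OF assms(1), of xs] by simp

lemma shift_mean_linear:
  "shift_mean (p + q) = shift_mean p + shift_mean q" "shift_mean (smult c p) = smult c (shift_mean p)"
  "shift_mean 0 = 0"
  by (simp_all add: fun_eq_iff poly_shift_mean field_simps flip: poly_eq_poly_eq_iff)

lemma shift_mean_sum: "shift_mean (\<Sum>i\<in>I. f i) = (\<Sum>i\<in>I. shift_mean (f i))"
  by (induction I rule: infinite_finite_induct) (auto simp: shift_mean_linear)

lemma super_volume_slice_even:
  assumes "super_volume_family V"
    and V: "\<And>x. stable_part V h (x # xs) = poly w x"
  shows "is_even w"
proof -
  have "stable_part V h (- x # xs) = stable_part V h (x # xs)" for x
  proof (cases "stable h (Suc (length xs))")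
    case True
    then have "\<forall>bs i. length bs = Suc (length xs) \<and> i < Suc (length xs) \<longrightarrow> V h (bs[i := - (bs ! i)]) = V h bs"
      using assms(1) unfolding super_volume_family_def by blast
    from this[rule_format, of "x # xs" 0] show ?thesis by (simp add: stable_part_def)
  qed (simp add: stable_part_def)
  then show ?thesis by (simp add: is_even_def V)
qed

text \<open>With the other lengths fixed, both sides of (SW) are polynomials in b. Each kernel
  integral is a polynomial whose shift average is 2 pi times an odd polynomial, the one that (N)
  contains in its place. Applying \<open>shift_mean\<close> to both sides and cancelling 2 pi gives
  (N).\<close>

theorem recursion_SW_imp_N:
  assumes fam: "super_volume_family V" and SW: "recursion_SW V g n"
  shows "recursion_N V g n"
  unfolding recursion_N_def Let_def
proof (intro allI impI, elim conjE)
  fix b0 :: real and bs :: "real list"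
  assume b0: "0 < b0" and bs: "length bs = n - 1" "\<forall>x\<in>set bs. 0 < x"
  let ?bs = "map complex_of_real bs"
  have slice: "\<exists>w. (\<forall>x. stable_part V h (x # xs) = poly w x) \<and> is_even w" for h xs
  proof -
    obtain D where D: "arity D (Suc (length xs))"
      "\<And>ys. length ys = Suc (length xs) \<Longrightarrow> stable_part V h ys = tensor poly D ys"
      using super_volume_tensor[OF fam] by metis
    have "stable_part V h (x # xs) = poly (slice poly D xs) x" for x
      using D(2)[of "x # xs"] by (simp add: tensor_eq_slice[OF linear_in_poly_poly D(1)])
    then show ?thesis using super_volume_slice_even[OF fam] by blast
  qed
  \<comment> \<open>The volume as an even polynomial in its first variable, with the remaining
    lengths as parameters.\<close>
  define W where "W = (\<lambda>h xs. SOME w. (\<forall>x. stable_part V h (x # xs) = poly w x) \<and> is_even w)"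
  have W: "stable_part V h (x # xs) = poly (W h xs) x" "is_even (W h xs)" for h x xs
    using someI_ex[OF slice[of h xs]] unfolding W_def by blast+
  obtain D where D: "arity D (Suc (Suc (length bs)))" "even_tensor D"
      "\<And>ys. length ys = Suc (Suc (length bs)) \<Longrightarrow> stable_part V (g - 1) ys = tensor poly D ys"
    using super_volume_tensor[OF fam] by metis
  obtain k1 where k1: "\<And>b. (LINT x:{0<..}|lborel. LINT y:{0<..}|lborel.
        of_real (x * y) * tensor poly D (complex_of_real x # complex_of_real y # ?bs) *
        of_real (kernel_H (x + y) b)) = poly k1 (of_real b)"
      "shift_mean k1 = smult (2 * of_real pi) (slice poly (contract D) ?bs)"
    using double_kernel_transform[OF D(1,2), of ?bs] by blast
  \<comment> \<open>A product of two volumes is a single product of two one-variable polynomials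
    with no variables left, so a one-element list suffices.\<close>
  have "\<exists>k. (\<forall>b. (LINT x:{0<..}|lborel. LINT y:{0<..}|lborel.
        of_real (x * y) * poly (W g1 (nths ?bs I)) (of_real x) * poly (W (g - g1) (nths ?bs (- I))) (of_real y) *
        of_real (kernel_H (x + y) b)) = poly k (of_real b)) \<and>
      shift_mean k = smult (2 * of_real pi) (conv1 (W g1 (nths ?bs I)) (W (g - g1) (nths ?bs (- I))))" for g1 I
    using double_kernel_transform[of "[(1, [W g1 (nths ?bs I), W (g - g1) (nths ?bs (- I))])]" 0 "[]"] W(2)
    by (simp add: even_tensor_def contract_def slice_simps mult.assoc)
  then obtain k2 where k2: "\<And>g1 I b. (LINT x:{0<..}|lborel. LINT y:{0<..}|lborel.
        of_real (x * y) * poly (W g1 (nths ?bs I)) (of_real x) * poly (W (g - g1) (nths ?bs (- I))) (of_real y) *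
        of_real (kernel_H (x + y) b)) = poly (k2 g1 I) (of_real b)"
      "\<And>g1 I. shift_mean (k2 g1 I) = smult (2 * of_real pi) (conv1 (W g1 (nths ?bs I)) (W (g - g1) (nths ?bs (- I))))"
    by metis
  have "\<exists>k. (\<forall>b. (LINT x:{0<..}|lborel. poly (pCons 0 (W g (nths ?bs (- {j})))) (of_real x) *
        of_real (kernel_H x b)) = poly k (of_real b)) \<and>
      shift_mean k = smult (2 * of_real pi) (pCons 0 (W g (nths ?bs (- {j}))))" for j
    using W(2)[of g "nths ?bs (- {j})"] by (intro kernel_H_transform) (simp add: is_even_def)
  then obtain k3 where k3: "\<And>j b. (LINT x:{0<..}|lborel. poly (pCons 0 (W g (nths ?bs (- {j})))) (of_real x) *
        of_real (kernel_H x b)) = poly (k3 j) (of_real b)"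
      "\<And>j. shift_mean (k3 j) = smult (2 * of_real pi) (pCons 0 (W g (nths ?bs (- {j}))))"
    by metis
  let ?\<delta> = "if g = 0 then 0 else 1/2 :: complex"
  \<comment> \<open>\<open>L\<close> and \<open>R\<close> are the two sides of (SW) as polynomials
    in b. The arguments b + b_j and b - b_j of the kernel become compositions with
    translations.\<close>
  define L where "L = smult (2 * of_real pi) (pCons 0 (W g ?bs))"
  define R where "R = smult ?\<delta> k1 + smult (1/2) (\<Sum>g1\<le>g. \<Sum>I\<in>Pow {..<length bs}. k2 g1 I) +
    smult (1/2) (\<Sum>j<length bs. pcompose (k3 j) [:of_real (bs ! j), 1:] + pcompose (k3 j) [:- of_real (bs ! j), 1:])"
  have "poly (L - R) (of_real b) = 0" if b: "b > 0" for b
  proof -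
    have e: "2 * of_real pi * of_real b * stable_part V g (map of_real (b # bs)) =
       (if g = 0 then 0 else
          1/2 * (LINT x:{0<..}|lborel. LINT y:{0<..}|lborel.
             of_real (x * y) * stable_part V (g - 1) (map of_real (x # y # bs)) * of_real (kernel_H (x + y) b)))
     + 1/2 * (\<Sum>g1\<le>g. \<Sum>I\<in>Pow {..<length bs}.
          LINT x:{0<..}|lborel. LINT y:{0<..}|lborel.
             of_real (x * y) * stable_part V g1 (map of_real (x # nths bs I)) *
             stable_part V (g - g1) (map of_real (y # nths bs (- I))) * of_real (kernel_H (x + y) b))
     + 1/2 * (\<Sum>j<length bs.
          LINT x:{0<..}|lborel.
             of_real x * stable_part V g (map of_real (x # nths bs (- {j}))) *
             of_real (kernel_H x (b + bs ! j) + kernel_H x (b - bs ! j)))"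
      (is "?L = ?Q + 1/2 * ?R + 1/2 * ?S")
      using SW[unfolded recursion_SW_def Let_def, rule_format, of b bs] bs b by simp
    have eL: "?L = poly L (of_real b)" by (simp add: L_def W)
    have eQ: "?Q = poly (smult ?\<delta> k1) (of_real b)"
    proof -
      have "stable_part V (g - 1) (map of_real (x # y # bs)) =
          tensor poly D (complex_of_real x # complex_of_real y # ?bs)" for x y
        using D(3)[of "complex_of_real x # complex_of_real y # ?bs"] by simp
      then show ?thesis by (simp only: k1(1)) simp
    qed
    have eR: "?R = poly (\<Sum>g1\<le>g. \<Sum>I\<in>Pow {..<length bs}. k2 g1 I) (of_real b)"
      by (simp only: list.map nths_map[symmetric] W k2(1) poly_sum)
    have eS: "?S = poly (\<Sum>j<length bs. pcompose (k3 j) [:of_real (bs ! j), 1:] +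
        pcompose (k3 j) [:- of_real (bs ! j), 1:]) (of_real b)"
      unfolding poly_sum
    proof (intro sum.cong refl)
      fix j
      let ?r = "pCons 0 (W g (nths ?bs (- {j})))"
      have "(LINT x:{0<..}|lborel. of_real x * stable_part V g (map of_real (x # nths bs (- {j}))) *
             of_real (kernel_H x (b + bs ! j) + kernel_H x (b - bs ! j))) =
         (LINT x:{0<..}|lborel. poly ?r (of_real x) * of_real (kernel_H x (b + bs ! j)) +
             poly ?r (of_real x) * of_real (kernel_H x (b - bs ! j)))"
        by (simp add: W distrib_left mult_ac flip: nths_map)
      also have "\<dots> = poly (k3 j) (of_real (b + bs ! j)) + poly (k3 j) (of_real (b - bs ! j))"
        unfolding k3(1)[symmetric] by (rule set_integral_add) (rule set_integrable_poly_kernel_H)+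
      finally show "(LINT x:{0<..}|lborel. of_real x * stable_part V g (map of_real (x # nths bs (- {j}))) *
             of_real (kernel_H x (b + bs ! j) + kernel_H x (b - bs ! j))) =
         poly (pcompose (k3 j) [:of_real (bs ! j), 1:] + pcompose (k3 j) [:- of_real (bs ! j), 1:]) (of_real b)"
        by (simp add: poly_pcompose algebra_simps)
    qed
    show ?thesis
      using e[unfolded eL eQ eR eS] by (simp add: R_def)
  qed
  moreover note infinite_of_real_pos
  ultimately have "L - R = 0"
    by (intro poly_zero_if_infinite[of "complex_of_real ` {0<..}"]) auto
  \<comment> \<open>Averaging over the shifts needs values at b + 2 pi i and b - 2 pi i, hence the
    equality of polynomials rather than of functions on b > 0.\<close>
  then have "poly (shift_mean L) (of_real b0) = poly (shift_mean R) (of_real b0)" by simp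
  moreover have "poly (shift_mean L) (of_real b0) = 2 * of_real pi * (1/2 * ((of_real b0 + 2 * of_real pi * \<i>) *
      stable_part V g ((of_real b0 + 2 * of_real pi * \<i>) # ?bs) +
      (of_real b0 - 2 * of_real pi * \<i>) * stable_part V g ((of_real b0 - 2 * of_real pi * \<i>) # ?bs)))"
    unfolding L_def shift_mean_linear by (simp add: poly_shift_mean W)
  moreover have "poly (shift_mean R) (of_real b0) = 2 * of_real pi *
     ((if g = 0 then 0 else
          1/2 * (LINT x:{0..b0}|lborel.
             of_real (x * (b0 - x)) * stable_part V (g - 1) (map of_real (x # (b0 - x) # bs))))
     + 1/2 * (\<Sum>g1\<le>g. \<Sum>I\<in>Pow {..<length bs}.
          LINT x:{0..b0}|lborel.
             of_real (x * (b0 - x)) * stable_part V g1 (map of_real (x # nths bs I)) *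
             stable_part V (g - g1) (map of_real ((b0 - x) # nths bs (- I))))
     + 1/2 * (\<Sum>j<length bs.
          of_real (b0 + bs ! j) * stable_part V g (map of_real ((b0 + bs ! j) # nths bs (- {j})))
        + of_real (b0 - bs ! j) * stable_part V g (map of_real ((b0 - bs ! j) # nths bs (- {j})))))"
    (is "_ = 2 * of_real pi * (?Q + 1/2 * ?R + 1/2 * ?S)")
  proof -
    have eQ: "poly (shift_mean (smult ?\<delta> k1)) (of_real b0) = 2 * of_real pi * ?Q"
    proof -
      have st: "stable_part V (g - 1) (map of_real (x # (b0 - x) # bs)) =
          tensor poly D (of_real x # (of_real b0 - of_real x) # ?bs)" for x
        using D(3)[of "of_real x # (of_real b0 - of_real x) # ?bs"] by simp
      have "(LINT x:{0..b0}|lborel. of_real (x * (b0 - x)) * stable_part V (g - 1) (map of_real (x # (b0 - x) # bs))) =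
          poly (slice poly (contract D) ?bs) (of_real b0)"
        unfolding st using LINT_contract[OF D(1), of b0 ?bs] b0
          tensor_eq_slice[OF linear_in_poly_poly arity_contract[OF D(1)], of "of_real b0" ?bs]
        by simp
      then show ?thesis unfolding shift_mean_linear k1(2) by (simp only:) simp
    qed
    have eR: "poly (shift_mean (\<Sum>g1\<le>g. \<Sum>I\<in>Pow {..<length bs}. k2 g1 I)) (of_real b0) = 2 * of_real pi * ?R"
    proof -
      have "(LINT x:{0..b0}|lborel.
             of_real (x * (b0 - x)) * stable_part V g1 (map of_real (x # nths bs I)) *
             stable_part V (g - g1) (map of_real ((b0 - x) # nths bs (- I)))) =
          poly (conv1 (W g1 (nths ?bs I)) (W (g - g1) (nths ?bs (- I)))) (of_real b0)" for g1 I
        using poly_conv1_integral[of b0 "W g1 (nths ?bs I)" "W (g - g1) (nths ?bs (- I))"] b0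
        by (simp add: W flip: nths_map)
      then show ?thesis
        unfolding shift_mean_sum k2(2) poly_sum by (simp only: poly_smult sum_distrib_left)
    qed
    have eS: "poly (shift_mean (\<Sum>j<length bs. pcompose (k3 j) [:of_real (bs ! j), 1:] +
        pcompose (k3 j) [:- of_real (bs ! j), 1:])) (of_real b0) = 2 * of_real pi * ?S"
      unfolding shift_mean_sum poly_sum sum_distrib_left
    proof (intro sum.cong refl)
      fix j
      \<comment> \<open>Averaging over imaginary shifts commutes with translation by b_j.\<close>
      have s: "poly (shift_mean (pcompose (k3 j) [:d, 1:])) x = poly (shift_mean (k3 j)) (x + d)" for d x
        by (simp add: poly_shift_mean poly_pcompose algebra_simps)
      show "poly (shift_mean (pcompose (k3 j) [:of_real (bs ! j), 1:] + pcompose (k3 j) [:- of_real (bs ! j), 1:])) (of_real b0) =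
         2 * of_real pi * (of_real (b0 + bs ! j) * stable_part V g (map of_real ((b0 + bs ! j) # nths bs (- {j})))
        + of_real (b0 - bs ! j) * stable_part V g (map of_real ((b0 - bs ! j) # nths bs (- {j}))))"
        unfolding shift_mean_linear poly_add s k3(2) by (simp add: W distrib_left mult_ac flip: nths_map)
    qed
    show ?thesis
      unfolding R_def shift_mean_linear(1) poly_add eQ shift_mean_linear(2)[of "1/2"] poly_smult eR eS
      by (simp add: algebra_simps)
  qed
  ultimately have "2 * of_real pi * (1/2 * ((of_real b0 + 2 * of_real pi * \<i>) *
      stable_part V g ((of_real b0 + 2 * of_real pi * \<i>) # ?bs) +
      (of_real b0 - 2 * of_real pi * \<i>) * stable_part V g ((of_real b0 - 2 * of_real pi * \<i>) # ?bs))) =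
    2 * of_real pi * (?Q + 1/2 * ?R + 1/2 * ?S)" by (simp only:)
  then show "1/2 * ((of_real b0 + 2 * of_real pi * \<i>) *
      stable_part V g ((of_real b0 + 2 * of_real pi * \<i>) # ?bs) +
      (of_real b0 - 2 * of_real pi * \<i>) * stable_part V g ((of_real b0 - 2 * of_real pi * \<i>) # ?bs)) =
    ?Q + 1/2 * ?R + 1/2 * ?S"
    by (subst (asm) mult_cancel_left) simp
qed

theorem theorem1p6:
  fixes g n :: nat
  assumes "n \<ge> 1" and "2 * g + n \<ge> 4"
  shows "(\<forall>V F. super_volume_family V \<and> laplace_transform_family V F \<longrightarrow>
            (recursion_SW V g n \<longrightarrow> recursion_A F g n) \<and>
            (recursion_N V g n \<longrightarrow> recursion_B F g n)) \<and>
         (\<forall>F. symmetric_odd_inverse_family F \<longrightarrow>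
            (recursion_A F g n \<longleftrightarrow> recursion_B F g n))"
  using assms(1) recursion_A_iff_B laplace_family_symmetric_odd recursion_N_imp_B recursion_SW_imp_N
  by blast

end
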